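(* Let $\{P_{Y_iX_i}\}_{i\in[1:m]}$ and $\{Q_{Y_j^n}\}_{j\in[1:k]}$, $\{Q_{X_t^n}\}_{t\in[1:r]}$ satisfy the standing assumption (A) or (B) of the context. Let $\nu_i>0$, $\sum_{i=1}^m\nu_i=1$, and $\tau_{jt}\ge 0$, $\sum_{j,t}\tau_{jt}=1$, with $\tau_{j_i^\star t_s^\star}>0$ for every $s$ and every $i\in\mathfrak F_s$, and put $$P_{Y^nX^n}=\sum_{i=1}^m\nu_iP_{Y_iX_i}^{\otimes n},\qquad Q_{Y^nX^n}=\sum_{j,t}\tau_{jt}\,Q_{Y_j^n}\times Q_{X_t^n}.$$ Let $E^\star_{\mathrm{mix},\epsilon}(R_c)$ be the maximum $\epsilon$-achievable error exponent at rate $R_c$ for testing $P_{Y^nX^n}$ against $Q_{Y^nX^n}$ with one-sided compression. For a given $R_c>0$ let $\mathcal S=\{s:\theta_s(R_c)<\min_{i\in\mathfrak F_s}\xi_i(R_c)\}$. If $\epsilon\in[0,1)$ satisfies $$\epsilon<\min_{i\in[1:m]}\nu_i\times\min\Big\{\min_{s\in\mathcal S}\frac1{|\mathfrak F_s|},\,1\Big\}$$ (with the convention $\min_{s\in\varnothing}(\cdot)=+\infty$), then $$E^\star_{\mathrm{mix},\epsilon}(R_c)=\min_{s\in[1:|\mathcal P_{\mathcal X}|]}\theta_s(R_c).$$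
   Context: Conventions: all alphabets are finite, $\log$ is natural, $[a:b]=\{a,\dots,b\}$, $P^{\otimes n}$ is the $n$-fold product, $P\ll Q$ is absolute continuity, $D(\cdot\Vert\cdot)$ is relative entropy ($+\infty$ if $P\not\ll Q$), $I$ is mutual information. Data: $P_{Y_iX_i}$, $i\in[1:m]$, are distributions on $\mathcal Y\times\mathcal X$ with marginals $P_{Y_i},P_{X_i}$; for each $n$, $Q_{Y_j^n}$ ($j\in[1:k]$) are distributions on $\mathcal Y^n$ and $Q_{X_t^n}$ ($t\in[1:r]$) distributions on $\mathcal X^n$. $\mathcal P_{\mathcal X}=\{P_{\mathcal X,1},\dots,P_{\mathcal X,|\mathcal P_{\mathcal X}|}\}$ is the set of distinct distributions among the $P_{X_i}$, and $\mathfrak F_s=\{i: P_{X_i}=P_{\mathcal X,s}\}$. Standing assumption: one of the following holds. (A) $Q_{X_t^n}=Q_{X_t}^{\otimes n}$ and $Q_{Y_j^n}=Q_{Y_j}^{\otimes n}$ for all $t,j$; $\min_jD(P_{Y_i}\Vert Q_{Y_j})<\infty$ for all $i$; $\min_tD(P_{\mathcal X,s}\Vert Q_{X_t})<\infty$ for all $s$. Define $j_i^\star=\arg\min_jD(P_{Y_i}\Vert Q_{Y_j})$, $d_i^{\mathrm y}=D(P_{Y_i}\Vert Q_{Y_{j_i^\star}})$, $t_s^\star=\arg\min_tD(P_{\mathcal X,s}\Vert Q_{X_t})$, $d_s^{\mathrm x}=D(P_{\mathcal X,s}\Vert Q_{X_{t_s^\star}})$. (B) For all $t,j$, $(Q_{X_t^n})_n$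 and $(Q_{Y_j^n})_n$ are the $n$-dimensional marginals of Markov processes of finite order with stationary (time-invariant) transition probabilities; for all $n$, $P_{\mathcal X,s}^{\otimes n}\ll Q_{X_t^n}$ for all $(s,t)$ and $P_{Y_i}^{\otimes n}\ll Q_{Y_j^n}$ for all $(i,j)$. Let $A_X^{(st)}=\lim_n[D(P_{\mathcal X,s}^{\otimes(n+1)}\Vert Q_{X_t^{n+1}})-D(P_{\mathcal X,s}^{\otimes n}\Vert Q_{X_t^n})]$ and $A_Y^{(ij)}=\lim_n[D(P_{Y_i}^{\otimes(n+1)}\Vert Q_{Y_j^{n+1}})-D(P_{Y_i}^{\otimes n}\Vert Q_{Y_j^n})]$ (these limits exist); assume $\min_jA_Y^{(ij)}<\infty$ for all $i$ and $\min_tA_X^{(st)}<\infty$ for all $s$. Define $j_i^\star=\arg\min_jA_Y^{(ij)}$, $d_i^{\mathrm y}=A_Y^{(ij_i^\star)}$, $t_s^\star=\arg\min_tA_X^{(st)}$, $d_s^{\mathrm x}=A_X^{(st_s^\star)}$. In both cases $\arg\min$ returns the first minimizer. Put $d_{is}^{\mathrm{yx}}=d_i^{\mathrm y}+d_s^{\mathrm x}$ for $i\in\mathfrak F_s$. Rate functions: for $i\in\mathfrak F_s$ let $(\bar Y_i,\bar X_s)\sim P_{Y_i|X_i}\times P_{\mathcal X,s}$ (i.e. $P_{Y_iX_i}$); a kernel $P_{U|\bar X_s}$ (with $U$ in a finite alphabet) defines $U$ with $\bar Y_i-\bar X_s-U$ Markov. Then $$\xi_i(R_c)=\max_{P_{U|\bar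 X_s}:\,I(\bar X_s;U)\le R_c}I(\bar Y_i;U)+d_{is}^{\mathrm{yx}}\ (i\in\mathfrak F_s),\qquad \theta_s(R_c)=\max_{P_{U|\bar X_s}:\,I(\bar X_s;U)\le R_c}\ \min_{i\in\mathfrak F_s}[I(\bar Y_i;U)+d_{is}^{\mathrm{yx}}].$$ Testing schemes: a testing scheme is a pair $(\phi_n,\psi_n)$ with $\phi_n:\mathcal X^n\to\mathcal M$ ($\mathcal M=\mathcal M_n$ a finite set, $|\phi_n|:=|\mathcal M|$) and a possibly randomized decision map $\psi_n:\mathcal Y^n\times\mathcal M\to\{0,1\}$ (output $0$ means deciding the null hypothesis). For a distribution $P$ on $\mathcal Y^n\times\mathcal M$, $P(\psi_n)$ is the probability that $\psi_n$ outputs $0$ and $P(1-\psi_n)=1-P(\psi_n)$. $P_{Y^n\phi_n(X^n)}$, $Q_{Y^n\phi_n(X^n)}$ denote the laws of $(Y^n,\phi_n(X^n))$ under $P_{Y^nX^n}$, $Q_{Y^nX^n}$. Put $\alpha_n=P_{Y^n\phi_n(X^n)}(1-\psi_n)$, $\beta_n=Q_{Y^n\phi_n(X^n)}(\psi_n)$. $E$ is $\epsilon$-achievable at rate $R_c$ if there is a sequence of testing schemes with $\limsup_n\alpha_n\le\epsilon$, $\liminf_n\frac1n\log\frac1{\beta_n}\ge E$, $\limsup_n\frac1n\log|\phi_n|\le R_c$; $E^\star_{\mathrm{mix},\epsilon}(R_c)$ is the supremum of $\epsilon$-achievable $E$. *)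

theory Defs
  imports "HOL-Probability.Probability"
begin

abbreviation abs_cont :: "'a pmf \<Rightarrow> 'a pmf \<Rightarrow> bool" (infix \<open>\<lless>\<close> 50) where
  "p \<lless> q \<equiv> absolutely_continuous (measure_pmf q) (measure_pmf p)"

text \<open>
  Logarithms are natural throughout (base \<^term>\<open>exp 1\<close>).
  The library function \<^term>\<open>KL_divergence\<close> takes the reference measure first and is
  real-valued; the value \<open>\<infinity>\<close> has to be added by hand.
\<close>

definition rel_entropy :: "'a pmf \<Rightarrow> 'a pmf \<Rightarrow> ereal" where
  "rel_entropy p q =
     (if p \<lless> q then ereal (KL_divergence (exp 1) (measure_pmf q) (measure_pmf p)) else \<infinity>)"

definition mutual_info :: "('a \<times> 'b) pmf \<Rightarrow> real" where
  "mutual_info p =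
     prob_space.mutual_information (measure_pmf p) (exp 1) (count_space UNIV) (count_space UNIV) fst snd"

text \<open>
  Words of length \<open>n\<close> are lists of length \<open>n\<close>. The n-fold product of \<open>p\<close> is
  \<^term>\<open>replicate_pmf n p\<close>; for a joint law of \<open>(Y, X)\<close> we regroup the \<open>n\<close> pairs into the
  pair of words \<open>(Y\<^sup>n, X\<^sup>n)\<close>.
\<close>

definition iid_pair :: "nat \<Rightarrow> ('y \<times> 'x) pmf \<Rightarrow> ('y list \<times> 'x list) pmf" where
  "iid_pair n p = map_pmf (\<lambda>zs. (map fst zs, map snd zs)) (replicate_pmf n p)"

text \<open>
  \<open>q n\<close> is the law of the first \<open>n\<close> letters of a Markov process of order \<open>d\<close>. The laws are
  consistent, and for \<open>n \<ge> d\<close> the next letter is drawn, given the past, from a kernel \<open>K\<close> that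
  depends on the last \<open>d\<close> letters only and not on \<open>n\<close>. The law of the first \<open>d\<close> letters is
  arbitrary; the process itself need not be stationary.
\<close>

definition markov_marginals :: "nat \<Rightarrow> (nat \<Rightarrow> 'a list pmf) \<Rightarrow> bool" where
  "markov_marginals d q \<longleftrightarrow>
     (\<forall>n. set_pmf (q n) \<subseteq> {xs. length xs = n}) \<and>
     (\<forall>n. map_pmf butlast (q (Suc n)) = q n) \<and>
     (\<exists>K :: 'a list \<Rightarrow> 'a pmf. \<forall>n\<ge>d.
        q (Suc n) = do {xs \<leftarrow> q n; x \<leftarrow> K (drop (n - d) xs); return_pmf (xs @ [x])})"

text \<open>
  Let \<open>p i\<close>, \<open>i \<in> I\<close>, be single-letter laws and \<open>q j\<close>, \<open>j \<in> J\<close>, sequences of laws of words.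
  The two predicates below are the two kinds of assumptions on such families; in each of them
  \<open>D i j\<close> is the associated divergence (rate) of \<open>p i\<close> from \<open>q j\<close>.
\<close>

definition iid_family ::
  "nat set \<Rightarrow> nat set \<Rightarrow> (nat \<Rightarrow> 'a pmf) \<Rightarrow> (nat \<Rightarrow> nat \<Rightarrow> 'a list pmf) \<Rightarrow> (nat \<Rightarrow> nat \<Rightarrow> ereal) \<Rightarrow> bool"
where
  "iid_family I J p q D \<longleftrightarrow>
     (\<exists>q1. (\<forall>j\<in>J. \<forall>n. q j n = replicate_pmf n (q1 j)) \<and>
           (\<forall>i\<in>I. \<forall>j\<in>J. D i j = rel_entropy (p i) (q1 j))) \<and>
     (\<forall>i\<in>I. (MIN j\<in>J. D i j) < \<infinity>)"

definition markov_family ::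
  "nat set \<Rightarrow> nat set \<Rightarrow> (nat \<Rightarrow> 'a pmf) \<Rightarrow> (nat \<Rightarrow> nat \<Rightarrow> 'a list pmf) \<Rightarrow> (nat \<Rightarrow> nat \<Rightarrow> ereal) \<Rightarrow> bool"
where
  "markov_family I J p q D \<longleftrightarrow>
     (\<forall>j\<in>J. \<exists>d. markov_marginals d (q j)) \<and>
     (\<forall>i\<in>I. \<forall>j\<in>J. \<forall>n. replicate_pmf n (p i) \<lless> q j n) \<and>
     (\<forall>i\<in>I. \<forall>j\<in>J. D i j =
        lim (\<lambda>n. rel_entropy (replicate_pmf (Suc n) (p i)) (q j (Suc n))
               - rel_entropy (replicate_pmf n (p i)) (q j n))) \<and>
     (\<forall>i\<in>I. (MIN j\<in>J. D i j) < \<infinity>)"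

definition first_argmin :: "nat set \<Rightarrow> (nat \<Rightarrow> 'a::linorder) \<Rightarrow> nat" where
  "first_argmin J f = (LEAST j. j \<in> J \<and> (\<forall>j'\<in>J. f j \<le> f j'))"

text \<open>
  The auxiliary variable \<open>U\<close> ranges over finite alphabets of arbitrary size, encoded as finite
  sets of natural numbers.
\<close>

definition law_XU :: "'x pmf \<Rightarrow> ('x \<Rightarrow> nat pmf) \<Rightarrow> ('x \<times> nat) pmf" where
  "law_XU p K = do {x \<leftarrow> p; u \<leftarrow> K x; return_pmf (x, u)}"

definition law_YU :: "('y \<times> 'x) pmf \<Rightarrow> ('x \<Rightarrow> nat pmf) \<Rightarrow> ('y \<times> nat) pmf" where
  "law_YU p K = do {(y, x) \<leftarrow> p; u \<leftarrow> K x; return_pmf (y, u)}"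

definition kernels :: "'x pmf \<Rightarrow> real \<Rightarrow> ('x \<Rightarrow> nat pmf) set" where
  "kernels p R = {K. finite (\<Union>x. set_pmf (K x)) \<and> mutual_info (law_XU p K) \<le> R}"

definition xi :: "('y \<times> 'x) pmf \<Rightarrow> ereal \<Rightarrow> real \<Rightarrow> ereal" where
  "xi p d R = (SUP K\<in>kernels (map_pmf snd p) R. ereal (mutual_info (law_YU p K))) + d"

text \<open>
  \<open>theta F pX p d R\<close> is the joint rate function of the laws \<open>p i\<close> with offsets \<open>d i\<close>, \<open>i \<in> F\<close>,
  which share the \<open>X\<close>-marginal \<open>pX\<close>.
\<close>

definition theta ::
  "nat set \<Rightarrow> 'x pmf \<Rightarrow> (nat \<Rightarrow> ('y \<times> 'x) pmf) \<Rightarrow> (nat \<Rightarrow> ereal) \<Rightarrow> real \<Rightarrow> ereal"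
where
  "theta F pX p d R =
     (SUP K\<in>kernels pX R. MIN i\<in>F. ereal (mutual_info (law_YU (p i) K)) + d i)"

datatype hypothesis = H0 | H1

text \<open>
  The message set is a finite set of natural numbers, and a randomized decision map returns a
  distribution on the two hypotheses.
\<close>

type_synonym 'y decision_map = "'y list \<times> nat \<Rightarrow> hypothesis pmf"

definition compressed :: "('x list \<Rightarrow> nat) \<Rightarrow> ('y list \<times> 'x list) pmf \<Rightarrow> ('y list \<times> nat) pmf" where
  "compressed \<phi> p = map_pmf (\<lambda>(y, x). (y, \<phi> x)) p"

definition accept_prob :: "('y list \<times> nat) pmf \<Rightarrow> 'y decision_map \<Rightarrow> real" where
  "accept_prob p \<psi> = pmf (bind_pmf p \<psi>) H0"

definition type_I_error ::
  "('y list \<times> 'x list) pmf \<Rightarrow> ('x list \<Rightarrow> nat) \<Rightarrow> 'y decision_map \<Rightarrow> real" where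
  "type_I_error p \<phi> \<psi> = 1 - accept_prob (compressed \<phi> p) \<psi>"

definition type_II_error ::
  "('y list \<times> 'x list) pmf \<Rightarrow> ('x list \<Rightarrow> nat) \<Rightarrow> 'y decision_map \<Rightarrow> real" where
  "type_II_error q \<phi> \<psi> = accept_prob (compressed \<phi> q) \<psi>"

text \<open>\<open>(1/n) log (1/\<beta>)\<close>, which is \<open>\<infinity>\<close> for \<open>\<beta> = 0\<close>.\<close>

definition exponent :: "nat \<Rightarrow> real \<Rightarrow> ereal" where
  "exponent n \<beta> = (if \<beta> = 0 then \<infinity> else ereal (1 / real n * ln (1 / \<beta>)))"

definition achievable ::
  "(nat \<Rightarrow> ('y list \<times> 'x list) pmf) \<Rightarrow> (nat \<Rightarrow> ('y list \<times> 'x list) pmf) \<Rightarrow> real \<Rightarrow> real \<Rightarrow> real \<Rightarrow> bool"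
where
  "achievable p q \<epsilon> R E \<longleftrightarrow>
     (\<exists>(M :: nat \<Rightarrow> nat set) (\<phi> :: nat \<Rightarrow> 'x list \<Rightarrow> nat) (\<psi> :: nat \<Rightarrow> 'y decision_map).
        (\<forall>n. finite (M n) \<and> \<phi> n ` {x. length x = n} \<subseteq> M n) \<and>
        limsup (\<lambda>n. ereal (type_I_error (p n) (\<phi> n) (\<psi> n))) \<le> ereal \<epsilon> \<and>
        liminf (\<lambda>n. exponent n (type_II_error (q n) (\<phi> n) (\<psi> n))) \<ge> ereal E \<and>
        limsup (\<lambda>n. ereal (1 / real n * ln (real (card (M n))))) \<le> ereal R)"

definition E_star ::
  "(nat \<Rightarrow> ('y list \<times> 'x list) pmf) \<Rightarrow> (nat \<Rightarrow> ('y list \<times> 'x list) pmf) \<Rightarrow> real \<Rightarrow> real \<Rightarrow> ereal"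
where
  "E_star p q \<epsilon> R = (SUP E\<in>{E. achievable p q \<epsilon> R E}. ereal E)"

end

theory Submission
  imports Defs "HOL-Real_Asymp.Real_Asymp"
begin

text \<open>
  Achievability: mixing an erasure into a test channel makes the rate constraint strict. A greedily
  chosen codebook then covers the typical words of each marginal, the encoder also announces which
  marginal it believes in, and the decoder accepts if the information density of \<open>(Y\<^sup>n, U\<^sup>n)\<close>
  is large for some component with this marginal. Both reference laws enter only through the fact
  that their log-likelihood ratios to the product laws concentrate at the divergence rate.

  Converse: since the sum of the type I errors over the components with a common marginal stays
  below \<open>1\<close>, a set of words \<open>x\<^sup>n\<close> of non-vanishing probability is accepted with non-vanishing
  conditional probability under all these components at once. Conditioning \<open>X\<^sup>n\<close> on this set
  costs \<open>O(1)\<close> in divergence and keeps the channels memoryless; pumping up the acceptance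
  function by a noise operator turns the non-vanishing acceptance probability into a lower bound on
  a divergence, which is then single-letterized. The resulting test channel has almost the correct
  input law and almost the correct rate, and both defects are repaired by mixing.
\<close>

text \<open>Since \<epsilon> is fixed and does not vanish, a Fano-type bound is too weak: a strong
  converse is required, and it must hold for several channels fed by one and the same message. The
  threshold on \<epsilon> makes this possible. If \<epsilon> < \<nu>_i c for all i, each component
  on its own has type I error below c, and |F_s| c < 1 is what the union bound over F_s asks for. If
  theta_s reaches the smallest xi_i, a single component suffices and c < 1 is enough; this explains
  the set \<open>S\<close>. The reference law mixes products of a Y-law and an X-law. The change to
  the product of the marginals is therefore made in each coordinate separately, and the two
  divergence rates simply add to I(Y;U). Test channels are replaced by laws of posteriors because
  both informations are linear in such a law. Time sharing, averaging over messages, erasure and the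
  repair of the input law all become mixtures, and the informations keep their meaning while the
  barycentre is still wrong, as it is after conditioning on an accepted set.\<close>

abbreviation expct :: "'a pmf \<Rightarrow> ('a \<Rightarrow> real) \<Rightarrow> real" where
  "expct p f \<equiv> measure_pmf.expectation p f"

abbreviation prb :: "'a pmf \<Rightarrow> 'a set \<Rightarrow> real" where
  "prb p A \<equiv> measure_pmf.prob p A"

section \<open>Finitely supported expectations\<close>

lemma expct_sum:
  assumes "finite A" "set_pmf p \<subseteq> A"
  shows "expct p f = (\<Sum>x\<in>A. pmf p x * f x)"
  using assms by (subst integral_measure_pmf[of A]) auto

lemma expct_cong:
  assumes "p = q" "\<And>x. x \<in> set_pmf q \<Longrightarrow> f x = g x"
  shows "expct p f = expct q g"
  using assms by (auto intro!: integral_cong_AE simp: AE_measure_pmf_iff)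

lemma expct_mono:
  assumes "finite (set_pmf p)" "\<And>x. x \<in> set_pmf p \<Longrightarrow> f x \<le> g x"
  shows "expct p f \<le> expct p g"
  using assms by (auto intro!: integral_mono_AE integrable_measure_pmf_finite simp: AE_measure_pmf_iff)

lemma expct_const_le:
  assumes "finite (set_pmf p)" "\<And>x. x \<in> set_pmf p \<Longrightarrow> f x \<le> c"
  shows "expct p f \<le> c"
  using expct_mono[of p f "\<lambda>_. c"] assms by simp

lemma expct_const_ge:
  assumes "finite (set_pmf p)" "\<And>x. x \<in> set_pmf p \<Longrightarrow> c \<le> f x"
  shows "c \<le> expct p f"
  using expct_mono[of p "\<lambda>_. c" f] assms by simp

lemma expct_nonneg:
  assumes "\<And>x. x \<in> set_pmf p \<Longrightarrow> 0 \<le> f x"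
  shows "0 \<le> expct p f"
  using assms by (auto intro!: integral_nonneg_AE simp: AE_measure_pmf_iff)

lemma expct_add:
  "finite (set_pmf p) \<Longrightarrow> expct p (\<lambda>x. f x + g x) = expct p f + expct p g"
  by (simp add: integrable_measure_pmf_finite)

lemma expct_diff:
  "finite (set_pmf p) \<Longrightarrow> expct p (\<lambda>x. f x - g x) = expct p f - expct p g"
  by (simp add: integrable_measure_pmf_finite)

lemma expct_setsum:
  "finite (set_pmf p) \<Longrightarrow> expct p (\<lambda>x. \<Sum>i\<in>I. f i x) = (\<Sum>i\<in>I. expct p (f i))"
  by (simp add: integrable_measure_pmf_finite)

lemma expct_bind:
  assumes "finite (set_pmf p)" "\<And>x. x \<in> set_pmf p \<Longrightarrow> finite (set_pmf (f x))"
  shows "expct (bind_pmf p f) g = expct p (\<lambda>x. expct (f x) g)"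
proof -
  define B where "B = (\<Union>x\<in>set_pmf p. set_pmf (f x))"
  have B: "finite B" using assms by (auto simp: B_def)
  have "expct (bind_pmf p f) g = (\<Sum>y\<in>B. pmf (bind_pmf p f) y * g y)"
    by (rule expct_sum[OF B]) (auto simp: B_def set_bind_pmf)
  also have "\<dots> = (\<Sum>y\<in>B. (\<Sum>x\<in>set_pmf p. pmf p x * pmf (f x) y) * g y)"
    using assms by (simp add: pmf_bind expct_sum)
  also have "\<dots> = (\<Sum>x\<in>set_pmf p. pmf p x * (\<Sum>y\<in>B. pmf (f x) y * g y))"
    by (simp add: sum_distrib_left sum_distrib_right sum.swap[of _ B] mult.assoc)
  also have "\<dots> = (\<Sum>x\<in>set_pmf p. pmf p x * expct (f x) g)"
  proof (rule sum.cong[OF refl])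
    fix x assume "x \<in> set_pmf p"
    then have "expct (f x) g = (\<Sum>y\<in>B. pmf (f x) y * g y)"
      by (intro expct_sum[OF B]) (auto simp: B_def)
    then show "pmf p x * (\<Sum>y\<in>B. pmf (f x) y * g y) = pmf p x * expct (f x) g" by simp
  qed
  also have "\<dots> = expct p (\<lambda>x. expct (f x) g)"
    using assms by (simp add: expct_sum)
  finally show ?thesis .
qed

lemma expct_indicator: "expct p (indicator A) = prb p A"
  by simp

lemma expct_swap:
  assumes "finite (set_pmf p)" "finite (set_pmf q)"
  shows "expct p (\<lambda>x. expct q (\<lambda>y. g x y)) = expct q (\<lambda>y. expct p (\<lambda>x. g x y))"
  using assms by (simp add: expct_sum sum_distrib_left sum.swap[of _ "set_pmf p"] mult_ac)

lemma prb_bind: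
  assumes "finite (set_pmf p)" "\<And>x. x \<in> set_pmf p \<Longrightarrow> finite (set_pmf (f x))"
  shows "prb (bind_pmf p f) A = expct p (\<lambda>x. prb (f x) A)"
  using expct_bind[of p f "indicator A"] assms by simp

lemma markov_ineq:
  assumes "finite (set_pmf p)" "\<And>x. x \<in> set_pmf p \<Longrightarrow> 0 \<le> f x" "0 < t"
  shows "prb p {x. t \<le> f x} \<le> expct p f / t"
proof -
  have "t * prb p {x. t \<le> f x} = expct p (\<lambda>x. t * indicator {x. t \<le> f x} x)"
    by simp
  also have "\<dots> \<le> expct p f"
    using assms by (intro expct_mono) (auto simp: indicator_def)
  finally show ?thesis using assms by (simp add: field_simps)
qed

lemma prb_mono_supp:
  assumes "\<And>x. x \<in> set_pmf p \<Longrightarrow> x \<in> A \<Longrightarrow> x \<in> B"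
  shows "prb p A \<le> prb p B"
  using assms by (intro measure_pmf.finite_measure_mono_AE) (auto simp: AE_measure_pmf_iff)

lemma prb_compl: "prb p (- A) = 1 - prb p A"
  using measure_pmf.prob_compl[of A p] by (simp add: Compl_eq_Diff_UNIV)

lemma prb_Un_le: "prb p (A \<union> B) \<le> prb p A + prb p B"
  by (rule measure_Un_le) auto

text \<open>Disintegration along the fibres of \<open>f\<close>. It is the source of the conditional
  laws below: the channel given the input letter, a word given its first letter, and the input word
  given the message.\<close>

lemma bind_cond_fibre: "bind_pmf (map_pmf f p) (\<lambda>a. cond_pmf p {x. f x = a}) = p"
proof (rule bind_cond_pmf_cancel)
  fix x y assume "x \<in> set_pmf (map_pmf f p)" "y \<in> set_pmf p" "f y = x"
  then show "measure (measure_pmf p) {y. f y = x} = measure (measure_pmf (map_pmf f p)) {x. f y = x}"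
    by (simp add: vimage_def)
qed auto

section \<open>Relative entropy\<close>

text \<open>A real-valued stand-in for relative entropy. It has this meaning only if the support of
  \<open>p\<close> lies in that of \<open>q\<close>; the infinite value is added back in
  \<open>rel_entropy_eq_kl\<close>.\<close>

definition kl :: "'a pmf \<Rightarrow> 'a pmf \<Rightarrow> real" where
  "kl p q = expct p (\<lambda>x. ln (pmf p x / pmf q x))"

lemma abs_cont_iff: "p \<lless> q \<longleftrightarrow> set_pmf p \<subseteq> set_pmf q"
proof
  assume *: "p \<lless> q"
  show "set_pmf p \<subseteq> set_pmf q"
  proof
    fix x assume x: "x \<in> set_pmf p"
    show "x \<in> set_pmf q"
    proof (rule ccontr)
      assume "x \<notin> set_pmf q"
      then have "{x} \<in> null_sets (measure_pmf q)"
        by (auto simp: null_sets_def emeasure_pmf_single pmf_eq_0_set_pmf)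
      then have "{x} \<in> null_sets (measure_pmf p)"
        using * by (auto simp: absolutely_continuous_def)
      then show False using x by (auto simp: null_sets_def emeasure_pmf_single set_pmf_iff)
    qed
  qed
next
  assume *: "set_pmf p \<subseteq> set_pmf q"
  show "p \<lless> q"
    unfolding absolutely_continuous_def
  proof
    fix A assume "A \<in> null_sets (measure_pmf q)"
    then have "AE x in measure_pmf q. x \<notin> A" by (rule AE_not_in)
    then have "AE x in measure_pmf p. x \<notin> A" using * by (auto simp: AE_measure_pmf_iff)
    then show "A \<in> null_sets (measure_pmf p)" by (simp add: AE_iff_null_sets)
  qed
qed

text \<open>Densities with respect to the counting measure turn the library notion into an
  expectation of a logarithm; countability makes that measure sigma-finite, as the density formula
  demands.\<close>

lemma KL_divergence_pmf:
  fixes p q :: "'a::countable pmf"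
  assumes "set_pmf p \<subseteq> set_pmf q"
  shows "KL_divergence (exp 1) (measure_pmf q) (measure_pmf p) = kl p q"
proof -
  interpret sigma_finite_measure "count_space (UNIV :: 'a set)"
    by (rule sigma_finite_measure_count_space)
  have "KL_divergence (exp 1) (measure_pmf q) (measure_pmf p) =
    (\<integral>x. pmf p x * log (exp 1) (pmf p x / pmf q x) \<partial>count_space UNIV)"
    unfolding measure_pmf_eq_density
    by (rule KL_density_density) (use assms in \<open>auto simp: AE_count_space pmf_eq_0_set_pmf\<close>)
  also have "\<dots> = kl p q"
    unfolding kl_def measure_pmf_eq_density
    by (subst integral_density) (auto simp: log_def)
  finally show ?thesis .
qed

lemma rel_entropy_eq_kl:
  fixes p q :: "'a::countable pmf"
  shows "rel_entropy p q = (if set_pmf p \<subseteq> set_pmf q then ereal (kl p q) else \<infinity>)"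
  by (simp add: rel_entropy_def abs_cont_iff KL_divergence_pmf)

text \<open>The Donsker--Varadhan bound, linearised by \<open>ln b \<le> b / c - 1 + ln c\<close>.\<close>

lemma gibbs_variational:
  assumes fin: "finite (set_pmf p)" "finite (set_pmf q)" and sub: "set_pmf p \<subseteq> set_pmf q"
    and pos: "\<And>x. x \<in> set_pmf p \<Longrightarrow> 0 < g x" and nn: "\<And>x. x \<in> set_pmf q \<Longrightarrow> 0 \<le> g x"
    and c: "0 < c"
  shows "expct p (\<lambda>x. ln (g x)) \<le> kl p q + expct q g / c - 1 + ln c"
proof -
  have "expct p (\<lambda>x. ln (g x)) \<le>
    expct p (\<lambda>x. ln (pmf p x / pmf q x) + (g x * pmf q x / (pmf p x) / c) + (ln c - 1))"
  proof (rule expct_mono[OF fin(1)])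
    fix x assume x: "x \<in> set_pmf p"
    have pp: "0 < pmf p x" "0 < pmf q x" "0 < g x"
      using x sub pos by (auto simp: pmf_positive)
    have "ln (g x * pmf q x / pmf p x / c) \<le> g x * pmf q x / pmf p x / c - 1"
      using pp c by (intro ln_le_minus_one) auto
    moreover have "ln (g x * pmf q x / pmf p x / c) = ln (g x) - ln (pmf p x / pmf q x) - ln c"
      using pp c by (simp add: ln_div ln_mult)
    ultimately show "ln (g x) \<le> ln (pmf p x / pmf q x) + g x * pmf q x / pmf p x / c + (ln c - 1)"
      by simp
  qed
  also have "\<dots> = kl p q + expct p (\<lambda>x. g x * pmf q x / pmf p x / c) + (ln c - 1)"
    unfolding kl_def using fin by (simp add: expct_add)
  also have "expct p (\<lambda>x. g x * pmf q x / pmf p x / c) = (\<Sum>x\<in>set_pmf p. pmf q x * g x) / c"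
    using fin by (subst expct_sum[of "set_pmf p"])
      (auto simp: sum_divide_distrib pmf_eq_0_set_pmf intro!: sum.cong)
  also have "(\<Sum>x\<in>set_pmf p. pmf q x * g x) \<le> (\<Sum>x\<in>set_pmf q. pmf q x * g x)"
    using fin sub nn by (intro sum_mono2) auto
  also have "\<dots> = expct q g"
    using fin by (simp add: expct_sum)
  finally show ?thesis using c by (simp add: divide_right_mono)
qed

lemma kl_nonneg:
  assumes "finite (set_pmf p)" "finite (set_pmf q)" "set_pmf p \<subseteq> set_pmf q"
  shows "0 \<le> kl p q"
  using gibbs_variational[OF assms, of "\<lambda>_. 1" 1] by simp

lemma kl_self [simp]: "kl p p = 0"
  unfolding kl_def using expct_cong[of p p "\<lambda>x. ln (pmf p x / pmf p x)" "\<lambda>_. 0"]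
  by (simp add: set_pmf_iff)

text \<open>Conditioning on an event of probability \<open>b\<close> produces a density of at most
  1/b, so by this bound it costs at most ln (1/b) in divergence.\<close>

lemma kl_le_of_pmf_le:
  assumes fin: "finite (set_pmf p)" and c: "0 < c"
    and le: "\<And>x. x \<in> set_pmf p \<Longrightarrow> pmf p x \<le> c * pmf q x"
  shows "kl p q \<le> ln c"
  unfolding kl_def
proof (rule expct_const_le[OF fin])
  fix x assume x: "x \<in> set_pmf p"
  then have "0 < pmf p x" by (simp add: pmf_positive)
  moreover have "pmf p x \<le> c * pmf q x" using le x by simp
  ultimately have "0 < pmf q x" using c by (smt (verit) zero_less_mult_pos)
  then show "ln (pmf p x / pmf q x) \<le> ln c"
    using \<open>0 < pmf p x\<close> le[OF x] c by (simp add: field_simps)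
qed

section \<open>Product laws on words\<close>

text \<open>The factors may differ from letter to letter, as they do for the output of a memoryless
  channel whose input word is given.\<close>

primrec prod_pmfs :: "'a pmf list \<Rightarrow> 'a list pmf" where
  "prod_pmfs [] = return_pmf []"
| "prod_pmfs (p # ps) = do {x \<leftarrow> p; xs \<leftarrow> prod_pmfs ps; return_pmf (x # xs)}"

lemma prod_pmfs_replicate: "prod_pmfs (replicate n p) = replicate_pmf n p"
  by (induction n) auto

lemma set_prod_pmfs: "set_pmf (prod_pmfs ps) = {xs. list_all2 (\<lambda>x p. x \<in> set_pmf p) xs ps}"
proof (induction ps)
  case (Cons p ps)
  show ?case
    by (auto simp: set_bind_pmf Cons list_all2_Cons2)
qed auto

lemma length_prod_pmfs: "xs \<in> set_pmf (prod_pmfs ps) \<Longrightarrow> length xs = length ps"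
  by (auto simp: set_prod_pmfs dest: list_all2_lengthD)

lemma length_replicate_pmf: "xs \<in> set_pmf (replicate_pmf n p) \<Longrightarrow> length xs = n"
  by (auto simp: set_replicate_pmf)

lemma finite_set_prod_pmfs:
  "(\<And>p. p \<in> set ps \<Longrightarrow> finite (set_pmf p)) \<Longrightarrow> finite (set_pmf (prod_pmfs ps))"
  by (induction ps) (auto simp: set_bind_pmf)

lemma finite_set_prod_pmfs' [simp]:
  fixes ps :: "'a::finite pmf list"
  shows "finite (set_pmf (prod_pmfs ps))"
  by (rule finite_set_prod_pmfs) auto

lemma finite_set_replicate_pmf [simp]:
  "finite (set_pmf p) \<Longrightarrow> finite (set_pmf (replicate_pmf n p))"
  unfolding prod_pmfs_replicate[symmetric] by (rule finite_set_prod_pmfs) auto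

lemma pmf_bind_Cons:
  "pmf (do {x \<leftarrow> p; xs \<leftarrow> q; return_pmf (x # xs)}) (x # xs) = pmf p x * pmf q xs"
proof -
  have *: "do {x \<leftarrow> p; xs \<leftarrow> q; return_pmf (x # xs)} = map_pmf (\<lambda>(x, xs). x # xs) (pair_pmf p q)"
    by (simp add: pair_pmf_def map_bind_pmf)
  have "inj (\<lambda>(x, xs). x # xs)" by (auto simp: inj_def)
  from pmf_map_inj'[OF this, of "pair_pmf p q" "(x, xs)"] show ?thesis
    unfolding * by (simp add: pmf_pair)
qed

lemma pmf_prod_pmfs_Cons [simp]:
  "pmf (prod_pmfs (p # ps)) (x # xs) = pmf p x * pmf (prod_pmfs ps) xs"
  by (simp add: pmf_bind_Cons)

lemma pmf_replicate_pmf_Cons [simp]: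
  "pmf (replicate_pmf (Suc n) p) (x # xs) = pmf p x * pmf (replicate_pmf n p) xs"
  by (simp add: pmf_bind_Cons)

declare prod_pmfs.simps(2) [simp del] replicate_pmf.simps(2) [simp del]

lemma pmf_prod_pmfs_append:
  "length us = length ps \<Longrightarrow>
    pmf (prod_pmfs (ps @ qs)) (us @ vs) = pmf (prod_pmfs ps) us * pmf (prod_pmfs qs) vs"
  by (induction us ps rule: list_induct2) (auto simp: mult.assoc)

section \<open>Expectation and concentration under product laws\<close>

lemma expct_prod_pmfs_Cons:
  assumes "\<And>q. q \<in> set (p # ps) \<Longrightarrow> finite (set_pmf q)"
  shows "expct (prod_pmfs (p # ps)) f = expct p (\<lambda>x. expct (prod_pmfs ps) (\<lambda>xs. f (x # xs)))"
proof -
  have "finite (set_pmf (prod_pmfs ps))" "finite (set_pmf p)"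
    using assms by (auto intro: finite_set_prod_pmfs)
  then show ?thesis by (simp add: prod_pmfs.simps expct_bind set_bind_pmf)
qed

lemma expct_replicate_pmf_Suc:
  assumes "finite (set_pmf p)"
  shows "expct (replicate_pmf (Suc n) p) f = expct p (\<lambda>x. expct (replicate_pmf n p) (\<lambda>xs. f (x # xs)))"
  using expct_prod_pmfs_Cons[of p "replicate n p" f] assms
  by (simp flip: prod_pmfs_replicate replicate_Suc)

text \<open>An Efron-Stein type bound by induction on the first letter: the variance splits into the
  variance of the conditional mean \<open>g\<close> and the mean conditional variance. As
  \<open>g\<close> inherits the oscillation bound \<open>C\<close>, each letter contributes at most
  C^2. Only words of positive probability are compared, because log-likelihood ratios are controlled
  only there.\<close>

lemma bounded_diff_variance:
  assumes "\<And>p. p \<in> set ps \<Longrightarrow> finite (set_pmf p)"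
    and "\<And>us a b vs. us @ a # vs \<in> set_pmf (prod_pmfs ps) \<Longrightarrow> us @ b # vs \<in> set_pmf (prod_pmfs ps) \<Longrightarrow>
           \<bar>f (us @ a # vs) - f (us @ b # vs)\<bar> \<le> C"
  shows "expct (prod_pmfs ps) (\<lambda>xs. (f xs - expct (prod_pmfs ps) f)\<^sup>2) \<le> real (length ps) * C\<^sup>2"
  using assms
proof (induction ps arbitrary: f)
  case (Cons p ps)
  define Q where "Q = prod_pmfs ps"
  define g where "g = (\<lambda>a. expct Q (\<lambda>v. f (a # v)))"
  define \<mu> where "\<mu> = expct p g"
  have finp: "finite (set_pmf p)" and finQ: "finite (set_pmf Q)"
    using Cons.prems(1) by (auto simp: Q_def intro!: finite_set_prod_pmfs)
  have supp: "a # v \<in> set_pmf (prod_pmfs (p # ps)) \<longleftrightarrow> a \<in> set_pmf p \<and> v \<in> set_pmf Q" for a v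
    by (auto simp: set_prod_pmfs Q_def)
  have "g a - g b \<le> C" if "a \<in> set_pmf p" "b \<in> set_pmf p" for a b
  proof -
    have "g a - g b = expct Q (\<lambda>v. f (a # v) - f (b # v))"
      using finQ by (simp add: g_def expct_diff)
    also have "\<dots> \<le> C"
    proof (rule expct_const_le[OF finQ])
      fix v assume "v \<in> set_pmf Q"
      then have "\<bar>f ([] @ a # v) - f ([] @ b # v)\<bar> \<le> C"
        using that by (intro Cons.prems(2)) (auto simp: supp)
      then show "f (a # v) - f (b # v) \<le> C" by simp
    qed
    finally show ?thesis .
  qed
  then have g_C: "(g a - \<mu>)\<^sup>2 \<le> C\<^sup>2" if "a \<in> set_pmf p" for a
  proof -
    assume *: "\<And>a b. a \<in> set_pmf p \<Longrightarrow> b \<in> set_pmf p \<Longrightarrow> g a - g b \<le> C"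
    have "\<mu> \<le> g a + C" unfolding \<mu>_def
      using *[OF _ that] finp by (intro expct_const_le) (auto simp: algebra_simps)
    moreover have "g a - C \<le> \<mu>" unfolding \<mu>_def
      using *[OF that] finp by (intro expct_const_ge) (auto simp: algebra_simps)
    ultimately have "\<bar>g a - \<mu>\<bar> \<le> C" by linarith
    then show ?thesis by (meson abs_ge_zero abs_le_square_iff order_trans abs_ge_self)
  qed
  have mean: "expct (prod_pmfs (p # ps)) f = \<mu>"
    unfolding \<mu>_def g_def Q_def by (rule expct_prod_pmfs_Cons[OF Cons.prems(1)])
  have "expct Q (\<lambda>v. (f (a # v) - \<mu>)\<^sup>2) \<le> real (length ps) * C\<^sup>2 + C\<^sup>2" if a: "a \<in> set_pmf p" for a
  proof -
    have gQ: "expct Q (\<lambda>v. f (a # v)) = g a" by (simp add: g_def)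
    \<comment> \<open>The cross term has mean zero, \<open>g a\<close> being the conditional mean of
      \<open>f\<close> given the first letter \<open>a\<close>.\<close>
    have "expct Q (\<lambda>v. (f (a # v) - \<mu>)\<^sup>2) =
      expct Q (\<lambda>v. (f (a # v) - g a)\<^sup>2 + (2 * (g a - \<mu>) * (f (a # v) - g a) + (g a - \<mu>)\<^sup>2))"
      by (intro arg_cong[of _ _ "expct Q"]) (auto simp: fun_eq_iff power2_eq_square algebra_simps)
    also have "\<dots> = expct Q (\<lambda>v. (f (a # v) - g a)\<^sup>2) + (g a - \<mu>)\<^sup>2"
      using finQ gQ by (simp add: expct_add expct_diff)
    also have "expct Q (\<lambda>v. (f (a # v) - g a)\<^sup>2) \<le> real (length ps) * C\<^sup>2"
      unfolding g_def Q_def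
    proof (rule Cons.IH)
      show "finite (set_pmf p)" if "p \<in> set ps" for p using that Cons.prems(1) by auto
      fix us b c vs assume "us @ b # vs \<in> set_pmf (prod_pmfs ps)" "us @ c # vs \<in> set_pmf (prod_pmfs ps)"
      then show "\<bar>f (a # us @ b # vs) - f (a # us @ c # vs)\<bar> \<le> C"
        using Cons.prems(2)[of "a # us" b vs c] a by (auto simp: supp Q_def)
    qed
    finally show ?thesis using g_C[OF a] by linarith
  qed
  then have "expct p (\<lambda>a. expct Q (\<lambda>v. (f (a # v) - \<mu>)\<^sup>2)) \<le> real (length ps) * C\<^sup>2 + C\<^sup>2"
    by (rule expct_const_le[OF finp])
  moreover have "expct (prod_pmfs (p # ps)) (\<lambda>xs. (f xs - \<mu>)\<^sup>2) =
      expct p (\<lambda>a. expct Q (\<lambda>v. (f (a # v) - \<mu>)\<^sup>2))"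
    unfolding Q_def by (rule expct_prod_pmfs_Cons[OF Cons.prems(1)])
  ultimately show ?case
    unfolding mean by (simp add: algebra_simps)
qed simp

lemma bounded_diff_chebyshev:
  assumes "\<And>p. p \<in> set ps \<Longrightarrow> finite (set_pmf p)"
    and "\<And>us a b vs. us @ a # vs \<in> set_pmf (prod_pmfs ps) \<Longrightarrow> us @ b # vs \<in> set_pmf (prod_pmfs ps) \<Longrightarrow>
           \<bar>f (us @ a # vs) - f (us @ b # vs)\<bar> \<le> C"
    and t: "0 < t"
  shows "prb (prod_pmfs ps) {xs. t \<le> \<bar>f xs - expct (prod_pmfs ps) f\<bar>} \<le> real (length ps) * C\<^sup>2 / t\<^sup>2"
proof -
  have fin: "finite (set_pmf (prod_pmfs ps))" using assms(1) by (rule finite_set_prod_pmfs)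
  have *: "{xs. t \<le> \<bar>f xs - expct (prod_pmfs ps) f\<bar>} = {xs. t\<^sup>2 \<le> (f xs - expct (prod_pmfs ps) f)\<^sup>2}"
    using t abs_le_square_iff[of t] by auto
  have "prb (prod_pmfs ps) {xs. t\<^sup>2 \<le> (f xs - expct (prod_pmfs ps) f)\<^sup>2} \<le>
    expct (prod_pmfs ps) (\<lambda>xs. (f xs - expct (prod_pmfs ps) f)\<^sup>2) / t\<^sup>2"
    using fin t by (intro markov_ineq) auto
  also have "\<dots> \<le> real (length ps) * C\<^sup>2 / t\<^sup>2"
    by (intro divide_right_mono bounded_diff_variance assms(1,2)) auto
  finally show ?thesis unfolding * .
qed

section \<open>Divergence rates\<close>

text \<open>Half of the tolerance \<open>t\<close> absorbs the convergence of the normalized means;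
  the other half is left to Chebyshev with a variance of order n. The threshold \<open>n0\<close> is
  there for Markov laws, whose likelihood takes its regular form only from the order on.\<close>

lemma bounded_diff_lln:
  fixes h :: "nat \<Rightarrow> 'a list \<Rightarrow> real"
  assumes fin: "finite (set_pmf p)"
    and bd: "\<And>n us a b vs. n0 \<le> n \<Longrightarrow> us @ a # vs \<in> set_pmf (replicate_pmf n p) \<Longrightarrow>
      us @ b # vs \<in> set_pmf (replicate_pmf n p) \<Longrightarrow> \<bar>h n (us @ a # vs) - h n (us @ b # vs)\<bar> \<le> C"
    and mean: "(\<lambda>n. expct (replicate_pmf n p) (h n) / real n) \<longlonglongrightarrow> D"
    and t: "0 < t"
  shows "(\<lambda>n. prb (replicate_pmf n p) {xs. real n * t \<le> \<bar>h n xs - real n * D\<bar>}) \<longlonglongrightarrow> 0"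
proof (rule tendsto_sandwich)
  show "\<forall>\<^sub>F n in sequentially. 0 \<le> prb (replicate_pmf n p) {xs. real n * t \<le> \<bar>h n xs - real n * D\<bar>}"
    by simp
  show "(\<lambda>_. 0 :: real) \<longlonglongrightarrow> 0" by simp
  have "(\<lambda>n. 4 * C\<^sup>2 / t\<^sup>2 * (1 / real n)) \<longlonglongrightarrow> 4 * C\<^sup>2 / t\<^sup>2 * 0"
    by (intro tendsto_mult tendsto_const lim_1_over_n)
  then show "(\<lambda>n. 4 * C\<^sup>2 / t\<^sup>2 * (1 / real n)) \<longlonglongrightarrow> 0" by simp
  have "\<forall>\<^sub>F n in sequentially. dist (expct (replicate_pmf n p) (h n) / real n) D < t / 2"
    using mean t by (intro tendstoD) auto
  then show "\<forall>\<^sub>F n in sequentially.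
      prb (replicate_pmf n p) {xs. real n * t \<le> \<bar>h n xs - real n * D\<bar>} \<le> 4 * C\<^sup>2 / t\<^sup>2 * (1 / real n)"
    using eventually_ge_at_top[of n0] eventually_gt_at_top[of 0]
  proof eventually_elim
    case (elim n)
    define E where "E = expct (replicate_pmf n p) (h n)"
    have "\<bar>E / real n - D\<bar> < t / 2" using elim by (simp add: dist_real_def E_def)
    then have "\<bar>E / real n - D\<bar> * real n < t / 2 * real n"
      using elim by (intro mult_strict_right_mono) auto
    moreover have "\<bar>E / real n - D\<bar> * real n = \<bar>(E / real n - D) * real n\<bar>"
      by (simp add: abs_mult)
    moreover have "(E / real n - D) * real n = E - real n * D"
      using elim by (simp add: field_simps)
    ultimately have *: "\<bar>E - real n * D\<bar> < real n * (t / 2)" by (simp add: mult.commute)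
    have "prb (replicate_pmf n p) {xs. real n * t \<le> \<bar>h n xs - real n * D\<bar>} \<le>
        prb (replicate_pmf n p) {xs. real n * (t / 2) \<le> \<bar>h n xs - E\<bar>}"
    proof (rule prb_mono_supp)
      fix xs assume "xs \<in> {xs. real n * t \<le> \<bar>h n xs - real n * D\<bar>}"
      moreover have "real n * t = real n * (t / 2) + real n * (t / 2)" by simp
      ultimately show "xs \<in> {xs. real n * (t / 2) \<le> \<bar>h n xs - E\<bar>}"
        using * unfolding mem_Collect_eq by linarith
    qed
    also have "\<dots> \<le> real (length (replicate n p)) * C\<^sup>2 / (real n * (t / 2))\<^sup>2"
      unfolding E_def prod_pmfs_replicate[symmetric]
      by (rule bounded_diff_chebyshev)
        (use fin bd elim t in \<open>auto simp: prod_pmfs_replicate split: if_splits\<close>)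
    also have "\<dots> = 4 * C\<^sup>2 / t\<^sup>2 * (1 / real n)"
      using elim t by (simp add: power2_eq_square field_simps)
    finally show ?case .
  qed
qed

lemma finite_bounded_abs:
  fixes f :: "'a \<Rightarrow> real"
  assumes "finite A"
  obtains G where "0 \<le> G" "\<And>x. x \<in> A \<Longrightarrow> \<bar>f x\<bar> \<le> G"
proof
  show "0 \<le> (\<Sum>x\<in>A. \<bar>f x\<bar>)" by (simp add: sum_nonneg)
  show "\<bar>f x\<bar> \<le> (\<Sum>x\<in>A. \<bar>f x\<bar>)" if "x \<in> A" for x
    using assms that by (intro member_le_sum) auto
qed

lemma expct_sum_list:
  assumes "finite (set_pmf p)"
  shows "expct (replicate_pmf n p) (\<lambda>xs. sum_list (map f xs)) = real n * expct p f"
proof (induction n)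
  case (Suc n)
  have fin: "finite (set_pmf (replicate_pmf n p))" using assms by simp
  show ?case
    using assms Suc fin by (simp add: expct_replicate_pmf_Suc expct_add algebra_simps)
qed simp

lemma iid_lln:
  assumes fin: "finite (set_pmf p)" and t: "0 < t"
  shows "(\<lambda>n. prb (replicate_pmf n p)
    {xs. real n * t \<le> \<bar>sum_list (map f xs) - real n * expct p f\<bar>}) \<longlonglongrightarrow> 0"
proof -
  obtain G where G: "0 \<le> G" "\<And>x. x \<in> set_pmf p \<Longrightarrow> \<bar>f x\<bar> \<le> G"
    using finite_bounded_abs[OF fin] by blast
  show ?thesis
  proof (rule bounded_diff_lln[where ?n0.0 = 0 and C = "2 * G"])
    fix n us a b vs
    assume "us @ a # vs \<in> set_pmf (replicate_pmf n p)" "us @ b # vs \<in> set_pmf (replicate_pmf n p)"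
    then have "\<bar>f a\<bar> \<le> G" "\<bar>f b\<bar> \<le> G" by (auto intro!: G simp: set_replicate_pmf)
    then show "\<bar>sum_list (map f (us @ a # vs)) - sum_list (map f (us @ b # vs))\<bar> \<le> 2 * G" by simp
  next
    have "\<forall>\<^sub>F n in sequentially. expct p f = expct (replicate_pmf n p) (\<lambda>xs. sum_list (map f xs)) / real n"
      using eventually_gt_at_top[of 0] by eventually_elim (simp add: expct_sum_list fin)
    then show "(\<lambda>n. expct (replicate_pmf n p) (\<lambda>xs. sum_list (map f xs)) / real n) \<longlonglongrightarrow> expct p f"
      by (rule Lim_transform_eventually[OF tendsto_const])
  qed (use fin t in auto)
qed

text \<open>On \<open>heavy\<close> words \<open>q\<close> is too large compared with exp (- n c)
  p^n, which a code has to avoid; on \<open>light\<close> words it is too small, which the converse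
  has to avoid. Negated inequalities between products, rather than ratios, treat words of
  probability zero uniformly.\<close>

abbreviation heavy :: "nat \<Rightarrow> real \<Rightarrow> 'a pmf \<Rightarrow> 'a list pmf \<Rightarrow> 'a list set" where
  "heavy n c p q \<equiv> {xs. \<not> pmf q xs \<le> exp (- (real n * c)) * pmf (replicate_pmf n p) xs}"

abbreviation light :: "nat \<Rightarrow> real \<Rightarrow> 'a pmf \<Rightarrow> 'a list pmf \<Rightarrow> 'a list set" where
  "light n c p q \<equiv> {xs. \<not> exp (- (real n * c)) * pmf (replicate_pmf n p) xs \<le> pmf q xs}"

text \<open>
  \<open>(1/n) ln (p\<^sup>n / q\<^sub>n)\<close> converges to \<open>D\<close> in probability under \<open>p\<^sup>n\<close>; only this
  property of the reference laws enters the proof, so it unifies the product and the Markov case.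
\<close>

definition divergence_rate :: "'a pmf \<Rightarrow> (nat \<Rightarrow> 'a list pmf) \<Rightarrow> ereal \<Rightarrow> bool" where
  "divergence_rate p q D \<longleftrightarrow> D \<noteq> -\<infinity> \<and>
     (\<forall>c. ereal c < D \<longrightarrow> (\<lambda>n. prb (replicate_pmf n p)
        (heavy n c p (q n))) \<longlonglongrightarrow> 0) \<and>
     (\<forall>c. D < ereal c \<longrightarrow> (\<lambda>n. prb (replicate_pmf n p)
        (light n c p (q n))) \<longlonglongrightarrow> 0)"

lemma tendsto_zero_mono:
  fixes f g :: "nat \<Rightarrow> real"
  assumes "g \<longlonglongrightarrow> 0" "\<And>n. 0 \<le> f n" "\<And>n. f n \<le> g n"
  shows "f \<longlonglongrightarrow> 0"
  by (rule tendsto_sandwich[of "\<lambda>_. 0" f _ g]) (use assms in auto)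

text \<open>The log-likelihood ratio has bounded differences and mean \<open>kl\<close>, so it
  concentrates. Being heavy or light is its lower or upper deviation, rewritten without the
  logarithm.\<close>

lemma divergence_rateI:
  assumes fin: "finite (set_pmf p)"
    and sub: "\<And>n. set_pmf (replicate_pmf n p) \<subseteq> set_pmf (q n)"
    and bd: "\<And>n us a b vs. n0 \<le> n \<Longrightarrow> us @ a # vs \<in> set_pmf (replicate_pmf n p) \<Longrightarrow>
      us @ b # vs \<in> set_pmf (replicate_pmf n p) \<Longrightarrow>
      \<bar>ln (pmf (replicate_pmf n p) (us @ a # vs) / pmf (q n) (us @ a # vs)) -
       ln (pmf (replicate_pmf n p) (us @ b # vs) / pmf (q n) (us @ b # vs))\<bar> \<le> C"
    and mean: "(\<lambda>n. kl (replicate_pmf n p) (q n) / real n) \<longlonglongrightarrow> D"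
  shows "divergence_rate p q (ereal D)"
proof -
  define h where "h = (\<lambda>n xs. ln (pmf (replicate_pmf n p) xs / pmf (q n) xs))"
  have lln: "(\<lambda>n. prb (replicate_pmf n p) {xs. real n * t \<le> \<bar>h n xs - real n * D\<bar>}) \<longlonglongrightarrow> 0"
    if "0 < t" for t
    by (rule bounded_diff_lln[OF fin _ _ that, of n0 _ C])
      (use bd mean in \<open>auto simp: h_def kl_def\<close>)
  have h: "pmf (replicate_pmf n p) xs = exp (h n xs) * pmf (q n) xs" "0 < pmf (q n) xs"
    if "xs \<in> set_pmf (replicate_pmf n p)" for n xs
  proof -
    show "0 < pmf (q n) xs" using that sub by (auto intro: pmf_positive)
    then show "pmf (replicate_pmf n p) xs = exp (h n xs) * pmf (q n) xs"
      using pmf_positive[OF that] by (simp add: h_def)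
  qed
  show ?thesis
    unfolding divergence_rate_def
  proof (intro conjI allI impI)
    fix c assume c: "ereal c < ereal D"
    show "(\<lambda>n. prb (replicate_pmf n p)
        (heavy n c p (q n))) \<longlonglongrightarrow> 0"
    proof (rule tendsto_zero_mono[OF lln[of "D - c"]])
      fix n
      show "prb (replicate_pmf n p) (heavy n c p (q n))
        \<le> prb (replicate_pmf n p) {xs. real n * (D - c) \<le> \<bar>h n xs - real n * D\<bar>}"
      proof (rule prb_mono_supp)
        fix xs assume xs: "xs \<in> set_pmf (replicate_pmf n p)"
          "xs \<in> (heavy n c p (q n))"
        then have "\<not> pmf (q n) xs * 1 \<le> pmf (q n) xs * exp (h n xs - real n * c)"
          by (simp add: h exp_diff exp_minus field_simps)
        then have "h n xs < real n * c" using h(2)[OF xs(1)] by (simp add: mult_le_cancel_left_pos)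
        then show "xs \<in> {xs. real n * (D - c) \<le> \<bar>h n xs - real n * D\<bar>}" by (auto simp: algebra_simps)
      qed
    qed (use c in auto)
  next
    fix c assume c: "ereal D < ereal c"
    show "(\<lambda>n. prb (replicate_pmf n p)
        (light n c p (q n))) \<longlonglongrightarrow> 0"
    proof (rule tendsto_zero_mono[OF lln[of "c - D"]])
      fix n
      show "prb (replicate_pmf n p) (light n c p (q n))
        \<le> prb (replicate_pmf n p) {xs. real n * (c - D) \<le> \<bar>h n xs - real n * D\<bar>}"
      proof (rule prb_mono_supp)
        fix xs assume xs: "xs \<in> set_pmf (replicate_pmf n p)"
          "xs \<in> (light n c p (q n))"
        then have "\<not> pmf (q n) xs * exp (h n xs - real n * c) \<le> pmf (q n) xs * 1"
          by (simp add: h exp_diff exp_minus field_simps)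
        then have "h n xs > real n * c" using h(2)[OF xs(1)] by (simp add: mult_le_cancel_left_pos)
        then show "xs \<in> {xs. real n * (c - D) \<le> \<bar>h n xs - real n * D\<bar>}" by (auto simp: algebra_simps)
      qed
    qed (use c in auto)
  qed simp
qed

section \<open>Product reference laws\<close>

lemma ln_ratio_replicate_pmf:
  assumes "set xs \<subseteq> set_pmf p" "set_pmf p \<subseteq> set_pmf q" "length xs = n"
  shows "ln (pmf (replicate_pmf n p) xs / pmf (replicate_pmf n q) xs) =
    sum_list (map (\<lambda>x. ln (pmf p x / pmf q x)) xs)"
  using assms
proof (induction xs arbitrary: n)
  case (Cons x xs)
  have "0 < pmf p x" "0 < pmf q x" using Cons.prems by (auto intro: pmf_positive)
  moreover have "xs \<in> set_pmf (replicate_pmf (length xs) p)" "xs \<in> set_pmf (replicate_pmf (length xs) q)"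
    using Cons.prems by (auto simp: set_replicate_pmf)
  then have "0 < pmf (replicate_pmf (length xs) p) xs" "0 < pmf (replicate_pmf (length xs) q) xs"
    by (auto intro: pmf_positive)
  moreover have "ln (pmf (replicate_pmf (length xs) p) xs / pmf (replicate_pmf (length xs) q) xs) =
      sum_list (map (\<lambda>x. ln (pmf p x / pmf q x)) xs)"
    using Cons by auto
  ultimately show ?case using Cons.prems by (auto simp: ln_mult ln_div)
qed auto

lemma kl_replicate_pmf:
  assumes "finite (set_pmf p)" "set_pmf p \<subseteq> set_pmf q"
  shows "kl (replicate_pmf n p) (replicate_pmf n q) = real n * kl p q"
proof -
  have "kl (replicate_pmf n p) (replicate_pmf n q) =
    expct (replicate_pmf n p) (\<lambda>xs. sum_list (map (\<lambda>x. ln (pmf p x / pmf q x)) xs))"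
    unfolding kl_def using assms
    by (intro expct_cong refl ln_ratio_replicate_pmf) (auto simp: set_replicate_pmf)
  then show ?thesis using assms by (simp add: expct_sum_list kl_def)
qed

lemma divergence_rate_iid:
  assumes fin: "finite (set_pmf p)" and sub: "set_pmf p \<subseteq> set_pmf q"
  shows "divergence_rate p (\<lambda>n. replicate_pmf n q) (ereal (kl p q))"
proof -
  obtain G where G: "0 \<le> G" "\<And>x. x \<in> set_pmf p \<Longrightarrow> \<bar>ln (pmf p x / pmf q x)\<bar> \<le> G"
    using finite_bounded_abs[OF fin, of "\<lambda>x. ln (pmf p x / pmf q x)"] by blast
  show ?thesis
  proof (rule divergence_rateI[where ?n0.0 = 0 and C = "2 * G"])
    fix n us a b vs
    assume *: "us @ a # vs \<in> set_pmf (replicate_pmf n p)" "us @ b # vs \<in> set_pmf (replicate_pmf n p)"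
    have "\<bar>ln (pmf p a / pmf q a)\<bar> \<le> G" "\<bar>ln (pmf p b / pmf q b)\<bar> \<le> G"
      using * by (auto intro!: G(2) simp: set_replicate_pmf)
    with * show "\<bar>ln (pmf (replicate_pmf n p) (us @ a # vs) / pmf (replicate_pmf n q) (us @ a # vs)) -
       ln (pmf (replicate_pmf n p) (us @ b # vs) / pmf (replicate_pmf n q) (us @ b # vs))\<bar> \<le> 2 * G"
      using sub by (subst (1 2) ln_ratio_replicate_pmf) (auto simp: set_replicate_pmf)
  next
    have "\<forall>\<^sub>F n in sequentially. kl p q = kl (replicate_pmf n p) (replicate_pmf n q) / real n"
      using eventually_gt_at_top[of 0] by eventually_elim (simp add: kl_replicate_pmf fin sub)
    then show "(\<lambda>n. kl (replicate_pmf n p) (replicate_pmf n q) / real n) \<longlonglongrightarrow> kl p q"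
      by (rule Lim_transform_eventually[OF tendsto_const])
  qed (use fin sub in \<open>auto simp: set_replicate_pmf\<close>)
qed

text \<open>A letter \<open>a\<close> charged by \<open>p\<close> but not by \<open>q\<close> is
  missing from a word with probability (1 - p a)^n, and a word that contains it has probability zero
  under the reference law. So every heavy word lies in this vanishing set, whatever \<open>c\<close>
  is.\<close>

lemma divergence_rate_iid_infinite:
  fixes p q :: "'a::finite pmf"
  assumes "\<not> set_pmf p \<subseteq> set_pmf q"
  shows "divergence_rate p (\<lambda>n. replicate_pmf n q) \<infinity>"
proof -
  obtain a where a: "a \<in> set_pmf p" "a \<notin> set_pmf q" using assms by auto
  have miss: "prb (replicate_pmf n p) {xs. a \<notin> set xs} = (1 - pmf p a) ^ n" for n
  proof (induction n)
    case (Suc n)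
    have "prb (replicate_pmf (Suc n) p) {xs. a \<notin> set xs} =
      expct p (\<lambda>x. expct (replicate_pmf n p) (\<lambda>xs. indicator {xs. a \<notin> set xs} (x # xs)))"
      unfolding expct_indicator[symmetric] by (rule expct_replicate_pmf_Suc) simp
    also have "\<dots> = expct p (\<lambda>x. indicator (- {a}) x * prb (replicate_pmf n p) {xs. a \<notin> set xs})"
    proof (intro arg_cong[of _ _ "expct p"] ext)
      fix x
      show "expct (replicate_pmf n p) (\<lambda>xs. indicator {xs. a \<notin> set xs} (x # xs)) =
        indicator (- {a}) x * prb (replicate_pmf n p) {xs. a \<notin> set xs}"
      proof (cases "x = a")
        case False
        then have "(\<lambda>xs. indicator {xs. a \<notin> set xs} (x # xs)) = (indicator {xs. a \<notin> set xs} :: 'a list \<Rightarrow> real)"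
          by (auto simp: indicator_def fun_eq_iff)
        then show ?thesis using False by (simp only: expct_indicator) simp
      qed simp
    qed
    also have "\<dots> = prb p (- {a}) * (1 - pmf p a) ^ n" using Suc by simp
    also have "prb p (- {a}) = 1 - pmf p a" by (simp add: prb_compl measure_pmf_single)
    finally show ?case by simp
  qed simp
  have "pmf p a > 0" using a by (simp add: pmf_positive)
  then have lim: "(\<lambda>n. (1 - pmf p a) ^ n) \<longlonglongrightarrow> 0"
    by (intro LIMSEQ_power_zero) (use pmf_le_1[of p a] in \<open>auto simp: abs_if\<close>)
  show ?thesis
    unfolding divergence_rate_def
  proof (intro conjI allI impI)
    fix c
    show "(\<lambda>n. prb (replicate_pmf n p)
        (heavy n c p (replicate_pmf n q))) \<longlonglongrightarrow> 0"
    proof (rule tendsto_zero_mono[OF lim])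
      fix n
      show "prb (replicate_pmf n p)
        (heavy n c p (replicate_pmf n q)) \<le> (1 - pmf p a) ^ n"
        unfolding miss[symmetric]
      proof (rule prb_mono_supp)
        fix xs assume "xs \<in> (heavy n c p (replicate_pmf n q))"
        moreover have "0 \<le> exp (- (real n * c)) * pmf (replicate_pmf n p) xs" by simp
        ultimately have "\<not> pmf (replicate_pmf n q) xs \<le> 0" by auto
        then have "xs \<in> set_pmf (replicate_pmf n q)"
          by (simp add: set_pmf_iff)
        then show "xs \<in> {xs. a \<notin> set xs}" using a by (auto simp: set_replicate_pmf)
      qed
    qed simp
  qed auto
qed

section \<open>Markov reference laws\<close>

lemma pmf_bind_inj:
  assumes "inj (\<lambda>(a, b). f a b)"
  shows "pmf (do {a \<leftarrow> p; b \<leftarrow> K a; return_pmf (f a b)}) (f a b) = pmf p a * pmf (K a) b"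
proof -
  define r where "r = do {a \<leftarrow> p; map_pmf (Pair a) (K a)}"
  have *: "pmf (map_pmf (Pair a') (K a')) (a, b) = indicator {a} a' * pmf (K a) b" for a'
  proof (cases "a' = a")
    case True
    then show ?thesis using pmf_map_inj'[of "Pair a" "K a" b] by (simp add: inj_on_def)
  next
    case False
    then have "(a, b) \<notin> set_pmf (map_pmf (Pair a') (K a'))" by auto
    then show ?thesis using False by (simp add: pmf_eq_0_set_pmf)
  qed
  have "pmf r (a, b) = pmf p a * pmf (K a) b"
    by (simp add: r_def pmf_bind * measure_pmf_single)
  moreover have "do {a \<leftarrow> p; b \<leftarrow> K a; return_pmf (f a b)} = map_pmf (\<lambda>(a, b). f a b) r"
    by (simp add: r_def map_bind_pmf map_pmf_def bind_assoc_pmf bind_return_pmf)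
  ultimately show ?thesis using pmf_map_inj'[OF assms, of r "(a, b)"] by simp
qed

lemma replicate_pmf_snoc:
  "replicate_pmf (Suc n) p = do {xs \<leftarrow> replicate_pmf n p; x \<leftarrow> p; return_pmf (xs @ [x])}"
  using replicate_pmf_distrib[of n 1 p]
  by (simp add: replicate_pmf_1 bind_map_pmf replicate_pmf.simps(2) bind_assoc_pmf bind_return_pmf)

lemma inj_snoc: "inj (\<lambda>(xs, x). xs @ [x])"
  by (auto simp: inj_def)

lemma map_drop_replicate_pmf: "map_pmf (drop k) (replicate_pmf (k + n) p) = replicate_pmf n p"
proof -
  have "map_pmf (drop k) (replicate_pmf (k + n) p) =
    do {xs \<leftarrow> replicate_pmf k p; ys \<leftarrow> replicate_pmf n p; return_pmf (drop k (xs @ ys))}"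
    by (simp add: replicate_pmf_distrib map_bind_pmf)
  also have "\<dots> = do {xs \<leftarrow> replicate_pmf k p; replicate_pmf n p}"
  proof (intro bind_pmf_cong refl)
    fix xs assume "xs \<in> set_pmf (replicate_pmf k p)"
    then have "length xs = k" by (rule length_replicate_pmf)
    then show "do {ys \<leftarrow> replicate_pmf n p; return_pmf (drop k (xs @ ys))} = replicate_pmf n p"
      by (simp add: bind_return_pmf')
  qed
  finally show ?thesis by simp
qed

text \<open>Beyond the order \<open>d\<close> the likelihood gains one factor per letter, which
  depends on this letter and the \<open>d\<close> letters before it. Under the i.i.d. law those
  \<open>d\<close> letters always have law p^d, so the divergence grows by the same constant
  \<open>A\<close> at each step. Replacing one letter affects the initial block and at most d + 1
  later factors, whence the bounded differences.\<close>

lemma divergence_rate_markov: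
  fixes p :: "'a::finite pmf"
  assumes markov: "markov_marginals d q"
    and sub: "\<And>n. set_pmf (replicate_pmf n p) \<subseteq> set_pmf (q n)"
  obtains A where "\<And>n. d \<le> n \<Longrightarrow>
      kl (replicate_pmf (Suc n) p) (q (Suc n)) - kl (replicate_pmf n p) (q n) = A"
    "divergence_rate p q (ereal A)"
proof -
  obtain K where K: "\<And>n. d \<le> n \<Longrightarrow>
      q (Suc n) = do {xs \<leftarrow> q n; x \<leftarrow> K (drop (n - d) xs); return_pmf (xs @ [x])}"
    using markov unfolding markov_marginals_def by blast
  define h where "h = (\<lambda>n xs. ln (pmf (replicate_pmf n p) xs / pmf (q n) xs))"
  define g where "g = (\<lambda>c x. ln (pmf p x / pmf (K c) x))"
  have h_Suc: "h (Suc n) (xs @ [x]) = h n xs + g (drop (n - d) xs) x"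
    if "d \<le> n" "xs \<in> set_pmf (replicate_pmf n p)" "x \<in> set_pmf p" for n xs x
  proof -
    have p: "pmf (replicate_pmf (Suc n) p) (xs @ [x]) = pmf (replicate_pmf n p) xs * pmf p x"
      unfolding replicate_pmf_snoc by (rule pmf_bind_inj[OF inj_snoc])
    have q: "pmf (q (Suc n)) (xs @ [x]) = pmf (q n) xs * pmf (K (drop (n - d) xs)) x"
      unfolding K[OF that(1)] by (rule pmf_bind_inj[OF inj_snoc])
    have "xs @ [x] \<in> set_pmf (replicate_pmf (Suc n) p)"
      using that by (auto simp: replicate_pmf_snoc set_bind_pmf)
    then have "0 < pmf (replicate_pmf n p) xs * pmf p x" "0 < pmf (q n) xs * pmf (K (drop (n - d) xs)) x"
      unfolding p[symmetric] q[symmetric] using sub by (auto intro: pmf_positive)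
    then have "0 < pmf (replicate_pmf n p) xs" "0 < pmf p x" "0 < pmf (q n) xs" "0 < pmf (K (drop (n - d) xs)) x"
      by (auto simp: zero_less_mult_iff pmf_nonneg not_less[symmetric])
    then show ?thesis
      by (simp add: h_def g_def p q ln_mult ln_div)
  qed
  define A where "A = expct (replicate_pmf d p) (\<lambda>c. expct p (g c))"
  have step: "kl (replicate_pmf (Suc n) p) (q (Suc n)) = kl (replicate_pmf n p) (q n) + A" if n: "d \<le> n" for n
  proof -
    have "kl (replicate_pmf (Suc n) p) (q (Suc n)) =
      expct (replicate_pmf n p) (\<lambda>xs. expct p (\<lambda>x. h (Suc n) (xs @ [x])))"
      unfolding kl_def h_def[symmetric, THEN fun_cong] replicate_pmf_snoc
      by (simp add: expct_bind set_bind_pmf h_def replicate_pmf_snoc)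
    also have "\<dots> = expct (replicate_pmf n p) (\<lambda>xs. expct p (\<lambda>x. h n xs + g (drop (n - d) xs) x))"
      using h_Suc[OF n] by (intro expct_cong refl) auto
    also have "\<dots> = expct (replicate_pmf n p) (h n) + expct (replicate_pmf n p) (\<lambda>xs. expct p (g (drop (n - d) xs)))"
      by (simp add: expct_add)
    also have "expct (replicate_pmf n p) (\<lambda>xs. expct p (g (drop (n - d) xs))) =
      expct (map_pmf (drop (n - d)) (replicate_pmf ((n - d) + d) p)) (\<lambda>c. expct p (g c))"
      using n by simp
    also have "\<dots> = A" unfolding map_drop_replicate_pmf A_def ..
    finally show ?thesis by (simp add: kl_def h_def)
  qed
  have kl_n: "kl (replicate_pmf n p) (q n) = kl (replicate_pmf d p) (q d) + (real n - real d) * A" if "d \<le> n" for n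
    using that by (induction n rule: nat_induct_at_least) (auto simp: step algebra_simps)
  have h_n: "h n xs = h d (take d xs) + (\<Sum>t\<in>{d..<n}. g (drop (t - d) (take t xs)) (xs ! t))"
    if "d \<le> n" "xs \<in> set_pmf (replicate_pmf n p)" for n xs
    using that
  proof (induction n arbitrary: xs rule: nat_induct_at_least)
    case base
    then show ?case by (simp add: length_replicate_pmf)
  next
    case (Suc n)
    then obtain ys y where xs: "xs = ys @ [y]" "ys \<in> set_pmf (replicate_pmf n p)" "y \<in> set_pmf p"
      by (auto simp: replicate_pmf_snoc set_bind_pmf)
    have len: "length ys = n" using xs by (simp add: length_replicate_pmf)
    have "(\<Sum>t\<in>{d..<n}. g (drop (t - d) (take t ys)) (ys ! t)) =
      (\<Sum>t\<in>{d..<n}. g (drop (t - d) (take t (ys @ [y]))) ((ys @ [y]) ! t))"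
      by (intro sum.cong) (auto simp: len nth_append)
    moreover have "(ys @ [y]) ! n = y" using len by (simp add: nth_append)
    ultimately show ?case
      using Suc.hyps len xs Suc.IH[OF xs(2)] by (simp add: h_Suc)
  qed
  have "finite (set_pmf (replicate_pmf d p) \<times> set_pmf p)" by simp
  then obtain G1 where G1: "0 \<le> G1"
    "\<And>c x. c \<in> set_pmf (replicate_pmf d p) \<Longrightarrow> x \<in> set_pmf p \<Longrightarrow> \<bar>g c x\<bar> \<le> G1"
    by (rule finite_bounded_abs[where f = "\<lambda>(c, x). g c x"]) force
  obtain G2 where G2: "0 \<le> G2" "\<And>z. z \<in> set_pmf (replicate_pmf d p) \<Longrightarrow> \<bar>h d z\<bar> \<le> G2"
    by (rule finite_bounded_abs[of "set_pmf (replicate_pmf d p)" "h d"]) auto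
  have rate: "divergence_rate p q (ereal A)"
  proof (rule divergence_rateI[where ?n0.0 = d and C = "2 * G2 + (real d + 1) * (2 * G1)"])
    fix n us a b vs
    assume n: "d \<le> n" and *: "us @ a # vs \<in> set_pmf (replicate_pmf n p)" "us @ b # vs \<in> set_pmf (replicate_pmf n p)"
    let ?x = "us @ a # vs" and ?y = "us @ b # vs"
    let ?l = "length us"
    let ?g = "\<lambda>xs t. g (drop (t - d) (take t xs)) (xs ! t)"
    have mem: "take d z \<in> set_pmf (replicate_pmf d p)" if "z \<in> set_pmf (replicate_pmf n p)" for z
      using that n by (auto simp: set_replicate_pmf dest: in_set_takeD)
    have gb: "\<bar>?g z t\<bar> \<le> G1" if "z \<in> set_pmf (replicate_pmf n p)" "d \<le> t" "t < n" for z t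
    proof -
      have "drop (t - d) (take t z) \<in> set_pmf (replicate_pmf d p)" "z ! t \<in> set_pmf p"
        using that by (auto simp: set_replicate_pmf dest: in_set_takeD in_set_dropD)
      then show ?thesis using G1(2) by simp
    qed
    \<comment> \<open>The term at time \<open>t\<close> reads the positions t - d, ..., t, so it can
      meet position \<open>?l\<close> only for \<open>t\<close> between \<open>?l\<close> and
      \<open>?l + d\<close>.\<close>
    have d1: "\<bar>?g ?x t - ?g ?y t\<bar> \<le> (if t \<in> {?l..?l + d} then 2 * G1 else 0)" if "d \<le> t" "t < n" for t
    proof (cases "t \<in> {?l..?l + d}")
      case True
      have "\<bar>?g ?x t - ?g ?y t\<bar> \<le> 2 * G1"
        using gb[OF *(1) that] gb[OF *(2) that] by linarith
      then show ?thesis by (simp only: True if_True)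
    next
      case False
      then have "t < ?l \<or> ?l + d < t" by auto
      then show ?thesis
      proof
        assume "t < ?l"
        then show ?thesis by (simp add: nth_append)
      next
        assume t: "?l + d < t"
        then have "drop (t - d) (take t ?x) = drop (t - d) (take t ?y)"
          by (simp add: take_Cons' drop_Cons' Suc_le_eq)
        moreover have "?x ! t = ?y ! t" using t by (simp add: nth_append nth_Cons')
        ultimately show ?thesis using False G1(1) by simp
      qed
    qed
    have "\<bar>h n ?x - h n ?y\<bar> \<le> \<bar>h d (take d ?x) - h d (take d ?y)\<bar> + \<bar>(\<Sum>t\<in>{d..<n}. ?g ?x t - ?g ?y t)\<bar>"
      unfolding h_n[OF n *(1)] h_n[OF n *(2)] sum_subtractf by linarith
    also have "\<bar>h d (take d ?x) - h d (take d ?y)\<bar> \<le> 2 * G2"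
      using G2(2)[OF mem[OF *(1)]] G2(2)[OF mem[OF *(2)]] by linarith
    also have "\<bar>(\<Sum>t\<in>{d..<n}. ?g ?x t - ?g ?y t)\<bar> \<le> (\<Sum>t\<in>{d..<n}. \<bar>?g ?x t - ?g ?y t\<bar>)"
      by (rule sum_abs)
    also have "\<dots> \<le> (\<Sum>t\<in>{d..<n}. if t \<in> {?l..?l + d} then 2 * G1 else 0)"
      by (intro sum_mono d1) auto
    also have "\<dots> = (\<Sum>t\<in>{d..<n} \<inter> {?l..?l + d}. 2 * G1)"
      by (rule sum.inter_restrict[symmetric]) simp
    also have "\<dots> \<le> (\<Sum>t\<in>{?l..?l + d}. 2 * G1)"
      using G1 by (intro sum_mono2) auto
    finally show "\<bar>ln (pmf (replicate_pmf n p) ?x / pmf (q n) ?x) - ln (pmf (replicate_pmf n p) ?y / pmf (q n) ?y)\<bar>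
        \<le> 2 * G2 + (real d + 1) * (2 * G1)"
      by (simp add: h_def algebra_simps)
  next
    define c where "c = kl (replicate_pmf d p) (q d)"
    have "(\<lambda>n. (c + (real n - real d) * A) / real n) \<longlonglongrightarrow> A"
      by real_asymp
    moreover have "\<forall>\<^sub>F n in sequentially. (c + (real n - real d) * A) / real n = kl (replicate_pmf n p) (q n) / real n"
      using eventually_ge_at_top[of d]
      by eventually_elim (unfold c_def, subst kl_n, assumption, rule refl)
    ultimately show "(\<lambda>n. kl (replicate_pmf n p) (q n) / real n) \<longlonglongrightarrow> A"
      by (rule Lim_transform_eventually)
  qed (use sub in auto)
  show ?thesis
    using that[of A] step rate by simp
qed

lemma iid_family_divergence_rate:
  fixes p :: "nat \<Rightarrow> 'a::finite pmf"
  assumes "iid_family I J p q D" "i \<in> I" "j \<in> J"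
  shows "divergence_rate (p i) (q j) (D i j)"
proof -
  obtain q1 where q1: "\<And>n. q j n = replicate_pmf n (q1 j)" "D i j = rel_entropy (p i) (q1 j)"
    using assms unfolding iid_family_def by blast
  from q1(1) have "q j = (\<lambda>n. replicate_pmf n (q1 j))" by auto
  then show ?thesis
    using q1(2) by (auto simp: rel_entropy_eq_kl divergence_rate_iid divergence_rate_iid_infinite)
qed

lemma markov_family_divergence_rate:
  fixes p :: "nat \<Rightarrow> 'a::finite pmf"
  assumes "markov_family I J p q D" "i \<in> I" "j \<in> J"
  shows "divergence_rate (p i) (q j) (D i j)"
proof -
  obtain d where d: "markov_marginals d (q j)"
    using assms unfolding markov_family_def by blast
  have sub: "set_pmf (replicate_pmf n (p i)) \<subseteq> set_pmf (q j n)" for n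
    using assms unfolding markov_family_def abs_cont_iff by blast
  obtain A where A: "\<And>n. d \<le> n \<Longrightarrow>
      kl (replicate_pmf (Suc n) (p i)) (q j (Suc n)) - kl (replicate_pmf n (p i)) (q j n) = A"
    "divergence_rate (p i) (q j) (ereal A)"
    using divergence_rate_markov[OF d sub] by blast
  \<comment> \<open>The increments are constant from index \<open>d\<close> on, so the limit in the
    definition of \<open>D i j\<close> exists and equals \<open>A\<close>.\<close>
  have "(\<lambda>n. rel_entropy (replicate_pmf (Suc n) (p i)) (q j (Suc n))
               - rel_entropy (replicate_pmf n (p i)) (q j n)) \<longlonglongrightarrow> ereal A"
    by (rule tendsto_eventually)
      (use A(1) sub in \<open>auto simp: rel_entropy_eq_kl eventually_at_top_linorder intro!: exI[of _ d]\<close>)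
  then have "D i j = ereal A"
    using assms unfolding markov_family_def by (simp add: limI)
  then show ?thesis using A by simp
qed

section \<open>Pumping up by a noise operator\<close>

text \<open>The letter is resampled from \<open>p\<close> with probability \<open>z\<close> and kept
  otherwise. Keeping it makes the noise mild, while resampling gives every letter of the support at
  least the weight \<open>z * pmf p c\<close>; pumping up plays these two effects against each
  other.\<close>

definition noise :: "real \<Rightarrow> 'a pmf \<Rightarrow> 'a \<Rightarrow> 'a pmf" where
  "noise z p y = do {b \<leftarrow> bernoulli_pmf z; if b then p else return_pmf y}"

lemma pmf_noise:
  assumes "0 \<le> z" "z \<le> 1"
  shows "pmf (noise z p y) c = z * pmf p c + (1 - z) * indicator {y} c"
  using assms by (simp add: noise_def pmf_bind integral_bernoulli_pmf pmf_return indicator_def)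

text \<open>Stationarity of \<open>p\<close>: averaging over the noise preserves means under
  \<open>p\<close>, so pumping up the acceptance function leaves its mean under the product of the
  marginals intact.\<close>

lemma bind_noise:
  assumes "0 \<le> z" "z \<le> 1"
  shows "bind_pmf p (noise z p) = p"
proof (rule pmf_eqI)
  fix c
  have "integrable (measure_pmf p) (\<lambda>y. (1 - z) * indicator {y} c)"
    by (rule measure_pmf.integrable_const_bound[where B = "\<bar>1 - z\<bar>"]) (auto simp: indicator_def)
  then have "pmf (bind_pmf p (noise z p)) c = z * pmf p c + (1 - z) * expct p (\<lambda>y. indicator {y} c)"
    using assms by (simp add: pmf_bind pmf_noise)
  also have "(\<lambda>y. indicator {y} c) = (indicator {c} :: 'a \<Rightarrow> real)"
    by (auto simp: fun_eq_iff indicator_def)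
  finally show "pmf (bind_pmf p (noise z p)) c = pmf p c"
    by (simp add: measure_pmf_single algebra_simps)
qed

text \<open>Used for two kernels: the noise, to transfer its stationarity to words, and the channel,
  to identify the output law of an i.i.d. input.\<close>

lemma bind_replicate_pmf_prod_pmfs:
  "bind_pmf (replicate_pmf n p) (\<lambda>xs. prod_pmfs (map K xs)) = replicate_pmf n (bind_pmf p K)"
proof (induction n)
  case (Suc n)
  have "bind_pmf (replicate_pmf (Suc n) p) (\<lambda>xs. prod_pmfs (map K xs)) =
    do {x \<leftarrow> p; xs \<leftarrow> replicate_pmf n p; y \<leftarrow> K x; ys \<leftarrow> prod_pmfs (map K xs); return_pmf (y # ys)}"
    by (simp add: replicate_pmf.simps prod_pmfs.simps bind_assoc_pmf bind_return_pmf)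
  also have "\<dots> = do {x \<leftarrow> p; y \<leftarrow> K x; xs \<leftarrow> replicate_pmf n p; ys \<leftarrow> prod_pmfs (map K xs); return_pmf (y # ys)}"
    by (subst (2) bind_commute_pmf) (rule refl)
  also have "\<dots> = do {x \<leftarrow> p; y \<leftarrow> K x; ys \<leftarrow> bind_pmf (replicate_pmf n p) (\<lambda>xs. prod_pmfs (map K xs)); return_pmf (y # ys)}"
    by (simp add: bind_assoc_pmf)
  also have "\<dots> = replicate_pmf (Suc n) (bind_pmf p K)"
    by (simp add: Suc replicate_pmf.simps bind_assoc_pmf)
  finally show ?case .
qed (simp add: bind_return_pmf)

text \<open>
  \<open>ln (T f)\<close> has bounded differences for the noise operator \<open>T\<close>, hence concentrates under any
  product law; since \<open>T f\<close> is not small on a set of non-negligible probability, its mean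
  logarithm is bounded below. This replaces the blowing-up lemma.
\<close>

lemma expct_ln_noise:
  fixes p :: "'a::finite pmf" and f :: "'a list \<Rightarrow> real"
  assumes z: "0 < z" "z < 1" and \<gamma>: "0 < \<gamma>" "\<And>c. c \<in> set_pmf p \<Longrightarrow> \<gamma> \<le> pmf p c" "\<gamma> \<le> 1"
    and ws: "\<And>w. w \<in> set ws \<Longrightarrow> set_pmf w \<subseteq> set_pmf p" "length ws = n"
    and f: "\<And>ys. 0 \<le> f ys" "\<And>ys. f ys \<le> 1"
    and \<eta>: "0 < \<eta>" "\<eta> \<le> expct (prod_pmfs ws) f"
  defines "T \<equiv> \<lambda>ys. expct (prod_pmfs (map (noise z p) ys)) f"
  shows "real n * ln (1 - z) + ln (\<eta> / 2) - ln (1 / (z * \<gamma>)) * sqrt (2 * real n / \<eta>)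
           \<le> expct (prod_pmfs ws) (\<lambda>ys. ln (T ys))"
    and "\<And>ys. ys \<in> set_pmf (prod_pmfs ws) \<Longrightarrow> 0 < T ys"
    and "\<And>ys. 0 \<le> T ys"
proof -
  let ?S = "set_pmf (prod_pmfs ws)"
  define C where "C = ln (1 / (z * \<gamma>))"
  have z\<gamma>: "0 < z * \<gamma>" "z * \<gamma> < 1"
  proof -
    show "0 < z * \<gamma>" using z \<gamma> by simp
    have "z * \<gamma> \<le> z * 1" using z \<gamma> by (intro mult_left_mono) auto
    then show "z * \<gamma> < 1" using z by linarith
  qed
  have C0: "0 < C" using z\<gamma> by (simp add: C_def ln_gt_zero)
  show T0: "0 \<le> T ys" for ys unfolding T_def by (rule expct_nonneg) (rule f)
  have len: "length ys = n" if "ys \<in> ?S" for ys using that ws(2) by (simp add: length_prod_pmfs)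
  have supp: "set ys \<subseteq> set_pmf p" if "ys \<in> ?S" for ys
  proof
    fix y assume "y \<in> set ys"
    then obtain i where i: "i < length ys" "y = ys ! i" by (auto simp: in_set_conv_nth)
    then have "y \<in> set_pmf (ws ! i)" "ws ! i \<in> set ws"
      using that by (auto simp: set_prod_pmfs list_all2_conv_all_nth)
    then show "y \<in> set_pmf p" using ws(1) by blast
  qed
  \<comment> \<open>With probability at least (1 - z)^n the noise leaves the whole word
    unchanged.\<close>
  have T_lower: "(1 - z) ^ n * f ys \<le> T ys" if "length ys = n" for ys
  proof -
    have "(1 - z) ^ length ys \<le> pmf (prod_pmfs (map (noise z p) ys)) ys"
    proof (induction ys)
      case (Cons y ys)
      have "1 - z \<le> pmf (noise z p y) y" using z by (simp add: pmf_noise)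
      with Cons show ?case using z by (auto intro!: mult_mono)
    qed simp
    then have "(1 - z) ^ n * f ys \<le> pmf (prod_pmfs (map (noise z p) ys)) ys * f ys"
      using that f by (intro mult_right_mono) auto
    also have "\<dots> \<le> T ys"
    proof -
      have "expct (prod_pmfs (map (noise z p) ys)) (\<lambda>v. f ys * indicator {ys} v) \<le> T ys"
        unfolding T_def using f by (intro expct_mono) (auto simp: indicator_def)
      then show ?thesis by (simp add: measure_pmf_single mult.commute)
    qed
    finally show ?thesis .
  qed
  \<comment> \<open>Since f \<le> 1, a mean of at least \<eta> forces f \<ge> \<eta>/2 with
    probability at least \<eta>/2.\<close>
  define A where "A = {ys. \<eta> / 2 \<le> f ys}"
  have PA: "\<eta> / 2 \<le> prb (prod_pmfs ws) A"
  proof -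
    have "expct (prod_pmfs ws) f \<le> expct (prod_pmfs ws) (\<lambda>ys. indicator A ys + \<eta> / 2)"
      using f \<eta> by (intro expct_mono) (auto simp: A_def indicator_def add_increasing2)
    also have "\<dots> = prb (prod_pmfs ws) A + \<eta> / 2" by (simp add: expct_add)
    finally show ?thesis using \<eta> by linarith
  qed
  have "prb (prod_pmfs ws) A > 0" using PA \<eta> by linarith
  then obtain ys0 where ys0: "ys0 \<in> ?S" "ys0 \<in> A"
    by (metis disjoint_iff less_irrefl measure_pmf_zero_iff)
  \<comment> \<open>Only one factor differs. Started from \<open>a\<close>, the noise puts mass at
    least z \<gamma> on any letter \<open>c\<close> of the support; started from \<open>b\<close>,
    it puts mass at most 1 there.\<close>
  have ratio: "z * \<gamma> * T (us @ b # vs) \<le> T (us @ a # vs)"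
    if "set us \<subseteq> set_pmf p" "set vs \<subseteq> set_pmf p" "b \<in> set_pmf p" for us a b vs
  proof -
    define L where "L = {ys :: 'a list. length ys = length us + Suc (length vs)}"
    have finL: "finite L" unfolding L_def using finite_lists_length_eq[of "UNIV :: 'a set" "length us + Suc (length vs)"] by simp
    have T_sum: "T ys = (\<Sum>cs\<in>L. pmf (prod_pmfs (map (noise z p) ys)) cs * f cs)"
      if "length ys = length us + Suc (length vs)" for ys
      unfolding T_def using that
      by (intro expct_sum[OF finL]) (auto simp: L_def dest: length_prod_pmfs)
    have "z * \<gamma> * T (us @ b # vs) = (\<Sum>cs\<in>L. (z * \<gamma> * pmf (prod_pmfs (map (noise z p) (us @ b # vs))) cs) * f cs)"
      by (simp add: T_sum sum_distrib_left mult_ac)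
    also have "\<dots> \<le> (\<Sum>cs\<in>L. pmf (prod_pmfs (map (noise z p) (us @ a # vs))) cs * f cs)"
    proof (intro sum_mono mult_right_mono f)
      fix cs assume "cs \<in> L"
      define c1 c c2 where "c1 = take (length us) cs" and "c = cs ! length us" and "c2 = drop (Suc (length us)) cs"
      have cs: "cs = c1 @ c # c2" "length c1 = length us"
        using \<open>cs \<in> L\<close> by (auto simp: c1_def c_def c2_def L_def id_take_nth_drop)
      have eq: "pmf (prod_pmfs (map (noise z p) (us @ a # vs))) cs =
        pmf (prod_pmfs (map (noise z p) us)) c1 * (pmf (noise z p a) c * pmf (prod_pmfs (map (noise z p) vs)) c2)" for a
        using cs(2) by (simp add: cs(1) pmf_prod_pmfs_append)
      show "z * \<gamma> * pmf (prod_pmfs (map (noise z p) (us @ b # vs))) cs \<le> pmf (prod_pmfs (map (noise z p) (us @ a # vs))) cs"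
      proof (cases "c \<in> set_pmf p")
        case True
        have "z * \<gamma> * pmf (noise z p b) c \<le> z * \<gamma> * 1"
          using z\<gamma> by (intro mult_left_mono pmf_le_1) auto
        also have "\<dots> \<le> z * pmf p c" using z \<gamma> True by simp
        also have "\<dots> \<le> pmf (noise z p a) c" using z by (simp add: pmf_noise indicator_def)
        finally have "(z * \<gamma> * pmf (noise z p b) c) * (pmf (prod_pmfs (map (noise z p) us)) c1 * pmf (prod_pmfs (map (noise z p) vs)) c2)
          \<le> pmf (noise z p a) c * (pmf (prod_pmfs (map (noise z p) us)) c1 * pmf (prod_pmfs (map (noise z p) vs)) c2)"
          by (intro mult_right_mono) auto
        then show ?thesis unfolding eq by (simp add: mult_ac)
      next
        case False
        then have "pmf (noise z p b) c = 0"
          using z that by (auto simp: pmf_noise pmf_eq_0_set_pmf indicator_def)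
        then show ?thesis by (simp only: eq) simp
      qed
    qed
    also have "\<dots> = T (us @ a # vs)" by (simp add: T_sum)
    finally show ?thesis .
  qed
  \<comment> \<open>From a word \<open>ys0\<close> at which \<open>T\<close> is positive, the
    letters of \<open>ys\<close> are inserted one at a time; each replacement loses at most the
    factor z \<gamma>.\<close>
  show T_pos: "0 < T ys" if "ys \<in> ?S" for ys
  proof -
    have "0 < T ys0"
      using T_lower[OF len[OF ys0(1)]] ys0 z \<eta> unfolding A_def
      by (smt (verit) mem_Collect_eq half_gt_zero mult_pos_pos zero_less_power)
    moreover have "0 < T (take k ys @ drop k ys0)" if "k \<le> n" for k
      using that
    proof (induction k)
      case (Suc k)
      have l: "length ys = n" "length ys0 = n" using len ys0 \<open>ys \<in> ?S\<close> by auto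
      have "take k ys @ drop k ys0 = take k ys @ (ys0 ! k) # drop (Suc k) ys0"
        using Suc.prems l by (simp add: Cons_nth_drop_Suc)
      moreover have "take (Suc k) ys @ drop (Suc k) ys0 = take k ys @ (ys ! k) # drop (Suc k) ys0"
        using Suc.prems l by (simp add: take_Suc_conv_app_nth)
      moreover have "z * \<gamma> * T (take k ys @ (ys0 ! k) # drop (Suc k) ys0) \<le> T (take k ys @ (ys ! k) # drop (Suc k) ys0)"
        using supp[OF ys0(1)] supp[OF \<open>ys \<in> ?S\<close>] l Suc.prems
        by (intro ratio) (auto dest: in_set_takeD in_set_dropD intro: nth_mem)
      moreover have "0 < T (take k ys @ drop k ys0)" using Suc by simp
      ultimately show ?case using z\<gamma>(1) by (smt (verit) mult_pos_pos)
    qed (use \<open>0 < T ys0\<close> in simp)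
    from this[of n] show ?thesis using len[OF that] len[OF ys0(1)] by simp
  qed
  define h where "h = (\<lambda>ys. ln (T ys))"
  define E where "E = expct (prod_pmfs ws) h"
  have bd: "h (us @ b # vs) - h (us @ a # vs) \<le> C" if "us @ a # vs \<in> ?S" "us @ b # vs \<in> ?S" for us a b vs
  proof -
    have *: "z * \<gamma> * T (us @ b # vs) \<le> T (us @ a # vs)"
      using supp[OF that(2)] by (intro ratio) auto
    have "ln (z * \<gamma> * T (us @ b # vs)) \<le> ln (T (us @ a # vs))"
      using z\<gamma> T_pos[OF that(2)] * by (intro ln_mono) auto
    moreover have "ln (w * t) = ln w + ln t" "ln (1 / w) = - ln w" if "0 < w" "0 < t" for w t :: real
      using that by (simp_all add: ln_mult ln_div)
    ultimately show ?thesis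
      using T_pos[OF that(2)] z\<gamma> unfolding h_def C_def by (metis add.commute diff_le_eq le_diff_eq minus_add_cancel uminus_add_conv_diff)
  qed
  have var: "expct (prod_pmfs ws) (\<lambda>xs. (h xs - E)\<^sup>2) \<le> real (length ws) * C\<^sup>2"
    unfolding E_def
  proof (rule bounded_diff_variance)
    fix us a b vs assume "us @ a # vs \<in> ?S" "us @ b # vs \<in> ?S"
    from bd[OF this] bd[OF this(2,1)] show "\<bar>h (us @ a # vs) - h (us @ b # vs)\<bar> \<le> C" by simp
  qed simp
  define B where "B = real n * ln (1 - z) + ln (\<eta> / 2)"
  have hA: "B \<le> h ys" if "ys \<in> ?S" "ys \<in> A" for ys
  proof -
    have "(1 - z) ^ n * (\<eta> / 2) \<le> (1 - z) ^ n * f ys" using that z by (auto simp: A_def intro!: mult_left_mono)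
    also have "\<dots> \<le> T ys" by (rule T_lower[OF len[OF that(1)]])
    finally have "ln ((1 - z) ^ n * (\<eta> / 2)) \<le> h ys" unfolding h_def using z \<eta> by (intro ln_mono) auto
    moreover have "ln ((1 - z) ^ n * (\<eta> / 2)) = ln ((1 - z) ^ n) + ln (\<eta> / 2)"
      using z \<eta> by (intro ln_mult_pos) auto
    ultimately show ?thesis using z by (simp add: B_def ln_realpow)
  qed
  show "real n * ln (1 - z) + ln (\<eta> / 2) - ln (1 / (z * \<gamma>)) * sqrt (2 * real n / \<eta>)
           \<le> expct (prod_pmfs ws) (\<lambda>ys. ln (T ys))"
  \<comment> \<open>If the mean \<open>E\<close> lies below \<open>B\<close>, then on the event
    \<open>A\<close> the function exceeds its mean by at least B - E, and the variance bound n C^2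
    limits this gap.\<close>
  proof (cases "B \<le> E")
    case True
    have "0 \<le> C * sqrt (2 * real n / \<eta>)" using C0 \<eta> by simp
    then show ?thesis using True by (simp add: B_def E_def h_def C_def)
  next
    case False
    have "(B - E)\<^sup>2 * (\<eta> / 2) \<le> (B - E)\<^sup>2 * prb (prod_pmfs ws) A"
      using PA by (intro mult_left_mono) auto
    also have "\<dots> = expct (prod_pmfs ws) (\<lambda>ys. (B - E)\<^sup>2 * indicator A ys)" by simp
    also have "\<dots> \<le> expct (prod_pmfs ws) (\<lambda>xs. (h xs - E)\<^sup>2)"
    proof (rule expct_mono)
      fix ys assume ys: "ys \<in> ?S"
      show "(B - E)\<^sup>2 * indicator A ys \<le> (h ys - E)\<^sup>2"
      proof (cases "ys \<in> A")
        case True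
        then have "B - E \<le> h ys - E" using hA[OF ys] by simp
        then show ?thesis using False True by (simp add: power_mono)
      qed simp
    qed simp
    also note var
    finally have "(B - E)\<^sup>2 \<le> C\<^sup>2 * (2 * real n / \<eta>)"
      using \<eta> ws(2) by (simp add: field_simps)
    then have "B - E \<le> sqrt (C\<^sup>2 * (2 * real n / \<eta>))" by (rule real_le_rsqrt)
    also have "\<dots> = C * sqrt (2 * real n / \<eta>)" using C0 by (subst real_sqrt_mult) simp
    finally show ?thesis by (simp add: B_def E_def h_def C_def)
  qed
qed

section \<open>Channels and posteriors\<close>

text \<open>The conditional law of the first coordinate given the second. At a letter
  \<open>x\<close> of probability zero it is an unspecified law, so statements about its support are
  restricted to the support of the second marginal.\<close>

definition chan :: "('a \<times> 'b) pmf \<Rightarrow> 'b \<Rightarrow> 'a pmf" where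
  "chan p x = map_pmf fst (cond_pmf p {z. snd z = x})"

abbreviation word_chan :: "('a \<times> 'b) pmf \<Rightarrow> 'b list \<Rightarrow> 'a list pmf" where
  "word_chan p xs \<equiv> prod_pmfs (map (chan p) xs)"

lemma chan_disintegration:
  "do {x \<leftarrow> map_pmf snd p; y \<leftarrow> chan p x; return_pmf (y, x)} = p"
proof -
  have "do {x \<leftarrow> map_pmf snd p; y \<leftarrow> chan p x; return_pmf (y, x)} =
    bind_pmf (map_pmf snd p) (\<lambda>x. cond_pmf p {z. snd z = x})"
  proof (intro bind_pmf_cong refl)
    fix x assume "x \<in> set_pmf (map_pmf snd p)"
    then have ne: "set_pmf p \<inter> {z. snd z = x} \<noteq> {}" by auto
    have "bind_pmf (chan p x) (\<lambda>y. return_pmf (y, x)) = map_pmf (\<lambda>z. (fst z, x)) (cond_pmf p {z. snd z = x})"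
      by (simp add: chan_def map_pmf_def bind_assoc_pmf bind_return_pmf)
    also have "\<dots> = map_pmf id (cond_pmf p {z. snd z = x})"
      by (rule map_pmf_cong) (auto simp: ne)
    finally show "bind_pmf (chan p x) (\<lambda>y. return_pmf (y, x)) = cond_pmf p {z. snd z = x}" by simp
  qed
  then show ?thesis by (simp add: bind_cond_fibre)
qed

lemma bind_chan: "bind_pmf (map_pmf snd p) (chan p) = map_pmf fst p"
proof -
  have "map_pmf fst p = map_pmf fst (do {x \<leftarrow> map_pmf snd p; y \<leftarrow> chan p x; return_pmf (y, x)})"
    by (simp only: chan_disintegration)
  then show ?thesis
    by (simp add: map_pmf_def[of fst] bind_assoc_pmf bind_return_pmf bind_return_pmf')
qed

lemma set_chan: "x \<in> snd ` set_pmf p \<Longrightarrow> set_pmf (chan p x) = {y. (y, x) \<in> set_pmf p}"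
proof -
  assume "x \<in> snd ` set_pmf p"
  then have "set_pmf p \<inter> {z. snd z = x} \<noteq> {}" by auto
  then show ?thesis by (force simp: chan_def)
qed

lemma set_chan_subset: "x \<in> set_pmf (map_pmf snd p) \<Longrightarrow> set_pmf (chan p x) \<subseteq> set_pmf (map_pmf fst p)"
  by (auto simp: set_chan image_iff) (metis fst_conv)

lemma iid_pair_eq:
  "iid_pair n p = do {xs \<leftarrow> replicate_pmf n (map_pmf snd p); ys \<leftarrow> word_chan p xs; return_pmf (ys, xs)}"
proof (induction n)
  case 0
  then show ?case by (simp add: iid_pair_def bind_return_pmf)
next
  case (Suc n)
  let ?X = "map_pmf snd p"
  have "iid_pair (Suc n) p = do {z \<leftarrow> p; zs \<leftarrow> replicate_pmf n p; return_pmf (fst z # map fst zs, snd z # map snd zs)}"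
    by (simp add: iid_pair_def replicate_pmf.simps map_bind_pmf)
  also have "\<dots> = do {z \<leftarrow> p; w \<leftarrow> iid_pair n p; return_pmf (fst z # fst w, snd z # snd w)}"
    by (simp add: iid_pair_def bind_map_pmf)
  also have "\<dots> = do {z \<leftarrow> do {x \<leftarrow> ?X; y \<leftarrow> chan p x; return_pmf (y, x)}; w \<leftarrow> iid_pair n p; return_pmf (fst z # fst w, snd z # snd w)}"
    by (simp only: chan_disintegration)
  also have "\<dots> = do {x \<leftarrow> ?X; y \<leftarrow> chan p x; xs \<leftarrow> replicate_pmf n ?X; ys \<leftarrow> word_chan p xs;
      return_pmf (y # ys, x # xs)}"
    by (simp add: Suc bind_assoc_pmf bind_return_pmf)
  also have "\<dots> = do {x \<leftarrow> ?X; xs \<leftarrow> replicate_pmf n ?X; y \<leftarrow> chan p x; ys \<leftarrow> word_chan p xs;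
      return_pmf (y # ys, x # xs)}"
    by (subst (2) bind_commute_pmf) (rule refl)
  also have "\<dots> = do {xs \<leftarrow> replicate_pmf (Suc n) ?X; ys \<leftarrow> word_chan p xs; return_pmf (ys, xs)}"
    by (simp add: replicate_pmf.simps prod_pmfs.simps bind_assoc_pmf bind_return_pmf)
  finally show ?case .
qed

lemma map_fst_iid_pair: "map_pmf fst (iid_pair n p) = replicate_pmf n (map_pmf fst p)"
proof (induction n)
  case (Suc n)
  then show ?case
    by (simp add: iid_pair_def map_pmf_comp replicate_pmf.simps map_bind_pmf bind_map_pmf o_def)
      (metis (no_types, lifting) bind_map_pmf bind_pmf_cong)
qed (simp add: iid_pair_def)

section \<open>Mutual information as mean divergence of posteriors\<close>

lemma pair_measure_pmf:
  fixes p :: "'a::countable pmf" and q :: "'b::countable pmf"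
  shows "measure_pmf p \<Otimes>\<^sub>M measure_pmf q = measure_pmf (pair_pmf p q)"
proof (rule measure_eqI_countable)
  have "sets (measure_pmf p \<Otimes>\<^sub>M measure_pmf q) = sets (count_space (UNIV :: 'a set) \<Otimes>\<^sub>M count_space (UNIV :: 'b set))"
    by (rule sets_pair_measure_cong) auto
  also have "count_space (UNIV :: 'a set) \<Otimes>\<^sub>M count_space (UNIV :: 'b set) = count_space (UNIV \<times> UNIV)"
    by (rule pair_measure_countable) auto
  finally show "sets (measure_pmf p \<Otimes>\<^sub>M measure_pmf q) = Pow UNIV" by simp
  fix z :: "'a \<times> 'b"
  obtain a b where z: "z = (a, b)" by force
  have "emeasure (measure_pmf p \<Otimes>\<^sub>M measure_pmf q) ({a} \<times> {b}) = emeasure p {a} * emeasure q {b}"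
    by (rule measure_pmf.emeasure_pair_measure_Times) auto
  then show "emeasure (measure_pmf p \<Otimes>\<^sub>M measure_pmf q) {z} = emeasure (pair_pmf p q) {z}"
    by (simp add: z emeasure_pmf_single pmf_pair ennreal_mult)
qed auto

text \<open>The library defines mutual information as a divergence between measures; on countable
  types both arguments are laws of pairs, so \<open>kl\<close> applies.\<close>

lemma mutual_info_eq_kl:
  fixes r :: "('a::countable \<times> nat) pmf"
  shows "mutual_info r = kl r (pair_pmf (map_pmf fst r) (map_pmf snd r))"
proof -
  have cs: "count_space (UNIV :: 'a set) \<Otimes>\<^sub>M count_space (UNIV :: nat set) = count_space UNIV"
    by (subst pair_measure_countable) auto
  have d: "distr (measure_pmf r) (count_space UNIV) (\<lambda>x. (fst x, snd x)) = measure_pmf r"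
    using map_pmf_rep_eq[of "\<lambda>x. x" r] by (simp add: map_pmf_def bind_return_pmf')
  have "mutual_info r = KL_divergence (exp 1)
      (measure_pmf (map_pmf fst r) \<Otimes>\<^sub>M measure_pmf (map_pmf snd r)) (measure_pmf r)"
    unfolding mutual_info_def prob_space.mutual_information_def[OF prob_space_measure_pmf] cs d
    by (simp add: map_pmf_rep_eq)
  also have "\<dots> = kl r (pair_pmf (map_pmf fst r) (map_pmf snd r))"
    unfolding pair_measure_pmf by (rule KL_divergence_pmf) force
  finally show ?thesis .
qed

text \<open>The pair is generated backwards, \<open>U\<close> first and then the other coordinate
  from its posterior, in contrast to \<open>law_XU\<close>. Read this way, mutual information is the
  mean divergence of the posteriors from their barycentre
  \<open>bind_pmf \<sigma> Q\<close>.\<close>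

definition mix_law :: "'u pmf \<Rightarrow> ('u \<Rightarrow> 'a pmf) \<Rightarrow> ('a \<times> 'u) pmf" where
  "mix_law \<sigma> Q = do {u \<leftarrow> \<sigma>; a \<leftarrow> Q u; return_pmf (a, u)}"

lemma mix_law_chan: "mix_law (map_pmf snd r) (chan r) = r"
  by (simp add: mix_law_def chan_disintegration)

lemma pmf_mix_law: "pmf (mix_law \<sigma> Q) (a, u) = pmf \<sigma> u * pmf (Q u) a"
  unfolding mix_law_def by (rule pmf_bind_inj) (auto simp: inj_def)

lemma map_snd_mix_law: "map_pmf snd (mix_law \<sigma> Q) = \<sigma>"
  by (simp add: mix_law_def map_bind_pmf bind_return_pmf')

lemma map_fst_mix_law: "map_pmf fst (mix_law \<sigma> Q) = bind_pmf \<sigma> Q"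
  by (simp add: mix_law_def map_bind_pmf bind_return_pmf')

lemma mutual_info_mix_law:
  fixes \<sigma> :: "nat pmf" and Q :: "nat \<Rightarrow> 'a::finite pmf"
  assumes fin: "finite (set_pmf \<sigma>)"
  shows "mutual_info (mix_law \<sigma> Q) = expct \<sigma> (\<lambda>u. kl (Q u) (bind_pmf \<sigma> Q))"
proof -
  have "mutual_info (mix_law \<sigma> Q) =
    expct (mix_law \<sigma> Q) (\<lambda>z. ln (pmf (mix_law \<sigma> Q) z / pmf (pair_pmf (bind_pmf \<sigma> Q) \<sigma>) z))"
    by (simp add: mutual_info_eq_kl kl_def map_fst_mix_law map_snd_mix_law)
  also have "\<dots> = expct (mix_law \<sigma> Q) (\<lambda>(a, u). ln (pmf (Q u) a / pmf (bind_pmf \<sigma> Q) a))"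
  proof (intro expct_cong refl)
    fix z assume "z \<in> set_pmf (mix_law \<sigma> Q)"
    then have "pmf \<sigma> (snd z) > 0" by (auto simp: mix_law_def set_bind_pmf intro: pmf_positive)
    then show "ln (pmf (mix_law \<sigma> Q) z / pmf (pair_pmf (bind_pmf \<sigma> Q) \<sigma>) z) =
        (case z of (a, u) \<Rightarrow> ln (pmf (Q u) a / pmf (bind_pmf \<sigma> Q) a))"
      by (cases z) (simp add: pmf_mix_law pmf_pair)
  qed
  also have "\<dots> = expct \<sigma> (\<lambda>u. kl (Q u) (bind_pmf \<sigma> Q))"
    unfolding mix_law_def kl_def using fin by (simp add: expct_bind set_bind_pmf)
  finally show ?thesis .
qed

text \<open>The Markov chain Y - X - U enters here: given the input letter, the draws of
  \<open>y\<close> and \<open>u\<close> commute.\<close>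

lemma law_YU_eq:
  assumes p: "map_pmf snd p = pX"
  shows "law_YU p K = do {z \<leftarrow> law_XU pX K; y \<leftarrow> chan p (fst z); return_pmf (y, snd z)}"
proof -
  have "law_YU p K = do {z \<leftarrow> do {x \<leftarrow> pX; y \<leftarrow> chan p x; return_pmf (y, x)}; u \<leftarrow> K (snd z); return_pmf (fst z, u)}"
    unfolding p[symmetric] chan_disintegration by (simp add: law_YU_def case_prod_unfold)
  also have "\<dots> = do {x \<leftarrow> pX; y \<leftarrow> chan p x; u \<leftarrow> K x; return_pmf (y, u)}"
    by (simp add: bind_assoc_pmf bind_return_pmf)
  also have "\<dots> = do {x \<leftarrow> pX; u \<leftarrow> K x; y \<leftarrow> chan p x; return_pmf (y, u)}"
    by (subst (2) bind_commute_pmf) (rule refl)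
  also have "\<dots> = do {z \<leftarrow> law_XU pX K; y \<leftarrow> chan p (fst z); return_pmf (y, snd z)}"
    by (simp add: law_XU_def bind_assoc_pmf bind_return_pmf)
  finally show ?thesis .
qed

lemma law_YU_mix:
  assumes "map_pmf snd p = pX" "law_XU pX K = mix_law \<sigma> Q"
  shows "law_YU p K = mix_law \<sigma> (\<lambda>u. bind_pmf (Q u) (chan p))"
  unfolding law_YU_eq[OF assms(1)] assms(2) by (simp add: mix_law_def bind_assoc_pmf bind_return_pmf)

lemma map_fst_law_XU: "map_pmf fst (law_XU pX K) = pX"
  by (simp add: law_XU_def map_bind_pmf bind_return_pmf')

lemma bind_bind_chan:
  assumes "bind_pmf \<sigma> Q = map_pmf snd p"
  shows "bind_pmf \<sigma> (\<lambda>u. bind_pmf (Q u) (chan p)) = map_pmf fst p"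
  by (simp add: assms bind_chan flip: bind_assoc_pmf)

text \<open>\<open>infoX\<close> and \<open>infoY\<close> are I(X;U) and I(Y;U) as functions of the
  law \<open>\<sigma>\<close> of the posterior. Both are linear in \<open>\<sigma>\<close>, and both
  are defined even if the barycentre of \<open>\<sigma>\<close> is not \<open>pX\<close>, which
  happens inside the converse.\<close>

abbreviation infoX :: "'x pmf \<Rightarrow> 'x pmf pmf \<Rightarrow> real" where
  "infoX pX \<sigma> \<equiv> expct \<sigma> (\<lambda>R. kl R pX)"

abbreviation infoY :: "('y \<times> 'x) pmf \<Rightarrow> 'x pmf pmf \<Rightarrow> real" where
  "infoY p \<sigma> \<equiv> expct \<sigma> (\<lambda>R. kl (bind_pmf R (chan p)) (map_pmf fst p))"

text \<open>
  As far as the two informations are concerned, a test channel is determined by the law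
  \<open>\<sigma>\<close> of the posterior \<open>P\<^bsub>X|U=u\<^esub>\<close>, a law on laws whose barycentre is \<open>pX\<close>.
\<close>

lemma mix_law_posterior:
  fixes pX :: "'x::finite pmf" and \<sigma> :: "nat pmf"
  assumes fin: "finite (set_pmf \<sigma>)" and K: "law_XU pX K = mix_law \<sigma> Q"
  shows "bind_pmf (map_pmf Q \<sigma>) id = pX"
    "mutual_info (law_XU pX K) = infoX pX (map_pmf Q \<sigma>)"
    "\<And>p :: ('y::finite \<times> 'x) pmf. map_pmf snd p = pX \<Longrightarrow>
        mutual_info (law_YU p K) = infoY p (map_pmf Q \<sigma>)"
proof -
  have b: "bind_pmf \<sigma> Q = pX"
    using map_fst_law_XU[of pX K] by (simp add: K map_fst_mix_law)
  then show "bind_pmf (map_pmf Q \<sigma>) id = pX" by (simp add: bind_map_pmf)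
  show "mutual_info (law_XU pX K) = infoX pX (map_pmf Q \<sigma>)"
    using fin by (simp add: K mutual_info_mix_law b)
  fix p :: "('y \<times> 'x) pmf" assume p: "map_pmf snd p = pX"
  show "mutual_info (law_YU p K) = infoY p (map_pmf Q \<sigma>)"
    using fin b p by (simp add: law_YU_mix[OF p K] mutual_info_mix_law bind_bind_chan)
qed

lemma posterior_law_exists:
  fixes pX :: "'x::finite pmf"
  assumes "finite (\<Union>x. set_pmf (K x))"
  obtains \<sigma> :: "'x pmf pmf" where "finite (set_pmf \<sigma>)" "bind_pmf \<sigma> id = pX"
    "mutual_info (law_XU pX K) = infoX pX \<sigma>"
    "\<And>p :: ('y::finite \<times> 'x) pmf. map_pmf snd p = pX \<Longrightarrow>
        mutual_info (law_YU p K) = infoY p \<sigma>"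
proof -
  define \<sigma>' where "\<sigma>' = map_pmf snd (law_XU pX K)"
  have "set_pmf \<sigma>' \<subseteq> (\<Union>x. set_pmf (K x))"
    by (auto simp: \<sigma>'_def law_XU_def set_bind_pmf)
  then have fin: "finite (set_pmf \<sigma>')" using assms finite_subset by blast
  have K: "law_XU pX K = mix_law \<sigma>' (chan (law_XU pX K))"
    by (simp add: \<sigma>'_def mix_law_chan)
  show ?thesis
    by (rule that[of "map_pmf (chan (law_XU pX K)) \<sigma>'"])
      (use fin mix_law_posterior[OF fin K] in auto)
qed

text \<open>Bayes' rule backwards: the finitely many posteriors are numbered, the number is
  \<open>U\<close>, and the kernel is the conditional law of the number given the letter.\<close>

lemma realize_posterior_law:
  fixes pX :: "'x::finite pmf" and \<sigma> :: "'x pmf pmf"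
  assumes fin: "finite (set_pmf \<sigma>)" and bary: "bind_pmf \<sigma> id = pX"
  obtains K :: "'x \<Rightarrow> nat pmf" where "finite (\<Union>x. set_pmf (K x))"
    "mutual_info (law_XU pX K) = infoX pX \<sigma>"
    "\<And>p :: ('y::finite \<times> 'x) pmf. map_pmf snd p = pX \<Longrightarrow>
        mutual_info (law_YU p K) = infoY p \<sigma>"
proof -
  have cnt: "countable (set_pmf \<sigma>)" using fin by (rule countable_finite)
  define \<sigma>' where "\<sigma>' = map_pmf (to_nat_on (set_pmf \<sigma>)) \<sigma>"
  define Q where "Q = from_nat_into (set_pmf \<sigma>)"
  have fin': "finite (set_pmf \<sigma>')" using fin by (simp add: \<sigma>'_def)
  have map_Q: "map_pmf Q \<sigma>' = \<sigma>"
  proof -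
    have "map_pmf Q \<sigma>' = map_pmf (\<lambda>R. R) \<sigma>"
      unfolding \<sigma>'_def map_pmf_comp Q_def
      by (intro map_pmf_cong refl) (simp add: cnt)
    then show ?thesis by simp
  qed
  define r where "r = map_pmf prod.swap (mix_law \<sigma>' Q)"
  have snd_r: "map_pmf snd r = pX"
  proof -
    have "map_pmf snd r = map_pmf fst (mix_law \<sigma>' Q)" by (simp add: r_def map_pmf_comp)
    also have "\<dots> = bind_pmf (map_pmf Q \<sigma>') id" by (simp add: map_fst_mix_law bind_map_pmf)
    finally show ?thesis by (simp add: map_Q bary)
  qed
  have fst_r: "map_pmf fst r = \<sigma>'" by (simp add: r_def map_pmf_comp map_snd_mix_law)
  \<comment> \<open>Off the support of \<open>pX\<close> the conditional law is unspecified; the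
    constant value 0 keeps the alphabet of \<open>U\<close> finite.\<close>
  define K where "K = (\<lambda>x. if x \<in> set_pmf pX then chan r x else return_pmf 0)"
  have "law_XU pX K = do {x \<leftarrow> map_pmf snd r; u \<leftarrow> chan r x; return_pmf (x, u)}"
    unfolding law_XU_def snd_r by (intro bind_pmf_cong refl) (auto simp: K_def)
  also have "\<dots> = map_pmf prod.swap (do {x \<leftarrow> map_pmf snd r; u \<leftarrow> chan r x; return_pmf (u, x)})"
    by (simp add: map_bind_pmf)
  also have "\<dots> = mix_law \<sigma>' Q" by (simp only: chan_disintegration) (simp add: r_def map_pmf_comp)
  finally have K: "law_XU pX K = mix_law \<sigma>' Q" .
  have "(\<Union>x. set_pmf (K x)) \<subseteq> insert 0 (set_pmf \<sigma>')"
  proof -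
    have "set_pmf (chan r x) \<subseteq> set_pmf \<sigma>'" if "x \<in> set_pmf pX" for x
      using set_chan_subset[of x r] that unfolding snd_r fst_r .
    then show ?thesis by (fastforce simp: K_def split: if_splits)
  qed
  then have "finite (\<Union>x. set_pmf (K x))" using fin' by (meson finite_insert finite_subset)
  then show ?thesis
    using that[of K] mix_law_posterior(2,3)[OF fin' K] unfolding map_Q by blast
qed

section \<open>Mixtures of posterior laws\<close>

lemma expct_bernoulli_mix:
  assumes "0 \<le> l" "l \<le> 1" "finite (set_pmf \<sigma>1)" "finite (set_pmf \<sigma>2)"
  shows "expct (bind_pmf (bernoulli_pmf l) (\<lambda>b. if b then \<sigma>1 else \<sigma>2)) g = l * expct \<sigma>1 g + (1 - l) * expct \<sigma>2 g"
  using assms by (subst expct_bind) auto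

lemma pmf_bernoulli_mix:
  assumes "0 \<le> l" "l \<le> 1"
  shows "pmf (bind_pmf (bernoulli_pmf l) (\<lambda>b. if b then p else q)) x = l * pmf p x + (1 - l) * pmf q x"
  using assms by (simp add: pmf_bind)

lemma finite_bernoulli_mix:
  assumes "finite (set_pmf \<sigma>1)" "finite (set_pmf \<sigma>2)"
  shows "finite (set_pmf (bind_pmf (bernoulli_pmf l) (\<lambda>b. if b then \<sigma>1 else \<sigma>2)))"
  using assms by (auto simp: set_bind_pmf)

lemma bernoulli_mix_same:
  "bind_pmf (bind_pmf (bernoulli_pmf l) (\<lambda>b. if b then \<sigma>1 else \<sigma>2)) f =
   bind_pmf (bernoulli_pmf l) (\<lambda>b. if b then bind_pmf \<sigma>1 f else bind_pmf \<sigma>2 f)"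
  unfolding bind_assoc_pmf by (intro bind_pmf_cong refl) auto

text \<open>An erased symbol has posterior \<open>pX\<close>, at which both divergences vanish, so
  both informations scale by exactly 1 - l.\<close>

lemma erase_posterior:
  fixes pX :: "'x::finite pmf" and \<sigma> :: "'x pmf pmf"
  assumes l: "0 \<le> l" "l \<le> 1" and fin: "finite (set_pmf \<sigma>)" and bary: "bind_pmf \<sigma> id = pX"
  obtains \<sigma>' :: "'x pmf pmf" where "finite (set_pmf \<sigma>')" "bind_pmf \<sigma>' id = pX"
    "infoX pX \<sigma>' = (1 - l) * infoX pX \<sigma>"
    "\<And>p :: ('y::finite \<times> 'x) pmf. map_pmf snd p = pX \<Longrightarrow>
        infoY p \<sigma>' =
        (1 - l) * infoY p \<sigma>"
proof -
  define \<sigma>' where "\<sigma>' = bind_pmf (bernoulli_pmf l) (\<lambda>b. if b then return_pmf pX else \<sigma>)"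
  have e: "expct \<sigma>' g = l * g pX + (1 - l) * expct \<sigma> g" for g
    using l fin by (simp add: \<sigma>'_def expct_bernoulli_mix)
  show ?thesis
  proof (rule that[of \<sigma>'])
    show "finite (set_pmf \<sigma>')" using fin by (simp add: \<sigma>'_def finite_bernoulli_mix)
    have "(\<lambda>b. if b then bind_pmf (return_pmf pX) id else bind_pmf \<sigma> id) = (\<lambda>_. pX)"
      by (auto simp: fun_eq_iff bind_return_pmf bary)
    then show "bind_pmf \<sigma>' id = pX" by (simp only: \<sigma>'_def bernoulli_mix_same) simp
    show "infoX pX \<sigma>' = (1 - l) * infoX pX \<sigma>" by (simp add: e)
    fix p :: "('y \<times> 'x) pmf" assume p: "map_pmf snd p = pX"
    have "bind_pmf pX (chan p) = map_pmf fst p" using bind_chan[of p] p by simp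
    then show "infoY p \<sigma>' =
        (1 - l) * infoY p \<sigma>" by (simp add: e)
  qed
qed

section \<open>Single-letterization\<close>

lemma expct_bind2:
  assumes "finite (set_pmf p)" "\<And>a. a \<in> set_pmf p \<Longrightarrow> finite (set_pmf (R a))"
  shows "expct (do {a \<leftarrow> p; b \<leftarrow> R a; return_pmf (h a b)}) g = expct p (\<lambda>a. expct (R a) (\<lambda>b. g (h a b)))"
proof -
  have "expct (do {a \<leftarrow> p; b \<leftarrow> R a; return_pmf (h a b)}) g =
    expct p (\<lambda>a. expct (do {b \<leftarrow> R a; return_pmf (h a b)}) g)"
    using assms by (intro expct_bind) (auto simp: set_bind_pmf)
  also have "\<dots> = expct p (\<lambda>a. expct (R a) (\<lambda>b. g (h a b)))"
    by (rule expct_cong[OF refl], subst expct_bind) (use assms in auto)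
  finally show ?thesis .
qed

lemma expct_bind3:
  assumes "finite (set_pmf p)" "\<And>a. a \<in> set_pmf p \<Longrightarrow> finite (set_pmf (R a))"
    "\<And>a b. a \<in> set_pmf p \<Longrightarrow> b \<in> set_pmf (R a) \<Longrightarrow> finite (set_pmf (S a b))"
  shows "expct (do {a \<leftarrow> p; b \<leftarrow> R a; c \<leftarrow> S a b; return_pmf (h a b c)}) g =
    expct p (\<lambda>a. expct (R a) (\<lambda>b. expct (S a b) (\<lambda>c. g (h a b c))))"
proof -
  have "expct (do {a \<leftarrow> p; b \<leftarrow> R a; c \<leftarrow> S a b; return_pmf (h a b c)}) g =
    expct p (\<lambda>a. expct (do {b \<leftarrow> R a; c \<leftarrow> S a b; return_pmf (h a b c)}) g)"
    using assms by (intro expct_bind) (auto simp: set_bind_pmf)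
  also have "\<dots> = expct p (\<lambda>a. expct (R a) (\<lambda>b. expct (S a b) (\<lambda>c. g (h a b c))))"
    by (rule expct_cong[OF refl], rule expct_bind2) (use assms in auto)
  finally show ?thesis .
qed

text \<open>The chain rule for a product reference law: the conditional reference is the same
  \<open>s\<close> for every first letter.\<close>

lemma kl_chain:
  assumes "finite (set_pmf p)" "\<And>a. a \<in> set_pmf p \<Longrightarrow> finite (set_pmf (R a))"
    and "set_pmf p \<subseteq> set_pmf q" "\<And>a. a \<in> set_pmf p \<Longrightarrow> set_pmf (R a) \<subseteq> set_pmf s"
  shows "kl (do {a \<leftarrow> p; as \<leftarrow> R a; return_pmf (a # as)}) (do {a \<leftarrow> q; as \<leftarrow> s; return_pmf (a # as)}) =
    kl p q + expct p (\<lambda>a. kl (R a) s)"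
proof -
  let ?r = "do {a \<leftarrow> p; as \<leftarrow> R a; return_pmf (a # as)}"
  let ?t = "do {a \<leftarrow> q; as \<leftarrow> s; return_pmf (a # as)}"
  have inj: "inj (\<lambda>(a, as). a # as)" by (auto simp: inj_def)
  have r: "pmf ?r (a # as) = pmf p a * pmf (R a) as" for a as by (rule pmf_bind_inj[OF inj])
  have t: "pmf ?t (a # as) = pmf q a * pmf s as" for a as by (rule pmf_bind_Cons)
  have "kl ?r ?t = expct p (\<lambda>a. expct (R a) (\<lambda>as. ln (pmf ?r (a # as) / pmf ?t (a # as))))"
    unfolding kl_def using assms(1,2) by (rule expct_bind2)
  also have "\<dots> = expct p (\<lambda>a. expct (R a) (\<lambda>as. ln (pmf p a / pmf q a) + ln (pmf (R a) as / pmf s as)))"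
  proof (intro expct_cong refl)
    fix a as assume a: "a \<in> set_pmf p" and as: "as \<in> set_pmf (R a)"
    then have "0 < pmf p a" "0 < pmf q a" "0 < pmf (R a) as" "0 < pmf s as"
      using assms by (auto intro!: pmf_positive)
    then show "ln (pmf ?r (a # as) / pmf ?t (a # as)) = ln (pmf p a / pmf q a) + ln (pmf (R a) as / pmf s as)"
      by (simp add: r t ln_div ln_mult)
  qed
  also have "\<dots> = expct p (\<lambda>a. ln (pmf p a / pmf q a) + kl (R a) s)"
    unfolding kl_def by (intro expct_cong refl) (simp add: expct_add assms)
  finally show ?thesis using assms by (simp add: expct_add kl_def)
qed

text \<open>Conditioning on more only increases the divergence from a product law.\<close>

lemma kl_mixture_chain:
  assumes finp: "finite (set_pmf p)" and finW: "\<And>a. a \<in> set_pmf p \<Longrightarrow> finite (set_pmf (W a))"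
    and finS: "\<And>a. a \<in> set_pmf p \<Longrightarrow> finite (set_pmf (S a))"
    and W: "\<And>a. a \<in> set_pmf p \<Longrightarrow> set_pmf (W a) \<subseteq> set_pmf q"
    and S: "\<And>a. a \<in> set_pmf p \<Longrightarrow> set_pmf (S a) \<subseteq> set_pmf s"
  shows "kl (do {a \<leftarrow> p; y \<leftarrow> W a; ys \<leftarrow> S a; return_pmf (y # ys)}) (do {y \<leftarrow> q; ys \<leftarrow> s; return_pmf (y # ys)}) \<le>
    kl (bind_pmf p W) q + expct p (\<lambda>a. kl (S a) s)"
proof -
  define r where "r = do {a \<leftarrow> p; y \<leftarrow> W a; ys \<leftarrow> S a; return_pmf (y # ys)}"
  define r1 where "r1 = bind_pmf p W"
  let ?t = "do {y \<leftarrow> q; ys \<leftarrow> s; return_pmf (y # ys)}"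
  have t: "pmf ?t (y # ys) = pmf q y * pmf s ys" for y ys by (rule pmf_bind_Cons)
  have pos: "0 < pmf r (y # ys)" "0 < pmf r1 y" "0 < pmf (S a) ys" "0 < pmf q y" "0 < pmf s ys"
    if "a \<in> set_pmf p" "y \<in> set_pmf (W a)" "ys \<in> set_pmf (S a)" for a y ys
    using that W S by (auto simp: r_def r1_def set_bind_pmf intro!: pmf_positive)
  \<comment> \<open>\<open>f\<close> is the law of the tail given \<open>y\<close> divided by the
    law of the tail given \<open>a\<close>. Its mean under the latter is at most 1, so ln f \<le> f
    - 1 shows that conditioning the tail on \<open>a\<close> in place of \<open>y\<close> cannot
    lower the divergence.\<close>
  define f where "f = (\<lambda>a y ys. pmf r (y # ys) / (pmf r1 y * pmf (S a) ys))"
  have marg: "expct (S a) (f a y) \<le> 1" if a: "a \<in> set_pmf p" and y: "y \<in> set_pmf (W a)" for a y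
  proof -
    have "expct (S a) (f a y) = (\<Sum>ys\<in>set_pmf (S a). pmf r (y # ys) / pmf r1 y)"
      by (subst expct_sum[OF finS[OF a] order_refl]) (auto simp: f_def set_pmf_iff intro!: sum.cong)
    also have "\<dots> = (\<Sum>z\<in>(#) y ` set_pmf (S a). pmf r z) / pmf r1 y"
      by (subst sum.reindex) (auto simp: inj_on_def sum_divide_distrib)
    finally have eq: "expct (S a) (f a y) = (\<Sum>z\<in>(#) y ` set_pmf (S a). pmf r z) / pmf r1 y" .
    have "(\<Sum>z\<in>(#) y ` set_pmf (S a). pmf r z) = prb r ((#) y ` set_pmf (S a))"
      using finS[OF a] by (simp add: measure_measure_pmf_finite)
    also have "\<dots> \<le> prb r (hd -` {y})"
      by (rule measure_pmf.finite_measure_mono) auto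
    also have "\<dots> = pmf (map_pmf hd r) y" by (simp add: pmf_map)
    also have "map_pmf hd r = r1"
      by (simp add: r_def r1_def map_bind_pmf bind_return_pmf')
    finally have le: "(\<Sum>z\<in>(#) y ` set_pmf (S a). pmf r z) \<le> pmf r1 y" .
    have "0 < pmf r1 y" using a y by (auto simp: r1_def set_bind_pmf intro!: pmf_positive)
    with le show ?thesis unfolding eq by (simp only: divide_le_eq_1_pos)
  qed
  have "kl r ?t = expct p (\<lambda>a. expct (W a) (\<lambda>y. expct (S a) (\<lambda>ys. ln (pmf r (y # ys) / pmf ?t (y # ys)))))"
    unfolding kl_def by (subst r_def, rule expct_bind3) (use assms in auto)
  also have "\<dots> \<le> expct p (\<lambda>a. expct (W a) (\<lambda>y. expct (S a) (\<lambda>ys.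
      (ln (pmf r1 y / pmf q y) + ln (pmf (S a) ys / pmf s ys)) + (f a y ys - 1))))"
  proof (intro expct_mono finp finW finS)
    fix a y ys assume *: "a \<in> set_pmf p" "y \<in> set_pmf (W a)" "ys \<in> set_pmf (S a)"
    note pos = pos[OF *]
    have "ln (pmf r (y # ys) / pmf ?t (y # ys)) =
        ln (pmf r1 y / pmf q y) + ln (pmf (S a) ys / pmf s ys) + ln (f a y ys)"
      using pos by (simp add: f_def t ln_div ln_mult)
    moreover have "ln (f a y ys) \<le> f a y ys - 1"
      using pos by (intro ln_le_minus_one) (simp add: f_def)
    ultimately show "ln (pmf r (y # ys) / pmf ?t (y # ys)) \<le>
        (ln (pmf r1 y / pmf q y) + ln (pmf (S a) ys / pmf s ys)) + (f a y ys - 1)" by simp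
  qed
  also have "\<dots> = expct p (\<lambda>a. expct (W a) (\<lambda>y. (ln (pmf r1 y / pmf q y) + kl (S a) s) + (expct (S a) (f a y) - 1)))"
    by (intro expct_cong refl) (simp add: finS expct_add expct_diff kl_def)
  also have "\<dots> \<le> expct p (\<lambda>a. expct (W a) (\<lambda>y. ln (pmf r1 y / pmf q y) + kl (S a) s))"
    using marg by (intro expct_mono finp finW) auto
  also have "\<dots> = expct p (\<lambda>a. expct (W a) (\<lambda>y. ln (pmf r1 y / pmf q y)) + kl (S a) s)"
    by (intro expct_cong refl) (simp add: finW expct_add)
  also have "\<dots> = kl r1 q + expct p (\<lambda>a. kl (S a) s)"
    using finp finW by (simp add: expct_add kl_def r1_def expct_bind)
  finally show ?thesis by (simp add: r_def r1_def)
qed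

lemma split_first_letter:
  assumes "set_pmf Q \<subseteq> {xs. length xs = Suc n}"
  shows "Q = do {a \<leftarrow> map_pmf hd Q; as \<leftarrow> map_pmf tl (cond_pmf Q {xs. hd xs = a}); return_pmf (a # as)}"
proof -
  have "do {a \<leftarrow> map_pmf hd Q; as \<leftarrow> map_pmf tl (cond_pmf Q {xs. hd xs = a}); return_pmf (a # as)} =
    bind_pmf (map_pmf hd Q) (\<lambda>a. cond_pmf Q {xs. hd xs = a})"
  proof (intro bind_pmf_cong refl)
    fix a assume "a \<in> set_pmf (map_pmf hd Q)"
    then have ne: "set_pmf Q \<inter> {xs. hd xs = a} \<noteq> {}" by auto
    have "bind_pmf (map_pmf tl (cond_pmf Q {xs. hd xs = a})) (\<lambda>as. return_pmf (a # as)) =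
      map_pmf (\<lambda>xs. a # tl xs) (cond_pmf Q {xs. hd xs = a})"
      by (simp add: map_pmf_def bind_assoc_pmf bind_return_pmf)
    also have "\<dots> = map_pmf id (cond_pmf Q {xs. hd xs = a})"
    proof (rule map_pmf_cong[OF refl])
      fix xs assume "xs \<in> set_pmf (cond_pmf Q {xs. hd xs = a})"
      then have "xs \<in> set_pmf Q" "hd xs = a" using ne by auto
      then show "a # tl xs = id xs" using assms by (cases xs) auto
    qed
    finally show "bind_pmf (map_pmf tl (cond_pmf Q {xs. hd xs = a})) (\<lambda>as. return_pmf (a # as)) =
      cond_pmf Q {xs. hd xs = a}" by simp
  qed
  then show ?thesis by (simp add: bind_cond_fibre)
qed

lemma set_replicate_chan:
  assumes xs: "xs \<in> set_pmf (replicate_pmf n (map_pmf snd p))"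
  shows "set_pmf (word_chan p xs) \<subseteq> set_pmf (replicate_pmf n (map_pmf fst p))"
proof
  fix ys assume ys: "ys \<in> set_pmf (word_chan p xs)"
  have len: "length ys = n" using ys xs by (simp add: length_prod_pmfs length_replicate_pmf)
  have "ys ! i \<in> set_pmf (map_pmf fst p)" if "i < n" for i
  proof -
    have "xs ! i \<in> set_pmf (map_pmf snd p)" using xs that by (auto simp: set_replicate_pmf in_lists_conv_set simp del: set_map_pmf)
    moreover have "ys ! i \<in> set_pmf (chan p (xs ! i))"
      using ys that len by (auto simp: set_prod_pmfs list_all2_conv_all_nth)
    ultimately show ?thesis by (meson set_chan_subset subsetD)
  qed
  then show "ys \<in> set_pmf (replicate_pmf n (map_pmf fst p))"
    unfolding set_replicate_pmf using len by (metis (mono_tags, lifting) in_lists_conv_set in_set_conv_nth mem_Collect_eq)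
qed

text \<open>\<open>\<sigma>\<close> plays the posterior of a uniformly chosen letter of a word with
  law \<open>Q\<close>, given the letters before it. Its barycentre is then the mean letter
  frequency under \<open>Q\<close>, hence the use of \<open>count_list\<close>. The X-divergence
  decomposes exactly, the Y-divergences only as an inequality, and one \<open>\<sigma>\<close>
  serves all channels in \<open>C\<close>.\<close>

definition single_letter_law ::
  "('y \<times> 'x) pmf set \<Rightarrow> nat \<Rightarrow> 'x pmf \<Rightarrow> 'x list pmf \<Rightarrow> 'x pmf pmf \<Rightarrow> bool"
where
  "single_letter_law C n pX Q \<sigma> \<longleftrightarrow>
    finite (set_pmf \<sigma>) \<and> (\<forall>R\<in>set_pmf \<sigma>. set_pmf R \<subseteq> set_pmf pX) \<and>
    (\<forall>a. real n * expct \<sigma> (\<lambda>R. pmf R a) = expct Q (\<lambda>xs. real (count_list xs a))) \<and>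
    real n * infoX pX \<sigma> = kl Q (replicate_pmf n pX) \<and>
    (\<forall>p\<in>C. kl (bind_pmf Q (word_chan p)) (replicate_pmf n (map_pmf fst p))
       \<le> real n * infoY p \<sigma>)"

lemma single_letter_lawD:
  assumes "single_letter_law C n pX Q \<sigma>"
  shows "finite (set_pmf \<sigma>)" "\<And>R. R \<in> set_pmf \<sigma> \<Longrightarrow> set_pmf R \<subseteq> set_pmf pX"
    "\<And>a. real n * expct \<sigma> (\<lambda>R. pmf R a) = expct Q (\<lambda>xs. real (count_list xs a))"
    "real n * infoX pX \<sigma> = kl Q (replicate_pmf n pX)"
    "\<And>p. p \<in> C \<Longrightarrow> kl (bind_pmf Q (word_chan p)) (replicate_pmf n (map_pmf fst p)) \<le> real n * infoY p \<sigma>"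
  using assms unfolding single_letter_law_def by blast+

text \<open>With probability 1/(n+1) the chosen letter is the first one, with posterior
  \<open>Q1\<close>; otherwise the first letter is drawn and the induction hypothesis handles the
  conditional law of the tail. At the output, conditioning on past inputs replaces conditioning on
  past outputs, which is the inequality \<open>kl_mixture_chain\<close>. The usual auxiliary
  variable, a time index together with the past letters, is thus built into the recursion.\<close>

lemma single_letter:
  fixes pX :: "'x::finite pmf" and Q :: "'x list pmf" and C :: "('y::finite \<times> 'x) pmf set"
  assumes "set_pmf Q \<subseteq> set_pmf (replicate_pmf n pX)" and C: "\<And>p. p \<in> C \<Longrightarrow> map_pmf snd p = pX"
  shows "\<exists>\<sigma>. single_letter_law C n pX Q \<sigma>"
  using assms(1)
proof (induction n arbitrary: Q)
  case 0
  then have "set_pmf Q \<subseteq> {[]}" by auto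
  then have Q: "Q = return_pmf []" by (simp add: set_pmf_subset_singleton)
  \<comment> \<open>At length zero both sides of every condition vanish, so any law concentrated on
    laws supported in \<open>pX\<close> will do.\<close>
  show ?case
    by (rule exI[of _ "return_pmf pX"]) (simp add: single_letter_law_def Q bind_return_pmf)
next
  case (Suc n)
  define Q1 where "Q1 = map_pmf hd Q"
  define R where "R = (\<lambda>a. map_pmf tl (cond_pmf Q {xs. hd xs = a}))"
  have len: "set_pmf Q \<subseteq> {xs. length xs = Suc n}"
    using Suc.prems by (auto simp: set_replicate_pmf)
  have Q: "Q = do {a \<leftarrow> Q1; as \<leftarrow> R a; return_pmf (a # as)}"
    unfolding Q1_def R_def by (rule split_first_letter[OF len])
  have Q1_supp: "set_pmf Q1 \<subseteq> set_pmf pX"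
  proof
    fix a assume "a \<in> set_pmf Q1"
    then obtain xs where "xs \<in> set_pmf Q" "a = hd xs" by (auto simp: Q1_def)
    then show "a \<in> set_pmf pX" using Suc.prems by (cases xs) (auto simp: set_replicate_pmf subset_iff)
  qed
  have R_supp: "set_pmf (R a) \<subseteq> set_pmf (replicate_pmf n pX)" if "a \<in> set_pmf Q1" for a
  proof
    fix as assume "as \<in> set_pmf (R a)"
    then have "a # as \<in> set_pmf Q" using that by (subst Q) (auto simp: set_bind_pmf)
    then show "as \<in> set_pmf (replicate_pmf n pX)" using Suc.prems by (auto simp: set_replicate_pmf subset_iff)
  qed
  have finR: "finite (set_pmf (R a))" if "a \<in> set_pmf Q1" for a
    using R_supp[OF that] by (rule finite_subset) simp
  have "\<forall>a\<in>set_pmf Q1. \<exists>\<sigma>. single_letter_law C n pX (R a) \<sigma>"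
    using Suc.IH[OF R_supp] by blast
  then obtain \<sigma>0 where \<sigma>0': "\<forall>a\<in>set_pmf Q1. single_letter_law C n pX (R a) (\<sigma>0 a)"
    by (auto simp: bchoice_iff)
  note \<sigma>0 = single_letter_lawD[OF \<sigma>0'[THEN bspec]]
  define l where "l = 1 / (real n + 1)"
  have l: "0 \<le> l" "l \<le> 1" "real (Suc n) * l = 1" "real (Suc n) * (1 - l) = real n"
    by (auto simp: l_def field_simps)
  define \<sigma> where "\<sigma> = bind_pmf (bernoulli_pmf l) (\<lambda>b. if b then return_pmf Q1 else bind_pmf Q1 \<sigma>0)"
  have fin2: "finite (set_pmf (bind_pmf Q1 \<sigma>0))" using \<sigma>0(1) by (simp add: set_bind_pmf)
  have E: "real (Suc n) * expct \<sigma> g = g Q1 + expct Q1 (\<lambda>a. real n * expct (\<sigma>0 a) g)" for g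
  proof -
    have "expct \<sigma> g = l * g Q1 + (1 - l) * expct Q1 (\<lambda>a. expct (\<sigma>0 a) g)"
      unfolding \<sigma>_def using l fin2 \<sigma>0(1) by (simp add: expct_bernoulli_mix expct_bind)
    then have "real (Suc n) * expct \<sigma> g = (real (Suc n) * l) * g Q1 + (real (Suc n) * (1 - l)) * expct Q1 (\<lambda>a. expct (\<sigma>0 a) g)"
      by (simp only: distrib_left mult.assoc)
    then show ?thesis unfolding l by simp
  qed
  show ?case
    unfolding single_letter_law_def
  proof (intro exI[of _ \<sigma>] conjI ballI allI)
    show "finite (set_pmf \<sigma>)" unfolding \<sigma>_def using fin2 by (intro finite_bernoulli_mix) auto
    show "set_pmf T \<subseteq> set_pmf pX" if "T \<in> set_pmf \<sigma>" for T
      using that \<sigma>0(2) Q1_supp by (auto simp: \<sigma>_def set_bind_pmf split: if_splits)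
  next
    fix a
    have "expct Q (\<lambda>xs. real (count_list xs a)) =
      expct Q1 (\<lambda>b. expct (R b) (\<lambda>xs. real (count_list (b # xs) a)))"
      by (subst Q, rule expct_bind2) (use finR in auto)
    also have "\<dots> = expct Q1 (\<lambda>b. expct (R b) (\<lambda>xs. indicator {a} b + real (count_list xs a)))"
      by (intro arg_cong[of _ _ "expct Q1"] ext arg_cong2[of _ _ _ _ expct] refl) (auto simp: indicator_def)
    also have "\<dots> = expct Q1 (\<lambda>b. indicator {a} b + real n * expct (\<sigma>0 b) (\<lambda>R. pmf R a))"
      by (intro expct_cong refl) (simp add: expct_add finR \<sigma>0(3))
    also have "\<dots> = pmf Q1 a + expct Q1 (\<lambda>b. real n * expct (\<sigma>0 b) (\<lambda>R. pmf R a))"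
      by (subst expct_add) (auto simp: measure_pmf_single)
    finally show "real (Suc n) * expct \<sigma> (\<lambda>R. pmf R a) = expct Q (\<lambda>xs. real (count_list xs a))"
      unfolding E by simp
  next
    have "kl Q (replicate_pmf (Suc n) pX) = kl Q1 pX + expct Q1 (\<lambda>a. kl (R a) (replicate_pmf n pX))"
      unfolding replicate_pmf.simps
      by (subst Q) (rule kl_chain, use finR Q1_supp R_supp in auto)
    also have "\<dots> = kl Q1 pX + expct Q1 (\<lambda>a. real n * infoX pX (\<sigma>0 a))"
      by (intro arg_cong2[of _ _ _ _ "(+)"] expct_cong refl) (simp add: \<sigma>0(4))
    finally show "real (Suc n) * infoX pX \<sigma> = kl Q (replicate_pmf (Suc n) pX)"
      unfolding E by simp
  next
    fix p assume pC: "p \<in> C"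
    then have p: "map_pmf snd p = pX" by (rule C)
    define S where "S = (\<lambda>a. bind_pmf (R a) (word_chan p))"
    have "bind_pmf Q (word_chan p) =
      do {a \<leftarrow> Q1; as \<leftarrow> R a; y \<leftarrow> chan p a; ys \<leftarrow> word_chan p as; return_pmf (y # ys)}"
      by (subst Q) (simp add: bind_assoc_pmf bind_return_pmf prod_pmfs.simps)
    also have "\<dots> = do {a \<leftarrow> Q1; y \<leftarrow> chan p a; as \<leftarrow> R a; ys \<leftarrow> word_chan p as; return_pmf (y # ys)}"
      by (subst (2) bind_commute_pmf) (rule refl)
    also have "\<dots> = do {a \<leftarrow> Q1; y \<leftarrow> chan p a; ys \<leftarrow> S a; return_pmf (y # ys)}"
      by (simp add: S_def bind_assoc_pmf)
    finally have out: "bind_pmf Q (word_chan p) =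
      do {a \<leftarrow> Q1; y \<leftarrow> chan p a; ys \<leftarrow> S a; return_pmf (y # ys)}" .
    have chan_supp: "set_pmf (chan p a) \<subseteq> set_pmf (map_pmf fst p)" if "a \<in> set_pmf pX" for a
      using set_chan_subset[of a p] that unfolding p .
    have S_supp: "set_pmf (S a) \<subseteq> set_pmf (replicate_pmf n (map_pmf fst p))" if a: "a \<in> set_pmf Q1" for a
    proof -
      have "set_pmf (word_chan p as) \<subseteq> set_pmf (replicate_pmf n (map_pmf fst p))"
        if "as \<in> set_pmf (R a)" for as
        by (rule set_replicate_chan) (use R_supp[OF a] that p in blast)
      then show ?thesis by (auto simp: S_def set_bind_pmf)
    qed
    have "kl (bind_pmf Q (word_chan p)) (replicate_pmf (Suc n) (map_pmf fst p)) \<le>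
      kl (bind_pmf Q1 (chan p)) (map_pmf fst p) + expct Q1 (\<lambda>a. kl (S a) (replicate_pmf n (map_pmf fst p)))"
      unfolding out replicate_pmf.simps
    proof (rule kl_mixture_chain)
      show "finite (set_pmf (S a))" if "a \<in> set_pmf Q1" for a
        using S_supp[OF that] by (rule finite_subset) simp
      show "set_pmf (chan p a) \<subseteq> set_pmf (map_pmf fst p)" if "a \<in> set_pmf Q1" for a
        using that Q1_supp chan_supp by blast
    qed (use S_supp in auto)
    also have "\<dots> \<le> kl (bind_pmf Q1 (chan p)) (map_pmf fst p) +
        expct Q1 (\<lambda>a. real n * infoY p (\<sigma>0 a))"
      unfolding S_def by (intro add_left_mono expct_mono \<sigma>0(5) pC) auto
    finally show "kl (bind_pmf Q (word_chan p)) (replicate_pmf (Suc n) (map_pmf fst p))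
       \<le> real (Suc n) * infoY p \<sigma>"
      unfolding E .
  qed
qed

section \<open>The converse\<close>

lemma ln_le_linear: "0 < t \<Longrightarrow> 0 < c \<Longrightarrow> ln t \<le> t / c - 1 + ln (c :: real)"
  using ln_le_minus_one[of "t / c"] by (simp add: ln_div)

text \<open>The support of \<open>q\<close> may be infinite here; integrability comes from the
  bounds on \<open>f\<close>.\<close>

lemma expct_ge_sum:
  assumes "finite A" "\<And>x. 0 \<le> f x" "\<And>x. f x \<le> 1"
  shows "(\<Sum>x\<in>A. pmf q x * f x) \<le> expct q f"
proof -
  have int: "integrable (measure_pmf q) f"
    by (rule measure_pmf.integrable_const_bound[where B = 1]) (use assms in \<open>auto simp: abs_of_nonneg\<close>)
  have "(\<Sum>x\<in>A. pmf q x * f x) = expct q (\<lambda>x. indicator A x * f x)"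
    using assms(1) by (subst integral_measure_pmf[of A]) (auto simp: indicator_def split: if_splits)
  also have "\<dots> \<le> expct q f"
    by (rule integral_mono') (use int assms in \<open>auto simp: indicator_def\<close>)
  finally show ?thesis .
qed

text \<open>On \<open>G\<close> the density of \<open>p\<close> with respect to \<open>q\<close> is
  at most \<open>k\<close>. Applied in each coordinate, this bounds acceptance under the product of
  the marginals by acceptance under a reference component.\<close>

lemma change_of_measure:
  assumes fin: "finite (set_pmf p)" and k: "0 \<le> k"
    and G: "\<And>x. x \<in> set_pmf p \<Longrightarrow> x \<in> G \<Longrightarrow> pmf p x \<le> k * pmf q x"
    and f: "\<And>x. 0 \<le> f x" "\<And>x. f x \<le> 1"
  shows "expct p (\<lambda>x. indicator G x * f x) \<le> k * expct q f"
proof -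
  have "expct p (\<lambda>x. indicator G x * f x) \<le> (\<Sum>x\<in>set_pmf p. k * (pmf q x * f x))"
    unfolding expct_sum[OF fin order_refl]
  proof (rule sum_mono)
    fix x assume x: "x \<in> set_pmf p"
    show "pmf p x * (indicator G x * f x) \<le> k * (pmf q x * f x)"
    proof (cases "x \<in> G")
      case True
      then show ?thesis using mult_right_mono[OF G[OF x True] f(1)[of x]] by (simp add: mult.assoc)
    qed (use k f in auto)
  qed
  also have "\<dots> = k * (\<Sum>x\<in>set_pmf p. pmf q x * f x)" by (simp add: sum_distrib_left)
  also have "\<dots> \<le> k * expct q f" by (intro mult_left_mono expct_ge_sum fin f k)
  finally show ?thesis .
qed

text \<open>Jensen's inequality in linearised form, with tangent point \<open>M\<close>: the mean of
  1/p under \<open>p\<close> is the size of the support.\<close>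

lemma entropy_le_ln_card:
  assumes fin: "finite (set_pmf p)" and M: "real (card (set_pmf p)) \<le> M" "0 < M"
  shows "expct p (\<lambda>x. - ln (pmf p x)) \<le> ln M"
proof -
  have "expct p (\<lambda>x. - ln (pmf p x)) \<le> expct p (\<lambda>x. (1 / pmf p x) / M - 1 + ln M)"
  proof (rule expct_mono[OF fin])
    fix x assume "x \<in> set_pmf p"
    then have "0 < pmf p x" by (rule pmf_positive)
    then show "- ln (pmf p x) \<le> (1 / pmf p x) / M - 1 + ln M"
      using ln_le_linear[of "1 / pmf p x" M] M by (simp add: ln_div)
  qed
  also have "\<dots> = expct p (\<lambda>x. (1 / pmf p x) / M) - 1 + ln M"
    using fin by (simp add: expct_add expct_diff)
  also have "expct p (\<lambda>x. (1 / pmf p x) / M) = (\<Sum>x\<in>set_pmf p. 1 / M)"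
    by (subst expct_sum[OF fin order_refl]) (auto simp: set_pmf_iff intro!: sum.cong)
  also have "\<dots> \<le> 1" using M by simp
  finally show ?thesis by simp
qed

lemma min_mass_exists:
  fixes p :: "'a::finite pmf"
  obtains \<gamma> where "0 < \<gamma>" "\<gamma> \<le> 1" "\<And>a. a \<in> set_pmf p \<Longrightarrow> \<gamma> \<le> pmf p a"
proof
  let ?g = "Min (pmf p ` set_pmf p)"
  have ne: "pmf p ` set_pmf p \<noteq> {}" "finite (pmf p ` set_pmf p)" by (auto simp: set_pmf_not_empty)
  show "0 < ?g" using ne by (auto simp: Min_gr_iff intro: pmf_positive)
  show "?g \<le> pmf p a" if "a \<in> set_pmf p" for a using that ne by (intro Min_le) auto
  then show "?g \<le> 1" by (meson order_trans pmf_le_1 set_pmf_not_empty ex_in_conv)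
qed

text \<open>\<open>B\<close> is a set of input words accepted under all components at once, and
  \<open>c i\<close> measures how rarely the test accepts under the product of the marginals. Given
  \<open>B\<close> and the message, the divergence of the input word from the i.i.d. law averages to
  at most the entropy of the message plus ln (1/b). At the output the variational bound is applied
  for each message with the same constant \<open>c i\<close>, so that only the average over messages
  of the acceptance probability has to be small. The barycentre of the resulting law exceeds
  \<open>pX\<close> by at most \<delta> at each letter.\<close>

lemma converse_n:
  fixes pX :: "'x::finite pmf" and P :: "nat \<Rightarrow> ('y::finite \<times> 'x) pmf" and \<phi> :: "'x list \<Rightarrow> nat"
    and f :: "nat \<Rightarrow> nat \<Rightarrow> 'y list \<Rightarrow> real"
  assumes marg: "\<And>i. i \<in> F \<Longrightarrow> map_pmf snd (P i) = pX"
    and M: "real (card (\<phi> ` {xs. length xs = n})) \<le> M" "0 < M"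
    and f: "\<And>i w y. 0 \<le> f i w y" "\<And>i w y. f i w y \<le> 1"
    and B: "B \<subseteq> set_pmf (replicate_pmf n pX)" "0 < b" "b \<le> prb (replicate_pmf n pX) B"
    and \<eta>: "0 < \<eta>" "\<And>i x. i \<in> F \<Longrightarrow> x \<in> B \<Longrightarrow> \<eta> \<le> expct (word_chan (P i) x) (f i (\<phi> x))"
    and typical: "\<And>x a. x \<in> B \<Longrightarrow> real (count_list x a) \<le> real n * (pmf pX a + \<delta>)"
    and z: "0 < z" "z < 1"
    and \<gamma>: "0 < \<gamma>" "\<gamma> \<le> 1" "\<And>i y. i \<in> F \<Longrightarrow> y \<in> set_pmf (map_pmf fst (P i)) \<Longrightarrow> \<gamma> \<le> pmf (map_pmf fst (P i)) y"
    and c: "\<And>i. i \<in> F \<Longrightarrow> 0 < c i"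
      "\<And>i. i \<in> F \<Longrightarrow> expct (replicate_pmf n pX) (\<lambda>x. indicator B x *
          expct (replicate_pmf n (map_pmf fst (P i))) (f i (\<phi> x))) \<le> c i * b"
  shows "\<exists>\<sigma> :: 'x pmf pmf. finite (set_pmf \<sigma>) \<and> (\<forall>R\<in>set_pmf \<sigma>. set_pmf R \<subseteq> set_pmf pX) \<and>
    (\<forall>a. real n * expct \<sigma> (\<lambda>R. pmf R a) \<le> real n * (pmf pX a + \<delta>)) \<and>
    real n * infoX pX \<sigma> \<le> ln M - ln b \<and>
    (\<forall>i\<in>F. - ln (c i) + real n * ln (1 - z) + ln (\<eta> / 2) - ln (1 / (z * \<gamma>)) * sqrt (2 * real n / \<eta>)
        \<le> real n * infoY (P i) \<sigma>)"
proof -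
  define pXn where "pXn = replicate_pmf n pX"
  define X where "X = cond_pmf pXn B"
  have "prb pXn B > 0" using B by (simp add: pXn_def)
  then have ne: "set_pmf pXn \<inter> B \<noteq> {}" by (metis disjoint_iff less_irrefl measure_pmf_zero_iff)
  have finXn: "finite (set_pmf pXn)" by (simp add: pXn_def)
  have setX: "set_pmf X = B" using B(1) ne by (auto simp: X_def pXn_def)
  have finX: "finite (set_pmf X)" by (rule finite_subset[OF _ finXn]) (use setX B(1) in \<open>auto simp: pXn_def\<close>)
  have pmfX: "pmf X x \<le> pmf pXn x / b" "pmf X x \<le> indicator B x * pmf pXn x / b" for x
  proof -
    have "pmf X x = indicator B x * pmf pXn x / prb pXn B"
      unfolding X_def by (subst pmf_cond[OF ne]) (auto simp: indicator_def)
    also have "\<dots> \<le> indicator B x * pmf pXn x / b"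
      using B by (intro divide_left_mono) (auto simp: pXn_def indicator_def)
    finally show *: "pmf X x \<le> indicator B x * pmf pXn x / b" .
    also have "\<dots> \<le> pmf pXn x / b" using B(2) by (intro divide_right_mono) (auto simp: indicator_def)
    finally show "pmf X x \<le> pmf pXn x / b" .
  qed
  define W where "W = map_pmf \<phi> X"
  define Q where "Q = (\<lambda>w. cond_pmf X {x. \<phi> x = w})"
  have X_split: "X = bind_pmf W Q" by (simp add: W_def Q_def bind_cond_fibre)
  have finW: "finite (set_pmf W)" using finX by (simp add: W_def)
  have neQ: "set_pmf X \<inter> {x. \<phi> x = w} \<noteq> {}" if "w \<in> set_pmf W" for w
    using that by (auto simp: W_def)
  have setQ: "set_pmf (Q w) = B \<inter> {x. \<phi> x = w}" if "w \<in> set_pmf W" for w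
    using neQ[OF that] by (simp add: Q_def setX)
  have finQ: "finite (set_pmf (Q w))" if "w \<in> set_pmf W" for w
    using setQ[OF that] finX setX by simp
  have Q_supp: "set_pmf (Q w) \<subseteq> set_pmf (replicate_pmf n pX)" if "w \<in> set_pmf W" for w
    using setQ[OF that] B(1) by auto
  have "\<forall>w\<in>set_pmf W. \<exists>\<sigma>. single_letter_law (P ` F) n pX (Q w) \<sigma>"
    using single_letter[OF Q_supp, of _ "P ` F"] marg by blast
  then obtain \<sigma>0 where \<sigma>0': "\<forall>w\<in>set_pmf W. single_letter_law (P ` F) n pX (Q w) (\<sigma>0 w)"
    by (auto simp: bchoice_iff)
  note \<sigma>0 = single_letter_lawD[OF \<sigma>0'[THEN bspec]]
  define \<sigma> where "\<sigma> = bind_pmf W \<sigma>0"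
  have E: "real n * expct \<sigma> g = expct W (\<lambda>w. real n * expct (\<sigma>0 w) g)" for g
    using finW \<sigma>0(1) by (simp add: \<sigma>_def expct_bind)
  show ?thesis
  proof (intro exI[of _ \<sigma>] conjI ballI allI)
    show "finite (set_pmf \<sigma>)" using finW \<sigma>0(1) by (simp add: \<sigma>_def set_bind_pmf)
    show "set_pmf R \<subseteq> set_pmf pX" if "R \<in> set_pmf \<sigma>" for R
      using that \<sigma>0(2) by (auto simp: \<sigma>_def set_bind_pmf)
  next
    fix a
    show "real n * expct \<sigma> (\<lambda>R. pmf R a) \<le> real n * (pmf pX a + \<delta>)"
      unfolding E
    proof (rule expct_const_le[OF finW])
      fix w assume w: "w \<in> set_pmf W"
      have "expct (Q w) (\<lambda>xs. real (count_list xs a)) \<le> real n * (pmf pX a + \<delta>)"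
        by (rule expct_const_le[OF finQ[OF w]]) (use setQ[OF w] typical in auto)
      then show "real n * expct (\<sigma>0 w) (\<lambda>R. pmf R a) \<le> real n * (pmf pX a + \<delta>)"
        by (simp only: \<sigma>0(3)[OF w])
    qed
  next
    have "real n * infoX pX \<sigma> \<le> expct W (\<lambda>w. - ln (pmf W w) - ln b)"
      unfolding E
    proof (rule expct_mono[OF finW])
      fix w assume w: "w \<in> set_pmf W"
      have Ww: "0 < pmf W w" using w by (rule pmf_positive)
      have prW: "prb X {x. \<phi> x = w} = pmf W w" by (simp add: W_def pmf_map vimage_def)
      \<comment> \<open>Conditioning on \<open>B\<close> and then on the message multiplies the two
        density bounds.\<close>
      have "kl (Q w) pXn \<le> ln (1 / (pmf W w * b))"
      proof (rule kl_le_of_pmf_le[OF finQ[OF w]])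
        show "0 < 1 / (pmf W w * b)" using Ww B by simp
        fix x assume "x \<in> set_pmf (Q w)"
        then have "\<phi> x = w" using setQ[OF w] by auto
        then have "pmf (Q w) x = pmf X x / pmf W w"
          unfolding Q_def by (subst pmf_cond[OF neQ[OF w]]) (simp add: prW)
        also have "\<dots> \<le> (pmf pXn x / b) / pmf W w" using pmfX(1) Ww by (intro divide_right_mono) auto
        finally show "pmf (Q w) x \<le> 1 / (pmf W w * b) * pmf pXn x" by (simp add: mult.commute)
      qed
      also have "\<dots> = - ln (pmf W w) - ln b" using Ww B by (simp add: ln_div ln_mult_pos)
      finally show "real n * infoX pX (\<sigma>0 w) \<le> - ln (pmf W w) - ln b"
        by (simp only: \<sigma>0(4)[OF w] pXn_def)
    qed
    also have "\<dots> = expct W (\<lambda>w. - ln (pmf W w)) - ln b" using finW by (simp only: expct_diff) simp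
    also have "expct W (\<lambda>w. - ln (pmf W w)) \<le> ln M"
    proof (rule entropy_le_ln_card[OF finW])
      have "set_pmf W \<subseteq> \<phi> ` {xs. length xs = n}"
        using B(1) by (auto simp: W_def setX dest: length_replicate_pmf)
      moreover have "finite {xs :: 'x list. length xs = n}"
        using finite_lists_length_eq[of "UNIV :: 'x set" n] by simp
      ultimately have "card (set_pmf W) \<le> card (\<phi> ` {xs. length xs = n})" by (intro card_mono) auto
      then show "real (card (set_pmf W)) \<le> M" using M by simp
    qed (rule M)
    finally show "real n * infoX pX \<sigma> \<le> ln M - ln b" by simp
  next
    fix i assume i: "i \<in> F"
    define pYn where "pYn = replicate_pmf n (map_pmf fst (P i))"
    define L where "L = real n * ln (1 - z) + ln (\<eta> / 2) - ln (1 / (z * \<gamma>)) * sqrt (2 * real n / \<eta>)"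
    define T where "T = (\<lambda>w y. expct (prod_pmfs (map (noise z (map_pmf fst (P i))) y)) (f i w))"
    define V where "V = (\<lambda>x. word_chan (P i) x)"
    have V_supp: "set_pmf (V x) \<subseteq> set_pmf pYn" if "x \<in> B" for x
      using set_replicate_chan[of x n "P i"] that B(1) marg[OF i] by (auto simp: V_def pYn_def)
    have noise: "L \<le> expct (V x) (\<lambda>y. ln (T (\<phi> x) y))" "\<And>y. y \<in> set_pmf (V x) \<Longrightarrow> 0 < T (\<phi> x) y"
      if x: "x \<in> B" for x
    proof -
      have ws: "set_pmf w \<subseteq> set_pmf (map_pmf fst (P i))" if w: "w \<in> set (map (chan (P i)) x)" for w
      proof -
        obtain a where a: "a \<in> set x" "w = chan (P i) a" using w by auto
        then have "a \<in> set_pmf (map_pmf snd (P i))" using x B(1) marg[OF i] by (auto simp: set_replicate_pmf subset_iff)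
        then show ?thesis unfolding a by (rule set_chan_subset)
      qed
      have len: "length (map (chan (P i)) x) = n" using x B(1) by (auto dest: length_replicate_pmf)
      note * = expct_ln_noise[OF z \<gamma>(1) \<gamma>(3)[OF i] \<gamma>(2) ws len f(1) f(2) \<eta>(1) \<eta>(2)[OF i x]]
      show "L \<le> expct (V x) (\<lambda>y. ln (T (\<phi> x) y))" using *(1) by (simp add: L_def V_def T_def)
      show "0 < T (\<phi> x) y" if "y \<in> set_pmf (V x)" for y using *(2) that by (simp add: V_def T_def)
    qed
    have T0: "0 \<le> T w y" for w y unfolding T_def by (rule expct_nonneg) (rule f)
    have ET: "expct pYn (T w) = expct pYn (f i w)" for w
    proof -
      have "expct pYn (f i w) = expct (bind_pmf pYn (\<lambda>xs. prod_pmfs (map (noise z (map_pmf fst (P i))) xs))) (f i w)"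
        using z by (simp add: pYn_def bind_replicate_pmf_prod_pmfs bind_noise)
      also have "\<dots> = expct pYn (T w)" unfolding T_def by (rule expct_bind) (auto simp: pYn_def)
      finally show ?thesis by simp
    qed
    have "L - (expct W (\<lambda>w. expct pYn (f i w)) / c i - 1 + ln (c i)) =
      expct W (\<lambda>w. L - (expct pYn (f i w) / c i - 1 + ln (c i)))"
      using finW by (simp add: expct_diff expct_add)
    also have "\<dots> \<le> expct W (\<lambda>w. real n * infoY (P i) (\<sigma>0 w))"
    proof (rule expct_mono[OF finW])
      fix w assume w: "w \<in> set_pmf W"
      have finV: "finite (set_pmf (bind_pmf (Q w) V))" using finQ[OF w] by (auto simp: set_bind_pmf V_def)
      have "L \<le> expct (Q w) (\<lambda>x. expct (V x) (\<lambda>y. ln (T w y)))"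
        by (rule expct_const_ge[OF finQ[OF w]]) (use noise(1) setQ[OF w] in auto)
      also have "\<dots> = expct (bind_pmf (Q w) V) (\<lambda>y. ln (T w y))"
        by (rule expct_bind[symmetric]) (use finQ[OF w] in \<open>auto simp: V_def\<close>)
      also have "\<dots> \<le> kl (bind_pmf (Q w) V) pYn + expct pYn (T w) / c i - 1 + ln (c i)"
      proof (rule gibbs_variational[OF finV])
        show "finite (set_pmf pYn)" by (simp add: pYn_def)
        show "set_pmf (bind_pmf (Q w) V) \<subseteq> set_pmf pYn" using V_supp setQ[OF w] by (auto simp: set_bind_pmf)
        show "0 < T w y" if "y \<in> set_pmf (bind_pmf (Q w) V)" for y
          using that noise(2) setQ[OF w] by (auto simp: set_bind_pmf)
      qed (use T0 c(1)[OF i] in auto)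
      also have "kl (bind_pmf (Q w) V) pYn \<le> real n * infoY (P i) (\<sigma>0 w)"
        unfolding V_def pYn_def by (rule \<sigma>0(5)[OF w]) (use i in simp)
      finally show "L - (expct pYn (f i w) / c i - 1 + ln (c i)) \<le>
          real n * infoY (P i) (\<sigma>0 w)"
        by (simp add: ET)
    qed
    also have "\<dots> = real n * infoY (P i) \<sigma>" by (simp only: E)
    finally have main: "L - (expct W (\<lambda>w. expct pYn (f i w)) / c i - 1 + ln (c i))
        \<le> real n * infoY (P i) \<sigma>" .
    \<comment> \<open>Averaging over the messages undoes the conditioning on the message; the
      conditioning on \<open>B\<close> remains and costs the factor 1/b, for which the factor
      \<open>b\<close> in the hypothesis on \<open>c\<close> makes up.\<close>
    have "expct W (\<lambda>w. expct pYn (f i w)) = expct X (\<lambda>x. expct pYn (f i (\<phi> x)))"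
      by (simp add: W_def)
    also have "\<dots> \<le> (\<Sum>x\<in>set_pmf pXn. (indicator B x * pmf pXn x / b) * expct pYn (f i (\<phi> x)))"
    proof -
      have "expct X (\<lambda>x. expct pYn (f i (\<phi> x))) = (\<Sum>x\<in>set_pmf pXn. pmf X x * expct pYn (f i (\<phi> x)))"
        by (rule expct_sum[OF finXn]) (use setX B(1) in \<open>auto simp: pXn_def\<close>)
      also have "\<dots> \<le> (\<Sum>x\<in>set_pmf pXn. (indicator B x * pmf pXn x / b) * expct pYn (f i (\<phi> x)))"
        by (intro sum_mono mult_right_mono pmfX(2) expct_nonneg f)
      finally show ?thesis .
    qed
    also have "\<dots> = expct pXn (\<lambda>x. indicator B x * expct pYn (f i (\<phi> x))) / b"
      by (subst expct_sum[OF finXn order_refl]) (simp add: sum_divide_distrib mult_ac)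
    also have "\<dots> \<le> c i"
      using c(2)[OF i] B(2) by (simp add: pXn_def pYn_def pos_divide_le_eq)
    finally have "expct W (\<lambda>w. expct pYn (f i w)) / c i \<le> 1"
      using c(1)[OF i] by simp
    then show "- ln (c i) + real n * ln (1 - z) + ln (\<eta> / 2) - ln (1 / (z * \<gamma>)) * sqrt (2 * real n / \<eta>)
        \<le> real n * infoY (P i) \<sigma>"
      using main by (simp add: L_def)
  qed
qed

text \<open>The correction \<open>V\<close>, mixed in with weight \<open>l\<close>, has to solve l V
  + (1 - l) A = pX for the barycentre \<open>A\<close> of \<open>\<sigma>\<close>. The solution is
  non-negative because \<open>A\<close> exceeds \<open>pX\<close> by at most \<delta> at each letter
  and l \<gamma> dominates (1 - l) \<delta>. Its divergence from \<open>pX\<close> is at most ln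
  (1/\<gamma>), and its contribution to the Y-information is non-negative.\<close>

lemma fix_barycentre:
  fixes pX :: "'x::finite pmf" and \<sigma> :: "'x pmf pmf" and C :: "('y::finite \<times> 'x) pmf set"
  assumes fin: "finite (set_pmf \<sigma>)" and supp: "\<And>R. R \<in> set_pmf \<sigma> \<Longrightarrow> set_pmf R \<subseteq> set_pmf pX"
    and C: "\<And>p. p \<in> C \<Longrightarrow> map_pmf snd p = pX"
    and \<gamma>: "0 < \<gamma>" "\<And>a. a \<in> set_pmf pX \<Longrightarrow> \<gamma> \<le> pmf pX a"
    and l: "0 < l" "l < 1" "(1 - l) * \<delta> \<le> l * \<gamma>"
    and avg: "\<And>a. expct \<sigma> (\<lambda>R. pmf R a) \<le> pmf pX a + \<delta>"
  obtains \<sigma>' :: "'x pmf pmf" where "finite (set_pmf \<sigma>')" "bind_pmf \<sigma>' id = pX"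
    "infoX pX \<sigma>' \<le> infoX pX \<sigma> + l * ln (1 / \<gamma>)"
    "\<And>p. p \<in> C \<Longrightarrow> (1 - l) * infoY p \<sigma> \<le>
        infoY p \<sigma>'"
proof -
  define A where "A = bind_pmf \<sigma> id"
  have pmfA: "pmf A a = expct \<sigma> (\<lambda>R. pmf R a)" for a by (simp add: A_def pmf_bind)
  have A_out: "pmf A a = 0" if "a \<notin> set_pmf pX" for a
    using that supp by (auto simp: A_def pmf_eq_0_set_pmf set_bind_pmf)
  have A_le: "(1 - l) * pmf A a \<le> pmf pX a" for a
  proof (cases "a \<in> set_pmf pX")
    case True
    have "(1 - l) * pmf A a \<le> (1 - l) * (pmf pX a + \<delta>)"
      using avg l by (intro mult_left_mono) (auto simp: pmfA)
    also have "\<dots> \<le> (1 - l) * pmf pX a + l * \<gamma>" using l(3) by (simp add: distrib_left)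
    also have "\<dots> \<le> (1 - l) * pmf pX a + l * pmf pX a" using \<gamma>(2)[OF True] l by simp
    finally show ?thesis by (simp add: algebra_simps)
  qed (simp add: A_out)
  define v where "v = (\<lambda>a. (pmf pX a - (1 - l) * pmf A a) / l)"
  define V where "V = embed_pmf v"
  have v0: "0 \<le> v a" for a using A_le[of a] l by (simp add: v_def)
  have "(\<Sum>a\<in>UNIV. v a) = ((\<Sum>a\<in>UNIV. pmf pX a) - (1 - l) * (\<Sum>a\<in>UNIV. pmf A a)) / l"
    unfolding v_def sum_divide_distrib[symmetric] sum_subtractf sum_distrib_left[symmetric] ..
  also have "\<dots> = 1" using l by (simp add: sum_pmf_eq_1)
  finally have "(\<integral>\<^sup>+ a. ennreal (v a) \<partial>count_space UNIV) = 1"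
    by (simp add: nn_integral_count_space_finite v0 sum_ennreal)
  then have pmfV: "pmf V a = v a" for a unfolding V_def by (rule pmf_embed_pmf[OF v0])
  have V_supp: "set_pmf V \<subseteq> set_pmf pX"
    using A_out by (auto simp: set_pmf_iff pmfV v_def)
  define \<sigma>' where "\<sigma>' = bind_pmf (bernoulli_pmf l) (\<lambda>b. if b then return_pmf V else \<sigma>)"
  have e: "expct \<sigma>' g = l * g V + (1 - l) * expct \<sigma> g" for g
    using l fin by (simp add: \<sigma>'_def expct_bernoulli_mix)
  show ?thesis
  proof (rule that[of \<sigma>'])
    show "finite (set_pmf \<sigma>')" using fin by (simp add: \<sigma>'_def finite_bernoulli_mix)
    show "bind_pmf \<sigma>' id = pX"
    proof (rule pmf_eqI)
      fix a
      have "pmf (bind_pmf \<sigma>' id) a = l * pmf V a + (1 - l) * pmf A a"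
        using l by (simp add: \<sigma>'_def bernoulli_mix_same pmf_bernoulli_mix A_def bind_return_pmf)
      then show "pmf (bind_pmf \<sigma>' id) a = pmf pX a" using l by (simp add: pmfV v_def)
    qed
    have "kl V pX \<le> ln (1 / \<gamma>)"
    proof (rule kl_le_of_pmf_le)
      fix a assume "a \<in> set_pmf V"
      then have "\<gamma> \<le> pmf pX a" using V_supp \<gamma> by auto
      then have "1 \<le> 1 / \<gamma> * pmf pX a" using \<gamma> by (simp add: field_simps)
      then show "pmf V a \<le> 1 / \<gamma> * pmf pX a" using pmf_le_1[of V a] by linarith
    qed (use \<gamma> in auto)
    then have "l * kl V pX \<le> l * ln (1 / \<gamma>)" using l by (intro mult_left_mono) auto
    moreover have "0 \<le> infoX pX \<sigma>"
      by (rule expct_nonneg, rule kl_nonneg) (use supp in auto)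
    then have "0 \<le> l * infoX pX \<sigma>" using l by simp
    then have "(1 - l) * infoX pX \<sigma> \<le> infoX pX \<sigma>" by (simp add: left_diff_distrib)
    ultimately show "infoX pX \<sigma>' \<le> infoX pX \<sigma> + l * ln (1 / \<gamma>)"
      unfolding e by linarith
    fix p assume "p \<in> C"
    then have p: "map_pmf snd p = pX" by (rule C)
    have "set_pmf (bind_pmf V (chan p)) \<subseteq> set_pmf (map_pmf fst p)"
      using V_supp set_chan_subset[of _ p] unfolding p by (force simp: set_bind_pmf simp del: set_map_pmf)
    then have "0 \<le> kl (bind_pmf V (chan p)) (map_pmf fst p)" by (intro kl_nonneg) auto
    then show "(1 - l) * infoY p \<sigma> \<le>
        infoY p \<sigma>'"
      unfolding e using l by simp
  qed
qed

section \<open>Typical words and the asymptotic converse\<close>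

lemma sum_list_indicator: "sum_list (map (indicator {a}) xs) = real (count_list xs a)"
  by (induction xs) (auto simp: indicator_def)

lemma strong_typicality:
  fixes p :: "'a::finite pmf"
  assumes "0 < \<delta>"
  shows "(\<lambda>n. prb (replicate_pmf n p)
    {xs. \<not> (\<forall>a. \<bar>real (count_list xs a) - real n * pmf p a\<bar> < real n * \<delta>)}) \<longlonglongrightarrow> 0"
proof (rule tendsto_zero_mono)
  have "(\<lambda>n. \<Sum>a\<in>UNIV. prb (replicate_pmf n p)
    {xs. real n * \<delta> \<le> \<bar>sum_list (map (indicator {a}) xs) - real n * expct p (indicator {a})\<bar>}) \<longlonglongrightarrow> (\<Sum>a\<in>(UNIV :: 'a set). 0)"
    by (intro tendsto_sum iid_lln assms) auto
  then show "(\<lambda>n. \<Sum>a\<in>UNIV. prb (replicate_pmf n p)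
    {xs. real n * \<delta> \<le> \<bar>real (count_list xs a) - real n * pmf p a\<bar>}) \<longlonglongrightarrow> 0"
    by (simp add: sum_list_indicator measure_pmf_single)
  fix n
  have "{xs. \<not> (\<forall>a. \<bar>real (count_list xs a) - real n * pmf p a\<bar> < real n * \<delta>)} =
    (\<Union>a\<in>UNIV. {xs. real n * \<delta> \<le> \<bar>real (count_list xs a) - real n * pmf p a\<bar>})"
    by (auto simp: not_less)
  then show "prb (replicate_pmf n p) {xs. \<not> (\<forall>a. \<bar>real (count_list xs a) - real n * pmf p a\<bar> < real n * \<delta>)}
    \<le> (\<Sum>a\<in>UNIV. prb (replicate_pmf n p) {xs. real n * \<delta> \<le> \<bar>real (count_list xs a) - real n * pmf p a\<bar>})"
    by (simp only:) (rule measure_pmf.finite_measure_subadditive_finite, auto)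
qed simp

lemma expct_mono_bounded:
  assumes "\<And>x. f x \<le> g x" "\<And>x. 0 \<le> f x" "\<And>x. g x \<le> c"
  shows "expct q f \<le> expct q g"
proof (rule integral_mono)
  have "0 \<le> g x" "f x \<le> c" for x using assms order_trans by blast+
  then show "integrable (measure_pmf q) f" "integrable (measure_pmf q) g"
    using assms by (auto intro!: measure_pmf.integrable_const_bound[where B = c])
qed (use assms in auto)

lemma expct_unit:
  assumes "\<And>x. 0 \<le> f x" "\<And>x. f x \<le> 1"
  shows "0 \<le> expct q f" "expct q f \<le> 1"
proof -
  show "0 \<le> expct q f" by (rule expct_nonneg) (rule assms)
  show "expct q f \<le> 1" using expct_mono_bounded[of f "\<lambda>_. 1" 1 q] assms by simp
qed

lemma exp_minus_mult_leD: "exp (- t) * a \<le> b \<Longrightarrow> a \<le> exp t * (b :: real)"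
  by (simp add: exp_minus field_simps)

text \<open>\<open>T n\<close> is the acceptance probability, \<open>E\<close> the type II exponent,
  and \<open>\<tau>\<close> the weight with which the relevant reference component enters the
  mixture. The slack \<rho> permits taking the kernel from one sufficiently large \<open>n\<close>,
  so no limit of kernels is formed: the law found at this length has its barycentre repaired and its
  rate brought down to \<open>R\<close> by erasure.\<close>

lemma converse:
  fixes pX :: "'x::finite pmf" and P :: "nat \<Rightarrow> ('y::finite \<times> 'x) pmf" and \<phi> :: "nat \<Rightarrow> 'x list \<Rightarrow> nat"
    and T :: "nat \<Rightarrow> 'y list \<times> nat \<Rightarrow> real"
  assumes F: "finite F" and marg: "\<And>i. i \<in> F \<Longrightarrow> map_pmf snd (P i) = pX"
    and rateY: "\<And>i. i \<in> F \<Longrightarrow> divergence_rate (map_pmf fst (P i)) (QY i) (ereal (dY i))"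
    and rateX: "divergence_rate pX QX (ereal dX)"
    and T: "\<And>n z. 0 \<le> T n z" "\<And>n z. T n z \<le> 1"
    and R: "0 < R" and \<tau>: "0 < \<tau>" and \<eta>: "0 < \<eta>" "\<eta> \<le> 1" and \<rho>: "0 < \<rho>"
    and err: "\<forall>\<^sub>F n in sequentially. (\<Sum>i\<in>F. 1 - expct (replicate_pmf n pX)
        (\<lambda>x. expct (word_chan (P i) x) (\<lambda>y. T n (y, \<phi> n x)))) \<le> 1 - \<eta>"
    and \<beta>: "\<forall>\<^sub>F n in sequentially. \<forall>i\<in>F. \<tau> * expct (QX n) (\<lambda>x. expct (QY i n) (\<lambda>y. T n (y, \<phi> n x))) \<le> exp (- (real n * E))"
    and rate: "\<And>\<kappa>. 0 < \<kappa> \<Longrightarrow> \<forall>\<^sub>F n in sequentially. real (card (\<phi> n ` {xs. length xs = n})) \<le> exp (real n * (R + \<kappa>))"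
  obtains K where "K \<in> kernels pX R"
    "\<And>i. i \<in> F \<Longrightarrow> E - dY i - dX - \<rho> \<le> mutual_info (law_YU (P i) K)"
proof -
  \<comment> \<open>Spent four times, \<rho>/2 in total: once in each of the two changes of measure,
    once for the noise, and once for the terms of order sqrt n.\<close>
  define \<kappa> where "\<kappa> = \<rho> / 8"
  have \<kappa>: "0 < \<kappa>" using \<rho> by (simp add: \<kappa>_def)
  obtain S where S: "0 \<le> S" "\<And>i. i \<in> F \<Longrightarrow> \<bar>E - dY i - dX - \<rho> / 2\<bar> \<le> S"
    using finite_bounded_abs[OF F, of "\<lambda>i. E - dY i - dX - \<rho> / 2"] by blast
  \<comment> \<open>The tolerated excess over the rate \<open>R\<close>. Erasing it away takes the
    weight \<rho>'/(R + \<rho>'), which is at most \<rho>/(4 (S + 1)) and so costs at most \<rho>/4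
    of Y-information.\<close>
  define \<rho>' where "\<rho>' = R * \<rho> / (4 * (S + 1))"
  have \<rho>': "0 < \<rho>'" using R \<rho> S by (simp add: \<rho>'_def)
  obtain \<gamma>X where \<gamma>X: "0 < \<gamma>X" "\<gamma>X \<le> 1" "\<And>a. a \<in> set_pmf pX \<Longrightarrow> \<gamma>X \<le> pmf pX a"
    by (rule min_mass_exists[of pX]) blast
  have ln\<gamma>: "0 \<le> ln (1 / \<gamma>X)" using \<gamma>X by simp
  \<comment> \<open>The weight of the barycentre correction. The first bound keeps it away from 1,
    the second limits the loss of Y-information to \<rho>/4, the third limits the increase of the
    rate to \<rho>'/2.\<close>
  define l where "l = min (1 / 2) (min (\<rho> / (4 * (S + 1))) (\<rho>' / (2 * (ln (1 / \<gamma>X) + 1))))"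
  have l: "0 < l" "l \<le> 1 / 2" "l \<le> \<rho> / (4 * (S + 1))" "l \<le> \<rho>' / (2 * (ln (1 / \<gamma>X) + 1))"
  proof -
    have "0 < \<rho> / (4 * (S + 1))" "0 < \<rho>' / (2 * (ln (1 / \<gamma>X) + 1))"
      using \<rho> S \<rho>' ln\<gamma> by (auto intro!: divide_pos_pos)
    then show "0 < l" unfolding l_def by (simp only: min_less_iff_conj) simp
  qed (auto simp only: l_def intro: min.cobounded1 min.cobounded2 min.coboundedI2)
  have l_ln: "l * ln (1 / \<gamma>X) \<le> \<rho>' / 2"
  proof -
    have "l * ln (1 / \<gamma>X) \<le> l * (ln (1 / \<gamma>X) + 1)" using l by simp
    also have "\<dots> \<le> \<rho>' / (2 * (ln (1 / \<gamma>X) + 1)) * (ln (1 / \<gamma>X) + 1)"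
      using l(4) ln\<gamma> by (intro mult_right_mono) auto
    also have "\<dots> = \<rho>' / 2" using ln\<gamma> by (simp add: field_simps)
    finally show ?thesis .
  qed
  define \<delta> where "\<delta> = l * \<gamma>X"
  have \<delta>: "0 < \<delta>" "(1 - l) * \<delta> \<le> l * \<gamma>X"
    using l \<gamma>X by (auto simp: \<delta>_def mult_left_le_one_le)
  define z where "z = 1 - exp (- \<kappa>)"
  have z: "0 < z" "z < 1" "ln (1 - z) = - \<kappa>" using \<kappa> by (auto simp: z_def)
  have "\<exists>\<gamma>>0. \<gamma> \<le> 1 \<and> (\<forall>i\<in>F. \<forall>y\<in>set_pmf (map_pmf fst (P i)). \<gamma> \<le> pmf (map_pmf fst (P i)) y)"
    using F
  proof (induction F rule: finite_induct)
    case empty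
    show ?case by (rule exI[of _ 1]) simp
  next
    case (insert i F)
    then obtain g1 where g1: "0 < g1" "g1 \<le> 1" "\<forall>i\<in>F. \<forall>y\<in>set_pmf (map_pmf fst (P i)). g1 \<le> pmf (map_pmf fst (P i)) y"
      by blast
    obtain g2 where g2: "0 < g2" "g2 \<le> 1" "\<And>y. y \<in> set_pmf (map_pmf fst (P i)) \<Longrightarrow> g2 \<le> pmf (map_pmf fst (P i)) y"
      by (rule min_mass_exists[of "map_pmf fst (P i)"]) blast
    show ?case
      using g1 g2 by (intro exI[of _ "min g1 g2"]) (auto simp: min_le_iff_disj simp del: set_map_pmf)
  qed
  then obtain \<gamma> where \<gamma>: "0 < \<gamma>" "\<gamma> \<le> 1"
    "\<And>i y. i \<in> F \<Longrightarrow> y \<in> set_pmf (map_pmf fst (P i)) \<Longrightarrow> \<gamma> \<le> pmf (map_pmf fst (P i)) y"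
    by blast
  define GY where "GY = (\<lambda>n i. {y. exp (- (real n * (dY i + \<kappa>))) * pmf (replicate_pmf n (map_pmf fst (P i))) y \<le> pmf (QY i n) y})"
  define GX where "GX = (\<lambda>n. {x. exp (- (real n * (dX + \<kappa>))) * pmf (replicate_pmf n pX) x \<le> pmf (QX n) x})"
  define Typ where "Typ = (\<lambda>n. {x. \<forall>a. \<bar>real (count_list x a) - real n * pmf pX a\<bar> < real n * \<delta>})"
  \<comment> \<open>What remains of the margin \<eta>: the jointly accepted words have probability
    at least \<eta>/2, of which untypical words and words with a bad X-likelihood take at most
    \<eta>/8 each. The same number bounds the acceptance probability of each component on the
    remaining words.\<close>
  define b where "b = \<eta> / 4"
  have b: "0 < b" using \<eta> by (simp add: b_def)
  define C1 where "C1 = ln (\<tau> * b) + ln (b / 2)"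
  define C2 where "C2 = ln (1 / (z * \<gamma>)) * sqrt (2 / b)"
  have e4: "\<forall>\<^sub>F n in sequentially. \<forall>i\<in>F. prb (replicate_pmf n (map_pmf fst (P i))) (- GY n i) < \<eta> / (4 * (real (card F) + 1))"
  proof (rule eventually_ball_finite[OF F], rule ballI)
    fix i assume i: "i \<in> F"
    have "(\<lambda>n. prb (replicate_pmf n (map_pmf fst (P i))) (- GY n i)) \<longlonglongrightarrow> 0"
      using rateY[OF i, unfolded divergence_rate_def] \<kappa> by (simp add: GY_def Compl_eq)
    then show "\<forall>\<^sub>F n in sequentially. prb (replicate_pmf n (map_pmf fst (P i))) (- GY n i) < \<eta> / (4 * (real (card F) + 1))"
      using \<eta> by (intro order_tendstoD(2)) auto
  qed
  have e5: "\<forall>\<^sub>F n in sequentially. prb (replicate_pmf n pX) (- GX n) < \<eta> / 8"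
  proof -
    have "(\<lambda>n. prb (replicate_pmf n pX) (- GX n)) \<longlonglongrightarrow> 0"
      using rateX[unfolded divergence_rate_def] \<kappa> by (simp add: GX_def Compl_eq)
    then show ?thesis using \<eta> by (intro order_tendstoD(2)) auto
  qed
  have e6: "\<forall>\<^sub>F n in sequentially. prb (replicate_pmf n pX) (- Typ n) < \<eta> / 8"
  proof -
    have "(\<lambda>n. prb (replicate_pmf n pX) (- Typ n)) \<longlonglongrightarrow> 0"
      using strong_typicality[OF \<delta>(1), of pX] by (simp add: Typ_def Compl_eq)
    then show ?thesis using \<eta> by (intro order_tendstoD(2)) auto
  qed
  have e7: "\<forall>\<^sub>F n in sequentially. - ln b / real n < \<rho>' / 4"
  proof -
    have "(\<lambda>n. - ln b / real n) \<longlonglongrightarrow> 0" by real_asymp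
    then show ?thesis using \<rho>' by (intro order_tendstoD(2)) auto
  qed
  have e8: "\<forall>\<^sub>F n in sequentially. - \<kappa> < (C1 - C2 * sqrt (real n)) / real n"
  proof -
    have "(\<lambda>n. (C1 - C2 * sqrt (real n)) / real n) \<longlonglongrightarrow> 0" by real_asymp
    then show ?thesis using \<kappa> by (intro order_tendstoD(1)) auto
  qed
  have e3: "\<forall>\<^sub>F n in sequentially. real (card (\<phi> n ` {xs. length xs = n})) \<le> exp (real n * (R + \<rho>' / 4))"
    using rate[of "\<rho>' / 4"] \<rho>' by simp
  have "\<forall>\<^sub>F n in sequentially. \<exists>K. K \<in> kernels pX R \<and> (\<forall>i\<in>F. E - dY i - dX - \<rho> \<le> mutual_info (law_YU (P i) K))"
    using err \<beta> e3 e4 e5 e6 e7 e8 eventually_gt_at_top[of 0]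
  proof eventually_elim
    case (elim n)
    note err = elim(1) and \<beta> = elim(2) and e3 = elim(3) and e4 = elim(4) and e5 = elim(5) and e6 = elim(6)
      and e7 = elim(7) and e8 = elim(8) and n = elim(9)
    define pXn where "pXn = replicate_pmf n pX"
    define V where "V = (\<lambda>i x. word_chan (P i) x)"
    \<comment> \<open>Acceptance is cut down to the output words on which the change of measure is
      available; \<open>e4\<close> bounds what is lost.\<close>
    define f where "f = (\<lambda>i w y. indicator (GY n i) y * T n (y, w))"
    have f: "0 \<le> f i w y" "f i w y \<le> 1" for i w y using T by (auto simp: f_def indicator_def)
    define acc where "acc = (\<lambda>i x. expct (V i x) (f i (\<phi> n x)))"
    have finXn: "finite (set_pmf pXn)" by (simp add: pXn_def)
    have acc1: "acc i x \<le> 1" for i x unfolding acc_def by (rule expct_unit) (use f in auto)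
    have V_chan: "bind_pmf pXn (V i) = replicate_pmf n (map_pmf fst (P i))" if "i \<in> F" for i
      unfolding pXn_def V_def bind_replicate_pmf_prod_pmfs
      using bind_chan[of "P i"] marg[OF that] by simp
    have mean_acc: "expct pXn (\<lambda>x. 1 - acc i x) \<le> (1 - expct pXn (\<lambda>x. expct (V i x) (\<lambda>y. T n (y, \<phi> n x)))) + \<eta> / (4 * (real (card F) + 1))"
      if i: "i \<in> F" for i
    proof -
      have "expct pXn (\<lambda>x. 1 - acc i x) \<le> expct pXn (\<lambda>x. 1 - expct (V i x) (\<lambda>y. T n (y, \<phi> n x)) + prb (V i x) (- GY n i))"
      proof (rule expct_mono[OF finXn])
        fix x
        have "expct (V i x) (\<lambda>y. T n (y, \<phi> n x)) \<le> expct (V i x) (\<lambda>y. f i (\<phi> n x) y + indicator (- GY n i) y)"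
          using T by (intro expct_mono) (auto simp: f_def indicator_def V_def)
        also have "\<dots> = acc i x + prb (V i x) (- GY n i)"
          by (subst expct_add) (auto simp: acc_def V_def)
        finally show "1 - acc i x \<le> 1 - expct (V i x) (\<lambda>y. T n (y, \<phi> n x)) + prb (V i x) (- GY n i)" by simp
      qed
      also have "\<dots> = 1 - expct pXn (\<lambda>x. expct (V i x) (\<lambda>y. T n (y, \<phi> n x))) + expct pXn (\<lambda>x. prb (V i x) (- GY n i))"
        using finXn by (simp add: expct_add expct_diff)
      also have "expct pXn (\<lambda>x. prb (V i x) (- GY n i)) = prb (bind_pmf pXn (V i)) (- GY n i)"
        by (rule prb_bind[symmetric]) (use finXn in \<open>auto simp: V_def\<close>)
      also have "\<dots> \<le> \<eta> / (4 * (real (card F) + 1))" using V_chan[OF i] e4 i by (simp add: less_imp_le)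
      finally show ?thesis by simp
    qed
    \<comment> \<open>The total rejection probability given \<open>x\<close>. Where it is below 1 -
      \<eta>/4, every single component accepts with probability above \<eta>/4; so one set of words
      serves all components.\<close>
    define g where "g = (\<lambda>x. \<Sum>i\<in>F. 1 - acc i x)"
    have g0: "0 \<le> g x" for x using acc1 by (auto simp: g_def intro: sum_nonneg)
    have Eg: "expct pXn g \<le> 1 - 3 * \<eta> / 4"
    proof -
      have "expct pXn g = (\<Sum>i\<in>F. expct pXn (\<lambda>x. 1 - acc i x))" unfolding g_def by (rule expct_setsum[OF finXn])
      also have "\<dots> \<le> (\<Sum>i\<in>F. (1 - expct pXn (\<lambda>x. expct (V i x) (\<lambda>y. T n (y, \<phi> n x)))) + \<eta> / (4 * (real (card F) + 1)))"
        by (rule sum_mono) (rule mean_acc)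
      also have "\<dots> = (\<Sum>i\<in>F. 1 - expct pXn (\<lambda>x. expct (V i x) (\<lambda>y. T n (y, \<phi> n x)))) + real (card F) * (\<eta> / (4 * (real (card F) + 1)))"
        by (simp add: sum.distrib)
      also have "real (card F) * (\<eta> / (4 * (real (card F) + 1))) \<le> \<eta> / 4"
        using \<eta> by (simp add: field_simps)
      also have "(\<Sum>i\<in>F. 1 - expct pXn (\<lambda>x. expct (V i x) (\<lambda>y. T n (y, \<phi> n x)))) \<le> 1 - \<eta>"
        using err by (simp add: pXn_def V_def)
      finally show ?thesis by simp
    qed
    define B0 where "B0 = {x. 1 - \<eta> / 4 \<le> g x}"
    have PB0: "prb pXn B0 \<le> 1 - \<eta> / 2"
    proof -
      have "prb pXn B0 \<le> expct pXn g / (1 - \<eta> / 4)"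
        unfolding B0_def using \<eta> g0 by (intro markov_ineq finXn) auto
      also have "\<dots> \<le> (1 - 3 * \<eta> / 4) / (1 - \<eta> / 4)" using Eg \<eta> by (intro divide_right_mono) auto
      also have "\<dots> \<le> 1 - \<eta> / 2"
      proof -
        have "1 - 3 * \<eta> / 4 \<le> (1 - \<eta> / 2) * (1 - \<eta> / 4)" by (simp add: algebra_simps)
        then show ?thesis using \<eta> by (simp add: pos_divide_le_eq)
      qed
      finally show ?thesis .
    qed
    define B where "B = set_pmf pXn \<inter> (- B0 \<inter> GX n \<inter> Typ n)"
    have PB: "b \<le> prb pXn B"
    proof -
      have "prb pXn (- (- B0 \<inter> GX n \<inter> Typ n)) \<le> prb pXn B0 + prb pXn (- GX n) + prb pXn (- Typ n)"
        using prb_Un_le[of pXn "B0 \<union> - GX n" "- Typ n"] prb_Un_le[of pXn B0 "- GX n"] by simp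
      then have "1 - prb pXn (- B0 \<inter> GX n \<inter> Typ n) \<le> (1 - \<eta> / 2) + \<eta> / 8 + \<eta> / 8"
        using PB0 e5 e6 by (simp only: prb_compl pXn_def)
      moreover have "prb pXn (- B0 \<inter> GX n \<inter> Typ n) \<le> prb pXn B"
        unfolding B_def by (rule prb_mono_supp) auto
      ultimately show ?thesis by (simp add: b_def)
    qed
    have accB: "b \<le> acc i x" if "i \<in> F" "x \<in> B" for i x
    proof -
      have "1 - acc i x \<le> g x" unfolding g_def using F that acc1 by (intro member_le_sum) auto
      then show ?thesis using that by (auto simp: B_def B0_def b_def)
    qed
    \<comment> \<open>The factors are the two changes of measure with slack \<kappa> each and the
      type II bound, normalized by the weight \<tau> and by the probability bound
      \<open>b\<close>.\<close>
    define c where "c = (\<lambda>i. exp (real n * (dX + \<kappa>)) * exp (real n * (dY i + \<kappa>)) * exp (- (real n * E)) / (\<tau> * b))"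
    have c: "0 < c i" for i using \<tau> b by (simp add: c_def)
    have cB: "expct pXn (\<lambda>x. indicator B x * expct (replicate_pmf n (map_pmf fst (P i))) (f i (\<phi> n x))) \<le> c i * b"
      if i: "i \<in> F" for i
    proof -
      let ?pYn = "replicate_pmf n (map_pmf fst (P i))"
      have "expct pXn (\<lambda>x. indicator B x * expct ?pYn (f i (\<phi> n x))) \<le>
        exp (real n * (dX + \<kappa>)) * expct (QX n) (\<lambda>x. expct ?pYn (f i (\<phi> n x)))"
      proof (rule change_of_measure[OF finXn])
        fix x assume "x \<in> B"
        then have "exp (- (real n * (dX + \<kappa>))) * pmf pXn x \<le> pmf (QX n) x" by (auto simp: B_def GX_def pXn_def)
        then show "pmf pXn x \<le> exp (real n * (dX + \<kappa>)) * pmf (QX n) x" by (rule exp_minus_mult_leD)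
      qed (use expct_unit[of "f i _"] f in auto)
      also have "expct (QX n) (\<lambda>x. expct ?pYn (f i (\<phi> n x))) \<le>
        expct (QX n) (\<lambda>x. exp (real n * (dY i + \<kappa>)) * expct (QY i n) (\<lambda>y. T n (y, \<phi> n x)))"
      proof (rule expct_mono_bounded[where c = "exp (real n * (dY i + \<kappa>)) * 1"])
        fix x
        show "0 \<le> expct ?pYn (f i (\<phi> n x))" using expct_unit[of "f i (\<phi> n x)"] f by simp
        show "exp (real n * (dY i + \<kappa>)) * expct (QY i n) (\<lambda>y. T n (y, \<phi> n x)) \<le> exp (real n * (dY i + \<kappa>)) * 1"
          using expct_unit[of "\<lambda>y. T n (y, \<phi> n x)"] T by (intro mult_left_mono) auto
        show "expct ?pYn (f i (\<phi> n x)) \<le> exp (real n * (dY i + \<kappa>)) * expct (QY i n) (\<lambda>y. T n (y, \<phi> n x))"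
          unfolding f_def
        proof (rule change_of_measure)
          fix y assume "y \<in> GY n i"
          then have "exp (- (real n * (dY i + \<kappa>))) * pmf ?pYn y \<le> pmf (QY i n) y" by (auto simp: GY_def)
          then show "pmf ?pYn y \<le> exp (real n * (dY i + \<kappa>)) * pmf (QY i n) y" by (rule exp_minus_mult_leD)
        qed (use T in auto)
      qed
      also have "expct (QX n) (\<lambda>x. exp (real n * (dY i + \<kappa>)) * expct (QY i n) (\<lambda>y. T n (y, \<phi> n x))) =
        exp (real n * (dY i + \<kappa>)) * expct (QX n) (\<lambda>x. expct (QY i n) (\<lambda>y. T n (y, \<phi> n x)))" by simp
      also have "expct (QX n) (\<lambda>x. expct (QY i n) (\<lambda>y. T n (y, \<phi> n x))) \<le> exp (- (real n * E)) / \<tau>"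
        using \<beta> i \<tau> by (simp add: pos_le_divide_eq mult.commute)
      finally show ?thesis using b by (simp add: c_def mult.assoc)
    qed
    have "\<exists>\<sigma> :: 'x pmf pmf. finite (set_pmf \<sigma>) \<and> (\<forall>R\<in>set_pmf \<sigma>. set_pmf R \<subseteq> set_pmf pX) \<and>
      (\<forall>a. real n * expct \<sigma> (\<lambda>R. pmf R a) \<le> real n * (pmf pX a + \<delta>)) \<and>
      real n * infoX pX \<sigma> \<le> ln (exp (real n * (R + \<rho>' / 4))) - ln b \<and>
      (\<forall>i\<in>F. - ln (c i) + real n * ln (1 - z) + ln (b / 2) - ln (1 / (z * \<gamma>)) * sqrt (2 * real n / b)
        \<le> real n * infoY (P i) \<sigma>)"
    proof (rule converse_n[where f = f and \<phi> = "\<phi> n" and B = B])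
      show "real (count_list x a) \<le> real n * (pmf pX a + \<delta>)" if "x \<in> B" for x a
      proof -
        have "\<bar>real (count_list x a) - real n * pmf pX a\<bar> < real n * \<delta>" using that by (auto simp: B_def Typ_def)
        then show ?thesis by (simp add: distrib_left)
      qed
      show "b \<le> expct (word_chan (P i) x) (f i (\<phi> n x))" if "i \<in> F" "x \<in> B" for i x
        using accB[OF that] by (simp add: acc_def V_def)
      show "expct (replicate_pmf n pX) (\<lambda>x. indicator B x * expct (replicate_pmf n (map_pmf fst (P i))) (f i (\<phi> n x))) \<le> c i * b"
        if "i \<in> F" for i using cB[OF that] by (simp add: pXn_def)
    qed (use marg e3 f B_def PB b z \<gamma> c in \<open>auto simp: pXn_def\<close>)
    then obtain \<sigma> :: "'x pmf pmf" where \<sigma>: "finite (set_pmf \<sigma>)" "\<And>R. R \<in> set_pmf \<sigma> \<Longrightarrow> set_pmf R \<subseteq> set_pmf pX"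
      "\<And>a. real n * expct \<sigma> (\<lambda>R. pmf R a) \<le> real n * (pmf pX a + \<delta>)"
      "real n * infoX pX \<sigma> \<le> real n * (R + \<rho>' / 4) - ln b"
      "\<And>i. i \<in> F \<Longrightarrow> - ln (c i) + real n * ln (1 - z) + ln (b / 2) - ln (1 / (z * \<gamma>)) * sqrt (2 * real n / b)
        \<le> real n * infoY (P i) \<sigma>"
      by auto
    have avg: "expct \<sigma> (\<lambda>R. pmf R a) \<le> pmf pX a + \<delta>" for a
      using \<sigma>(3)[of a] n by (simp only: mult_le_cancel_left_pos of_nat_0_less_iff)
    have IX: "infoX pX \<sigma> \<le> R + \<rho>' / 2"
    proof -
      have "- ln b \<le> real n * (\<rho>' / 4)" using e7 n by (simp add: field_simps)
      then have "real n * infoX pX \<sigma> \<le> real n * (R + \<rho>' / 2)" using \<sigma>(4) by (simp add: algebra_simps)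
      then show ?thesis using n by (simp only: mult_le_cancel_left_pos of_nat_0_less_iff)
    qed
    have IY: "E - dY i - dX - \<rho> / 2 \<le> infoY (P i) \<sigma>" if i: "i \<in> F" for i
    proof -
      have lnc: "- ln (c i) = ln (\<tau> * b) + real n * E - real n * (dX + \<kappa>) - real n * (dY i + \<kappa>)"
        unfolding c_def exp_add[symmetric] using \<tau> b by (simp add: ln_div ln_mult_pos)
      have sq: "ln (1 / (z * \<gamma>)) * sqrt (2 * real n / b) = C2 * sqrt (real n)"
        unfolding C2_def by (simp add: real_sqrt_mult real_sqrt_divide)
      have "- \<kappa> * real n \<le> C1 - C2 * sqrt (real n)" using e8 n by (simp add: field_simps)
      then have "real n * (E - dY i - dX - \<rho> / 2) \<le> - ln (c i) + real n * ln (1 - z) + ln (b / 2) - ln (1 / (z * \<gamma>)) * sqrt (2 * real n / b)"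
        unfolding lnc sq z(3) by (simp add: \<kappa>_def C1_def algebra_simps)
      also note \<sigma>(5)[OF i]
      finally show ?thesis using n by (simp only: mult_le_cancel_left_pos of_nat_0_less_iff)
    qed
    have IY0: "0 \<le> infoY (P i) \<sigma>" if i: "i \<in> F" for i
    proof (rule expct_nonneg)
      fix Ra assume "Ra \<in> set_pmf \<sigma>"
      then have "set_pmf (bind_pmf Ra (chan (P i))) \<subseteq> set_pmf (map_pmf fst (P i))"
        using \<sigma>(2) set_chan_subset[of _ "P i"] unfolding marg[OF i] by (force simp: set_bind_pmf simp del: set_map_pmf)
      then show "0 \<le> kl (bind_pmf Ra (chan (P i))) (map_pmf fst (P i))" by (intro kl_nonneg) auto
    qed
    obtain \<sigma>1 :: "'x pmf pmf" where \<sigma>1: "finite (set_pmf \<sigma>1)" "bind_pmf \<sigma>1 id = pX"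
      "infoX pX \<sigma>1 \<le> infoX pX \<sigma> + l * ln (1 / \<gamma>X)"
      "\<And>p. p \<in> P ` F \<Longrightarrow> (1 - l) * infoY p \<sigma> \<le>
          infoY p \<sigma>1"
    proof -
      have C: "map_pmf snd p = pX" if "p \<in> P ` F" for p using that marg by auto
      have l1: "l < 1" using l by simp
      from fix_barycentre[OF \<sigma>(1,2) C \<gamma>X(1,3) l(1) l1 \<delta>(2) avg] that show ?thesis by blast
    qed
    have IX1: "infoX pX \<sigma>1 \<le> R + \<rho>'" using \<sigma>1(3) IX l_ln by linarith
    define l' where "l' = \<rho>' / (R + \<rho>')"
    have l': "0 \<le> l'" "l' \<le> 1" "(1 - l') * (R + \<rho>') = R" "l' \<le> \<rho> / (4 * (S + 1))"
    proof -
      show "0 \<le> l'" "l' \<le> 1" "(1 - l') * (R + \<rho>') = R" using R \<rho>' by (auto simp: l'_def field_simps)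
      have "l' \<le> \<rho>' / R" unfolding l'_def using R \<rho>' by (intro divide_left_mono) auto
      also have "\<dots> = \<rho> / (4 * (S + 1))" using R by (simp add: \<rho>'_def)
      finally show "l' \<le> \<rho> / (4 * (S + 1))" .
    qed
    obtain \<sigma>2 :: "'x pmf pmf" where \<sigma>2: "finite (set_pmf \<sigma>2)" "bind_pmf \<sigma>2 id = pX"
      "infoX pX \<sigma>2 = (1 - l') * infoX pX \<sigma>1"
      "\<And>p :: ('y \<times> 'x) pmf. map_pmf snd p = pX \<Longrightarrow>
        infoY p \<sigma>2 =
        (1 - l') * infoY p \<sigma>1"
      by (rule erase_posterior[OF l'(1,2) \<sigma>1(1,2)]) blast
    obtain K :: "'x \<Rightarrow> nat pmf" where K: "finite (\<Union>x. set_pmf (K x))"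
      "mutual_info (law_XU pX K) = infoX pX \<sigma>2"
      "\<And>p :: ('y \<times> 'x) pmf. map_pmf snd p = pX \<Longrightarrow>
        mutual_info (law_YU p K) = infoY p \<sigma>2"
      by (rule realize_posterior_law[OF \<sigma>2(1,2)]) blast
    show ?case
    proof (intro exI[of _ K] conjI ballI)
      have "mutual_info (law_XU pX K) \<le> (1 - l') * (R + \<rho>')"
        unfolding K(2) \<sigma>2(3) using IX1 l' by (intro mult_left_mono) auto
      then show "K \<in> kernels pX R" using K(1) l'(3) by (simp add: kernels_def)
      fix i assume i: "i \<in> F"
      define t where "t = E - dY i - dX - \<rho> / 2"
      define J where "J = infoY (P i) \<sigma>"
      have "t - (l + l') * S \<le> (1 - l') * ((1 - l) * J)"
      \<comment> \<open>A negative target is met at once because the information is non-negative; a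
        non-negative one shrinks under the factors 1 - l and 1 - l' by at most (l + l') S.\<close>
      proof (cases "0 \<le> t")
        case True
        have "t \<le> S" using S(2)[OF i] by (simp add: t_def)
        have "t - (l + l') * S \<le> t - (l + l') * t" using \<open>t \<le> S\<close> l l' by (simp add: mult_left_mono)
        also have "\<dots> \<le> (1 - l') * (1 - l) * t" using l l' True by (simp add: algebra_simps)
        also have "\<dots> \<le> (1 - l') * (1 - l) * J" using l l' IY[OF i] by (intro mult_left_mono) (auto simp: t_def J_def)
        finally show ?thesis by (simp add: mult.assoc)
      next
        case False
        moreover have "0 \<le> (l + l') * S" using l l' S by simp
        moreover have "0 \<le> (1 - l') * ((1 - l) * J)" using l l' IY0[OF i] by (simp add: J_def)
        ultimately show ?thesis by linarith
      qed
      also have "\<dots> \<le> (1 - l') * infoY (P i) \<sigma>1"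
        unfolding J_def using l' \<sigma>1(4) i by (intro mult_left_mono) auto
      also have "\<dots> = mutual_info (law_YU (P i) K)" using K(3) \<sigma>2(4) marg[OF i] by simp
      finally have "t - (l + l') * S \<le> mutual_info (law_YU (P i) K)" .
      moreover have "(l + l') * S \<le> \<rho> / 2"
      proof -
        have "(l + l') * S \<le> (\<rho> / (4 * (S + 1)) + \<rho> / (4 * (S + 1))) * (S + 1)"
          using l l' S \<rho> by (intro mult_mono add_mono) auto
        also have "\<dots> = \<rho> / 2"
        proof -
          have h: "(\<rho> / (4 * u) + \<rho> / (4 * u)) * u = \<rho> / 2" if "u \<noteq> 0" for u
            using that by (simp add: field_simps)
          show ?thesis using S by (intro h) simp
        qed
        finally show ?thesis .
      qed
      ultimately show "E - dY i - dX - \<rho> \<le> mutual_info (law_YU (P i) K)" by (simp add: t_def)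
    qed
  qed
  then obtain n where "\<exists>K. K \<in> kernels pX R \<and> (\<forall>i\<in>F. E - dY i - dX - \<rho> \<le> mutual_info (law_YU (P i) K))"
    by (auto dest: eventually_happens)
  then show ?thesis using that by blast
qed

section \<open>Achievability\<close>

lemma ex_le_expct:
  assumes "finite (set_pmf p)"
  shows "\<exists>b\<in>set_pmf p. f b \<le> expct p f"
proof -
  have ne: "finite (f ` set_pmf p)" "f ` set_pmf p \<noteq> {}" using assms by (auto simp: set_pmf_not_empty)
  have "Min (f ` set_pmf p) \<le> expct p f" using assms ne by (intro expct_const_ge) auto
  moreover obtain b where b: "b \<in> set_pmf p" "f b = Min (f ` set_pmf p)" using Min_in[OF ne] by auto
  ultimately have "f b \<le> expct p f" by (simp only: b(2))
  then show ?thesis using b(1) by blast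
qed

text \<open>For a fixed uncovered set, a random \<open>b\<close> covers a share of at least \<gamma>
  on average, hence some \<open>b\<close> does. The codebook is found one word at a time, each
  choice shrinking the uncovered mass by the factor 1 - \<gamma>.\<close>

lemma greedy_covering:
  fixes pa :: "'a pmf" and pb :: "'b pmf"
  assumes fin: "finite (set_pmf pa)" "finite (set_pmf pb)" and \<gamma>: "\<gamma> \<le> 1"
    and A0: "\<And>a. a \<in> set_pmf pa \<Longrightarrow> a \<in> A0 \<Longrightarrow> \<gamma> \<le> prb pb {b. (a, b) \<in> G}"
  shows "\<exists>cs. length cs = M \<and> prb pa {a \<in> A0. \<forall>b\<in>set cs. (a, b) \<notin> G} \<le> (1 - \<gamma>) ^ M"
proof (induction M)
  case (Suc M)
  then obtain cs where cs: "length cs = M" "prb pa {a \<in> A0. \<forall>b\<in>set cs. (a, b) \<notin> G} \<le> (1 - \<gamma>) ^ M" by blast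
  define U where "U = {a \<in> A0. \<forall>b\<in>set cs. (a, b) \<notin> G}"
  have "expct pb (\<lambda>b. prb pa {a \<in> U. (a, b) \<notin> G}) = expct pb (\<lambda>b. expct pa (\<lambda>a. indicator U a * indicator {b. (a, b) \<notin> G} b))"
  proof (intro expct_cong refl)
    fix b
    have "prb pa {a \<in> U. (a, b) \<notin> G} = expct pa (indicator {a \<in> U. (a, b) \<notin> G})" by simp
    also have "\<dots> = expct pa (\<lambda>a. indicator U a * indicator {b. (a, b) \<notin> G} b)"
      by (intro expct_cong refl) (auto simp: indicator_def)
    finally show "prb pa {a \<in> U. (a, b) \<notin> G} = expct pa (\<lambda>a. indicator U a * indicator {b. (a, b) \<notin> G} b)" .
  qed
  also have "\<dots> = expct pa (\<lambda>a. expct pb (\<lambda>b. indicator U a * indicator {b. (a, b) \<notin> G} b))"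
    by (rule expct_swap) (use fin in auto)
  also have "\<dots> = expct pa (\<lambda>a. indicator U a * prb pb {b. (a, b) \<notin> G})" by simp
  also have "\<dots> \<le> expct pa (\<lambda>a. (1 - \<gamma>) * indicator U a)"
  proof (rule expct_mono[OF fin(1)])
    fix a assume a: "a \<in> set_pmf pa"
    show "indicator U a * prb pb {b. (a, b) \<notin> G} \<le> (1 - \<gamma>) * indicator U a"
    proof (cases "a \<in> U")
      case True
      have "prb pb {b. (a, b) \<notin> G} = 1 - prb pb {b. (a, b) \<in> G}"
        using prb_compl[of pb "{b. (a, b) \<in> G}"] by (simp add: Compl_eq)
      then show ?thesis using True A0[OF a] by (simp add: U_def)
    qed simp
  qed
  also have "\<dots> = (1 - \<gamma>) * prb pa U" by simp
  also have "\<dots> \<le> (1 - \<gamma>) * (1 - \<gamma>) ^ M" using cs(2) \<gamma> by (intro mult_left_mono) (auto simp: U_def)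
  finally have le: "expct pb (\<lambda>b. prb pa {a \<in> U. (a, b) \<notin> G}) \<le> (1 - \<gamma>) ^ Suc M" by simp
  obtain b where "prb pa {a \<in> U. (a, b) \<notin> G} \<le> expct pb (\<lambda>b. prb pa {a \<in> U. (a, b) \<notin> G})"
    using ex_le_expct[OF fin(2), of "\<lambda>b. prb pa {a \<in> U. (a, b) \<notin> G}"] by blast
  with le have b: "prb pa {a \<in> U. (a, b) \<notin> G} \<le> (1 - \<gamma>) ^ Suc M" by linarith
  have eq: "{a \<in> U. (a, b) \<notin> G} = {a \<in> A0. \<forall>b'\<in>set (b # cs). (a, b') \<notin> G}" by (auto simp: U_def)
  show ?case
    by (rule exI[of _ "b # cs"]) (use b cs(1) eq in simp)
qed simp

text \<open>\<open>A0\<close> keeps the letters with at least half of their joint mass in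
  \<open>G\<close>; the others have total mass at most 2 g. For a kept letter the density bound
  \<open>L\<close> turns this half into probability at least 1/(2 L) under an independent choice of
  \<open>b\<close>, as the greedy choice requires.\<close>

lemma covering:
  fixes r :: "('a \<times> 'b) pmf"
  assumes fin: "finite (set_pmf r)" and L: "1 \<le> L"
    and G: "\<And>a b. (a, b) \<in> G \<Longrightarrow> pmf r (a, b) \<le> L * (pmf (map_pmf fst r) a * pmf (map_pmf snd r) b)"
    and g: "prb r (- G) \<le> g"
  shows "\<exists>cs. length cs = M \<and> prb (map_pmf fst r) {a. \<forall>b\<in>set cs. (a, b) \<notin> G} \<le> 2 * g + (1 - 1 / (2 * L)) ^ M"
proof -
  define pa pb where "pa = map_pmf fst r" and "pb = map_pmf snd r"
  have finab: "finite (set_pmf pa)" "finite (set_pmf pb)" using fin by (auto simp: pa_def pb_def)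
  define h where "h = (\<lambda>a. \<Sum>b\<in>set_pmf pb. pmf r (a, b) * indicator G (a, b))"
  define h' where "h' = (\<lambda>a. \<Sum>b\<in>set_pmf pb. pmf r (a, b) * indicator (- G) (a, b))"
  have set_r: "set_pmf r \<subseteq> set_pmf pa \<times> set_pmf pb" by (force simp: pa_def pb_def)
  have hh': "h a + h' a = pmf pa a" for a
  proof -
    have "h a + h' a = (\<Sum>b\<in>set_pmf pb. pmf r (a, b))"
      unfolding h_def h'_def sum.distrib[symmetric] by (intro sum.cong) (auto simp: indicator_def)
    also have "\<dots> = (\<Sum>z\<in>Pair a ` set_pmf pb. pmf r z)" by (subst sum.reindex) (auto simp: inj_on_def)
    also have "\<dots> = prb r (Pair a ` set_pmf pb)" using finab by (simp add: measure_measure_pmf_finite)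
    also have "\<dots> = prb r (fst -` {a})"
    proof (rule antisym; rule prb_mono_supp)
      fix z assume "z \<in> set_pmf r" "z \<in> fst -` {a}"
      then show "z \<in> Pair a ` set_pmf pb" using set_r by (cases z) auto
    qed auto
    also have "\<dots> = pmf pa a" by (simp add: pa_def pmf_map)
    finally show ?thesis .
  qed
  have h'0: "0 \<le> h' a" for a by (auto simp: h'_def intro: sum_nonneg)
  have sum_h': "(\<Sum>a\<in>set_pmf pa. h' a) \<le> g"
  proof -
    have "(\<Sum>a\<in>set_pmf pa. h' a) = (\<Sum>z\<in>set_pmf pa \<times> set_pmf pb. pmf r z * indicator (- G) z)"
      unfolding h'_def by (simp add: sum.cartesian_product)
    also have "\<dots> = expct r (indicator (- G))"
      using finab set_r by (subst expct_sum[of "set_pmf pa \<times> set_pmf pb"]) auto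
    also have "\<dots> = prb r (- G)" by simp
    finally show ?thesis using g by simp
  qed
  define A0 where "A0 = {a. pmf pa a / 2 \<le> h a}"
  have bad: "prb pa (- A0) \<le> 2 * g"
  proof -
    have "prb pa (- A0) = (\<Sum>a\<in>set_pmf pa. pmf pa a * indicator (- A0) a)"
      unfolding expct_indicator[symmetric] by (rule expct_sum) (use finab in auto)
    also have "\<dots> \<le> (\<Sum>a\<in>set_pmf pa. 2 * h' a)"
    proof (rule sum_mono)
      fix a
      show "pmf pa a * indicator (- A0) a \<le> 2 * h' a"
        using hh'[of a] h'0[of a] by (auto simp: A0_def indicator_def)
    qed
    also have "\<dots> \<le> 2 * g" using sum_h' by (simp add: sum_distrib_left[symmetric])
    finally show ?thesis .
  qed
  have "\<exists>cs. length cs = M \<and> prb pa {a \<in> A0. \<forall>b\<in>set cs. (a, b) \<notin> G} \<le> (1 - 1 / (2 * L)) ^ M"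
  proof (rule greedy_covering[OF finab])
    show "1 / (2 * L) \<le> 1" using L by simp
    fix a assume a: "a \<in> set_pmf pa" "a \<in> A0"
    have pa: "0 < pmf pa a" using a by (simp add: pmf_positive)
    have "h a \<le> (\<Sum>b\<in>set_pmf pb. (L * pmf pa a) * (pmf pb b * indicator {b. (a, b) \<in> G} b))"
      unfolding h_def
    proof (rule sum_mono)
      fix b
      show "pmf r (a, b) * indicator G (a, b) \<le> (L * pmf pa a) * (pmf pb b * indicator {b. (a, b) \<in> G} b)"
        using G[of a b] by (auto simp: indicator_def pa_def pb_def mult.assoc)
    qed
    also have "\<dots> = (L * pmf pa a) * expct pb (indicator {b. (a, b) \<in> G})"
      using finab by (simp only: sum_distrib_left[symmetric] expct_sum[OF _ order_refl])
    also have "\<dots> = (L * pmf pa a) * prb pb {b. (a, b) \<in> G}" by simp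
    finally have "pmf pa a * (1 / 2) \<le> pmf pa a * (L * prb pb {b. (a, b) \<in> G})"
      using a(2) by (simp add: A0_def mult_ac)
    then have "1 / 2 \<le> L * prb pb {b. (a, b) \<in> G}" using pa by (simp only: mult_le_cancel_left_pos)
    then show "1 / (2 * L) \<le> prb pb {b. (a, b) \<in> G}" using L by (simp add: field_simps)
  qed
  then obtain cs where cs: "length cs = M" "prb pa {a \<in> A0. \<forall>b\<in>set cs. (a, b) \<notin> G} \<le> (1 - 1 / (2 * L)) ^ M" by blast
  have "prb pa {a. \<forall>b\<in>set cs. (a, b) \<notin> G} \<le> prb pa (- A0 \<union> {a \<in> A0. \<forall>b\<in>set cs. (a, b) \<notin> G})"
    by (rule prb_mono_supp) auto
  also have "\<dots> \<le> prb pa (- A0) + prb pa {a \<in> A0. \<forall>b\<in>set cs. (a, b) \<notin> G}" by (rule prb_Un_le)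
  finally show ?thesis using bad cs by (intro exI[of _ cs]) (auto simp: pa_def)
qed

section \<open>Information density and coding for one marginal\<close>

lemma inj_unzip: "inj (\<lambda>zs. (map fst zs, map snd zs))"
proof (rule injI)
  fix zs zs' :: "('a \<times> 'b) list"
  assume "(map fst zs, map snd zs) = (map fst zs', map snd zs')"
  then have "zip (map fst zs) (map snd zs) = zip (map fst zs') (map snd zs')" by simp
  then show "zs = zs'" by (simp only: zip_map_fst_snd)
qed

lemma pmf_replicate_pair_pmf:
  "length zs = n \<Longrightarrow> pmf (replicate_pmf n (pair_pmf p q)) zs =
    pmf (replicate_pmf n p) (map fst zs) * pmf (replicate_pmf n q) (map snd zs)"
  by (induction zs arbitrary: n) (auto simp: pmf_pair)

lemma map_snd_iid_pair: "map_pmf snd (iid_pair n p) = replicate_pmf n (map_pmf snd p)"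
  by (simp add: iid_pair_eq map_bind_pmf bind_return_pmf')

text \<open>Mutual information is the divergence of \<open>r\<close> from the product of its
  marginals, so this is the i.i.d. divergence rate, transported from words of pairs to pairs of
  words.\<close>

lemma information_density:
  fixes r :: "('a::finite \<times> nat) pmf"
  assumes fin: "finite (set_pmf r)"
  shows "c < mutual_info r \<Longrightarrow> (\<lambda>n. prb (iid_pair n r) {z.
      \<not> pmf (replicate_pmf n (map_pmf fst r)) (fst z) * pmf (replicate_pmf n (map_pmf snd r)) (snd z)
        \<le> exp (- (real n * c)) * pmf (iid_pair n r) z}) \<longlonglongrightarrow> 0"
    and "mutual_info r < c \<Longrightarrow> (\<lambda>n. prb (iid_pair n r) {z.
      \<not> exp (- (real n * c)) * pmf (iid_pair n r) z
        \<le> pmf (replicate_pmf n (map_pmf fst r)) (fst z) * pmf (replicate_pmf n (map_pmf snd r)) (snd z)}) \<longlonglongrightarrow> 0"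
proof -
  let ?q = "pair_pmf (map_pmf fst r) (map_pmf snd r)"
  have "set_pmf r \<subseteq> set_pmf ?q" by force
  from divergence_rate_iid[OF fin this]
  have rate: "divergence_rate r (\<lambda>n. replicate_pmf n ?q) (ereal (mutual_info r))"
    by (simp only: mutual_info_eq_kl)
  have pmf_unzip: "pmf (iid_pair n r) (map fst zs, map snd zs) = pmf (replicate_pmf n r) zs" for n zs
    unfolding iid_pair_def using pmf_map_inj'[OF inj_unzip, of "replicate_pmf n r" zs] by simp
  have tr: "prb (iid_pair n r) A = prb (replicate_pmf n r) {zs. length zs = n \<and> (map fst zs, map snd zs) \<in> A}" for n A
    unfolding iid_pair_def by (auto intro!: antisym prb_mono_supp dest: length_replicate_pmf)
  have tr': "prb (replicate_pmf n r) A = prb (replicate_pmf n r) {zs. length zs = n \<and> zs \<in> A}" for n A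
    by (auto intro!: antisym prb_mono_supp dest: length_replicate_pmf)
  {
    assume "c < mutual_info r"
    then have *: "(\<lambda>n. prb (replicate_pmf n r) {zs. \<not> pmf (replicate_pmf n ?q) zs \<le> exp (- (real n * c)) * pmf (replicate_pmf n r) zs}) \<longlonglongrightarrow> 0"
      using rate by (simp add: divergence_rate_def)
    show "(\<lambda>n. prb (iid_pair n r) {z.
      \<not> pmf (replicate_pmf n (map_pmf fst r)) (fst z) * pmf (replicate_pmf n (map_pmf snd r)) (snd z)
        \<le> exp (- (real n * c)) * pmf (iid_pair n r) z}) \<longlonglongrightarrow> 0"
      using * by (subst (asm) tr', subst tr) (simp add: pmf_unzip pmf_replicate_pair_pmf cong: conj_cong)
  }
  {
    assume "mutual_info r < c"
    then have *: "(\<lambda>n. prb (replicate_pmf n r) {zs. \<not> exp (- (real n * c)) * pmf (replicate_pmf n r) zs \<le> pmf (replicate_pmf n ?q) zs}) \<longlonglongrightarrow> 0"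
      using rate by (simp add: divergence_rate_def)
    show "(\<lambda>n. prb (iid_pair n r) {z.
      \<not> exp (- (real n * c)) * pmf (iid_pair n r) z
        \<le> pmf (replicate_pmf n (map_pmf fst r)) (fst z) * pmf (replicate_pmf n (map_pmf snd r)) (snd z)}) \<longlonglongrightarrow> 0"
      using * by (subst (asm) tr', subst tr) (simp add: pmf_unzip pmf_replicate_pair_pmf cong: conj_cong)
  }
qed

lemma iid_pair_Suc:
  "iid_pair (Suc n) p = do {z \<leftarrow> p; w \<leftarrow> iid_pair n p; return_pmf (fst z # fst w, snd z # snd w)}"
  by (simp add: iid_pair_def replicate_pmf.simps map_bind_pmf bind_map_pmf)

text \<open>The draw of the input word together with its auxiliary word is common to all components;
  only the channel applied afterwards differs. Hence one codebook can serve a whole class of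
  channels.\<close>

lemma iid_pair_law_YU:
  assumes p: "map_pmf snd p = pX"
  shows "iid_pair n (law_YU p K) =
    do {z \<leftarrow> iid_pair n (law_XU pX K); ys \<leftarrow> word_chan p (fst z); return_pmf (ys, snd z)}"
proof (induction n)
  case 0
  then show ?case by (simp add: iid_pair_def bind_return_pmf)
next
  case (Suc n)
  have "iid_pair (Suc n) (law_YU p K) =
    do {z \<leftarrow> law_XU pX K; y \<leftarrow> chan p (fst z); w \<leftarrow> iid_pair n (law_XU pX K); ys \<leftarrow> word_chan p (fst w);
      return_pmf (y # ys, snd z # snd w)}"
    by (subst iid_pair_Suc, subst Suc) (simp add: law_YU_eq[OF p] bind_assoc_pmf bind_return_pmf)
  also have "\<dots> = do {z \<leftarrow> law_XU pX K; w \<leftarrow> iid_pair n (law_XU pX K); y \<leftarrow> chan p (fst z); ys \<leftarrow> word_chan p (fst w);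
      return_pmf (y # ys, snd z # snd w)}"
    by (subst (2) bind_commute_pmf) (rule refl)
  also have "\<dots> = do {z \<leftarrow> iid_pair (Suc n) (law_XU pX K); ys \<leftarrow> word_chan p (fst z); return_pmf (ys, snd z)}"
    by (simp add: iid_pair_Suc prod_pmfs.simps bind_assoc_pmf bind_return_pmf)
  finally show ?case .
qed

text \<open>Besides a density bound, the set \<open>G\<close> of good pairs demands that under every
  component the output falls into the decoding set with conditional probability above 1 - g n.
  Covering the input word by a good pair thus yields the type I bound for all components at once;
  this plays the part of the Markov lemma.\<close>

lemma achievability_component:
  fixes pX :: "'x::finite pmf" and P :: "nat \<Rightarrow> ('y::finite \<times> 'x) pmf"
  assumes F: "finite F" and marg: "\<And>i. i \<in> F \<Longrightarrow> map_pmf snd (P i) = pX"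
    and K: "finite (\<Union>x. set_pmf (K x))" and R: "0 < R" "mutual_info (law_XU pX K) < R"
    and e: "\<And>i. i \<in> F \<Longrightarrow> e i < mutual_info (law_YU (P i) K)"
  obtains err :: "nat \<Rightarrow> real" and enc :: "nat \<Rightarrow> 'x list \<Rightarrow> nat" and A :: "nat \<Rightarrow> nat \<Rightarrow> nat \<Rightarrow> 'y list set"
  where "err \<longlonglongrightarrow> 0" "\<And>n x. real (enc n x) \<le> exp (real n * R)"
    "\<And>n i w. i \<in> F \<Longrightarrow> prb (replicate_pmf n (map_pmf fst (P i))) (A n i w) \<le> exp (- (real n * e i))"
    "\<And>n i. i \<in> F \<Longrightarrow> expct (replicate_pmf n pX) (\<lambda>x. prb (word_chan (P i) x) (- A n i (enc n x))) \<le> err n"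
proof -
  define rX where "rX = law_XU pX K"
  define rY where "rY = (\<lambda>i. law_YU (P i) K)"
  have finX: "finite (set_pmf rX)" unfolding rX_def law_XU_def
    by (simp add: set_bind_pmf) (use K in \<open>auto intro: finite_subset[of _ "\<Union>x. set_pmf (K x)"]\<close>)
  have finY: "finite (set_pmf (rY i))" if "i \<in> F" for i
  proof -
    have "rY i = do {z \<leftarrow> rX; y \<leftarrow> chan (P i) (fst z); return_pmf (y, snd z)}"
      using law_YU_eq[OF marg[OF that]] by (simp add: rY_def rX_def)
    then show ?thesis using finX by (simp add: set_bind_pmf)
  qed
  \<comment> \<open>A positive rate strictly between the mutual information and \<open>R\<close>:
    the gap below makes the density bound typical, the gap above leaves enough codewords.\<close>
  define R1 where "R1 = (max 0 (mutual_info rX) + R) / 2"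
  have R1: "0 < R1" "mutual_info rX < R1" "R1 < R" using R by (auto simp: R1_def rX_def max_def)
  \<comment> \<open>The support condition empties the set for auxiliary words of probability zero;
    for all others this probability can be divided out.\<close>
  define AU where "AU = (\<lambda>n i us. {y. us \<in> set_pmf (replicate_pmf n (map_pmf snd (rY i))) \<and>
      pmf (replicate_pmf n (map_pmf fst (rY i))) y * pmf (replicate_pmf n (map_pmf snd (rY i))) us
        \<le> exp (- (real n * e i)) * pmf (iid_pair n (rY i)) (y, us)})"
  define \<epsilon> where "\<epsilon> = (\<lambda>n. \<Sum>i\<in>F. prb (iid_pair n (rY i)) {z. fst z \<notin> AU n i (snd z)})"
  define \<epsilon>' where "\<epsilon>' = (\<lambda>n. prb (iid_pair n rX) {z.
      \<not> exp (- (real n * R1)) * pmf (iid_pair n rX) z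
        \<le> pmf (replicate_pmf n (map_pmf fst rX)) (fst z) * pmf (replicate_pmf n (map_pmf snd rX)) (snd z)})"
  have \<epsilon>'_lim: "\<epsilon>' \<longlonglongrightarrow> 0" unfolding \<epsilon>'_def by (rule information_density(2)[OF finX R1(2)])
  have \<epsilon>_lim: "\<epsilon> \<longlonglongrightarrow> 0"
  proof -
    have "(\<lambda>n. prb (iid_pair n (rY i)) {z. fst z \<notin> AU n i (snd z)}) \<longlonglongrightarrow> 0" if i: "i \<in> F" for i
    proof (rule tendsto_zero_mono[OF information_density(1)[OF finY[OF i]]])
      show "e i < mutual_info (rY i)" using e[OF i] by (simp add: rY_def)
      fix n
      show "prb (iid_pair n (rY i)) {z. fst z \<notin> AU n i (snd z)} \<le> prb (iid_pair n (rY i)) {z.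
      \<not> pmf (replicate_pmf n (map_pmf fst (rY i))) (fst z) * pmf (replicate_pmf n (map_pmf snd (rY i))) (snd z)
        \<le> exp (- (real n * e i)) * pmf (iid_pair n (rY i)) z}"
      proof (rule prb_mono_supp)
        fix z assume z: "z \<in> set_pmf (iid_pair n (rY i))" "z \<in> {z. fst z \<notin> AU n i (snd z)}"
        have "snd z \<in> set_pmf (map_pmf snd (iid_pair n (rY i)))" using z(1) by simp
        then have "snd z \<in> set_pmf (replicate_pmf n (map_pmf snd (rY i)))" by (simp only: map_snd_iid_pair)
        then show "z \<in> {z. \<not> pmf (replicate_pmf n (map_pmf fst (rY i))) (fst z) * pmf (replicate_pmf n (map_pmf snd (rY i))) (snd z)
          \<le> exp (- (real n * e i)) * pmf (iid_pair n (rY i)) z}"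
          using z(2) by (simp add: AU_def)
      qed
    qed simp
    then have "\<epsilon> \<longlonglongrightarrow> (\<Sum>i\<in>F. 0)" unfolding \<epsilon>_def by (intro tendsto_sum)
    then show ?thesis by simp
  qed
  have \<epsilon>0: "0 \<le> \<epsilon> n" for n by (auto simp: \<epsilon>_def intro: sum_nonneg)
  \<comment> \<open>The square root gives \<open>\<epsilon> n / g n \<le> g n\<close> after Markov's
    inequality, and the summand 1/(n+1) keeps \<open>g n\<close> positive.\<close>
  define g where "g = (\<lambda>n. sqrt (\<epsilon> n + 1 / (real n + 1)))"
  have g_lim: "g \<longlonglongrightarrow> 0"
  proof -
    have "(\<lambda>n. 1 / (real n + 1)) \<longlonglongrightarrow> 0" by real_asymp
    then have "(\<lambda>n. \<epsilon> n + 1 / (real n + 1)) \<longlonglongrightarrow> 0 + 0" by (intro tendsto_add \<epsilon>_lim)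
    then have "g \<longlonglongrightarrow> sqrt (0 + 0)" unfolding g_def by (rule tendsto_real_sqrt)
    then show ?thesis by simp
  qed
  have g0: "0 < g n" for n using \<epsilon>0[of n] by (simp add: g_def add_nonneg_pos)
  have g2: "\<epsilon> n / g n \<le> g n" for n
  proof -
    have "\<epsilon> n \<le> g n * g n" using \<epsilon>0[of n] by (simp add: g_def)
    then show ?thesis using g0[of n] by (simp add: pos_divide_le_eq)
  qed
  define V where "V = (\<lambda>i x. word_chan (P i) x)"
  define G where "G = (\<lambda>n. {z. exp (- (real n * R1)) * pmf (iid_pair n rX) z
        \<le> pmf (replicate_pmf n (map_pmf fst rX)) (fst z) * pmf (replicate_pmf n (map_pmf snd rX)) (snd z) \<and>
      (\<forall>i\<in>F. prb (V i (fst z)) (- AU n i (snd z)) < g n)})"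
  have fin_iid: "finite (set_pmf (iid_pair n rX))" for n using finX by (simp add: iid_pair_def)
  have PG: "prb (iid_pair n rX) (- G n) \<le> \<epsilon>' n + g n" for n
  proof -
    have one: "prb (iid_pair n rX) {z. g n \<le> prb (V i (fst z)) (- AU n i (snd z))} \<le>
        prb (iid_pair n (rY i)) {z. fst z \<notin> AU n i (snd z)} / g n" if i: "i \<in> F" for i
    proof -
      have "prb (iid_pair n rX) {z. g n \<le> prb (V i (fst z)) (- AU n i (snd z))} \<le>
        expct (iid_pair n rX) (\<lambda>z. prb (V i (fst z)) (- AU n i (snd z))) / g n"
        by (rule markov_ineq) (use fin_iid g0 in auto)
      also have "expct (iid_pair n rX) (\<lambda>z. prb (V i (fst z)) (- AU n i (snd z))) =
          expct (iid_pair n rX) (\<lambda>z. expct (V i (fst z)) (\<lambda>y. indicator {z. fst z \<notin> AU n i (snd z)} (y, snd z)))"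
      proof (intro expct_cong refl)
        fix z
        have "prb (V i (fst z)) (- AU n i (snd z)) = expct (V i (fst z)) (indicator (- AU n i (snd z)))" by simp
        also have "\<dots> = expct (V i (fst z)) (\<lambda>y. indicator {z. fst z \<notin> AU n i (snd z)} (y, snd z))"
          by (intro expct_cong refl) (auto simp: indicator_def)
        finally show "prb (V i (fst z)) (- AU n i (snd z)) =
          expct (V i (fst z)) (\<lambda>y. indicator {z. fst z \<notin> AU n i (snd z)} (y, snd z))" .
      qed
      also have "\<dots> = expct (iid_pair n (rY i)) (indicator {z. fst z \<notin> AU n i (snd z)})"
        unfolding rY_def rX_def iid_pair_law_YU[OF marg[OF i]] V_def
        by (rule expct_bind2[symmetric]) (use fin_iid[of n] in \<open>auto simp: rX_def\<close>)
      also have "\<dots> = prb (iid_pair n (rY i)) {z. fst z \<notin> AU n i (snd z)}" by simp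
      finally show ?thesis .
    qed
    have "prb (iid_pair n rX) (- G n) \<le> prb (iid_pair n rX) ({z.
      \<not> exp (- (real n * R1)) * pmf (iid_pair n rX) z
        \<le> pmf (replicate_pmf n (map_pmf fst rX)) (fst z) * pmf (replicate_pmf n (map_pmf snd rX)) (snd z)} \<union>
      (\<Union>i\<in>F. {z. g n \<le> prb (V i (fst z)) (- AU n i (snd z))}))"
      by (rule prb_mono_supp) (auto simp: G_def not_less)
    also have "\<dots> \<le> \<epsilon>' n + prb (iid_pair n rX) (\<Union>i\<in>F. {z. g n \<le> prb (V i (fst z)) (- AU n i (snd z))})"
      unfolding \<epsilon>'_def by (rule prb_Un_le)
    also have "prb (iid_pair n rX) (\<Union>i\<in>F. {z. g n \<le> prb (V i (fst z)) (- AU n i (snd z))}) \<le>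
        (\<Sum>i\<in>F. prb (iid_pair n rX) {z. g n \<le> prb (V i (fst z)) (- AU n i (snd z))})"
      by (rule measure_pmf.finite_measure_subadditive_finite) (use F in auto)
    also have "\<dots> \<le> (\<Sum>i\<in>F. prb (iid_pair n (rY i)) {z. fst z \<notin> AU n i (snd z)} / g n)"
      by (rule sum_mono) (rule one)
    also have "\<dots> = \<epsilon> n / g n" by (simp add: \<epsilon>_def sum_divide_distrib)
    finally show ?thesis using g2[of n] by linarith
  qed
  define M where "M = (\<lambda>n. nat \<lfloor>exp (real n * R)\<rfloor>)"
  have M: "real (M n) \<le> exp (real n * R)" "exp (real n * R) - 1 \<le> real (M n)" for n
    unfolding M_def using exp_gt_zero[of "real n * R"] by linarith+
  \<comment> \<open>About exp (n R) codewords against a covering probability of order exp (- n R1):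
    the failure probability decays doubly exponentially.\<close>
  define u where "u = (\<lambda>n. (1 - 1 / (2 * exp (real n * R1))) ^ M n)"
  have "\<forall>n. \<exists>cs. length cs = M n \<and> prb (map_pmf fst (iid_pair n rX)) {x. \<forall>us\<in>set cs. (x, us) \<notin> G n} \<le> 2 * (\<epsilon>' n + g n) + u n"
    unfolding u_def
  proof (intro allI covering[OF fin_iid _ _ PG])
    fix n x us
    show "1 \<le> exp (real n * R1)" using R1 by simp
    assume "(x, us) \<in> G n"
    then have "exp (- (real n * R1)) * pmf (iid_pair n rX) (x, us)
        \<le> pmf (replicate_pmf n (map_pmf fst rX)) x * pmf (replicate_pmf n (map_pmf snd rX)) us"
      by (simp add: G_def)
    then show "pmf (iid_pair n rX) (x, us) \<le> exp (real n * R1) *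
        (pmf (map_pmf fst (iid_pair n rX)) x * pmf (map_pmf snd (iid_pair n rX)) us)"
      unfolding map_fst_iid_pair map_snd_iid_pair by (rule exp_minus_mult_leD)
  qed
  then obtain cs where cs': "\<forall>n. length (cs n) = M n \<and>
      prb (map_pmf fst (iid_pair n rX)) {x. \<forall>us\<in>set (cs n). (x, us) \<notin> G n} \<le> 2 * (\<epsilon>' n + g n) + u n"
    unfolding choice_iff by blast
  have cs: "length (cs n) = M n"
    "prb (map_pmf fst (iid_pair n rX)) {x. \<forall>us\<in>set (cs n). (x, us) \<notin> G n} \<le> 2 * (\<epsilon>' n + g n) + u n" for n
    using cs' by auto
  \<comment> \<open>The index \<open>M n\<close> lies beyond the codebook and signals failure. The
    decoding set attached to it is unspecified: such words are charged in full to the type I error,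
    and the bound on accidental acceptance holds for every index.\<close>
  define enc where "enc = (\<lambda>n x. if \<exists>j<M n. (x, cs n ! j) \<in> G n then SOME j. j < M n \<and> (x, cs n ! j) \<in> G n else M n)"
  have enc_good: "enc n x < M n \<and> (x, cs n ! enc n x) \<in> G n" if "\<not> (\<forall>us\<in>set (cs n). (x, us) \<notin> G n)" for n x
  proof -
    have ex: "\<exists>j. j < M n \<and> (x, cs n ! j) \<in> G n" using that by (auto simp: in_set_conv_nth cs)
    from someI_ex[OF this] show ?thesis using ex by (simp add: enc_def)
  qed
  have enc_le: "enc n x \<le> M n" for n x
  proof (cases "\<exists>j<M n. (x, cs n ! j) \<in> G n")
    case True
    then have "\<not> (\<forall>us\<in>set (cs n). (x, us) \<notin> G n)" using cs by (metis nth_mem)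
    then show ?thesis using enc_good by fastforce
  next
    case False
    then show ?thesis by (simp only: enc_def False if_False order_refl)
  qed
  have fstX: "map_pmf fst rX = pX" by (simp add: rX_def map_fst_law_XU)
  show ?thesis
  proof (rule that[of "\<lambda>n. (2 * (\<epsilon>' n + g n) + u n) + g n" enc "\<lambda>n i w. AU n i (cs n ! w)"])
    have u_lim: "u \<longlonglongrightarrow> 0"
    proof (rule tendsto_zero_mono)
      have "0 < R - R1" using R1 by simp
      then show "(\<lambda>n. exp (- ((exp (real n * (R - R1)) - 1) / 2))) \<longlonglongrightarrow> 0" by real_asymp
      fix n
      define t where "t = 1 / (2 * exp (real n * R1))"
      have "1 \<le> exp (real n * R1)" using R1 by simp
      then have t_half: "t \<le> 1 / (2 * 1)" unfolding t_def by (intro divide_left_mono) auto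
      have "0 \<le> t" by (simp add: t_def)
      moreover have "t \<le> 1" using t_half by linarith
      ultimately have t: "0 \<le> t" "t \<le> 1" .
      show "0 \<le> u n" using t by (simp add: u_def t_def[symmetric])
      have "u n \<le> exp (- t) ^ M n"
        unfolding u_def t_def[symmetric] using t exp_ge_add_one_self[of "- t"] by (intro power_mono) auto
      also have "\<dots> = exp (- (t * real (M n)))" by (simp add: exp_of_nat_mult[symmetric] mult.commute)
      also have "\<dots> \<le> exp (- ((exp (real n * (R - R1)) - 1) / 2))"
      proof -
        have "(exp (real n * (R - R1)) - 1) / 2 \<le> t * (exp (real n * R) - 1)"
        proof -
          have "t * exp (real n * R) = exp (real n * (R - R1)) / 2"
            by (simp add: t_def exp_diff right_diff_distrib)
          then show ?thesis using t_half by (simp add: right_diff_distrib)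
        qed
        also have "\<dots> \<le> t * real (M n)" using M(2) t by (intro mult_left_mono) auto
        finally show ?thesis by simp
      qed
      finally show "u n \<le> exp (- ((exp (real n * (R - R1)) - 1) / 2))" .
    qed
    have "(\<lambda>n. (2 * (\<epsilon>' n + g n) + u n) + g n) \<longlonglongrightarrow> (2 * (0 + 0) + 0) + 0"
      by (intro tendsto_intros \<epsilon>'_lim g_lim u_lim)
    then show "(\<lambda>n. (2 * (\<epsilon>' n + g n) + u n) + g n) \<longlonglongrightarrow> 0" by simp
    show "real (enc n x) \<le> exp (real n * R)" for n x using enc_le[of n x] M(1)[of n] by linarith
  next
    fix n i w assume i: "i \<in> F"
    define us where "us = cs n ! w"
    have fstY: "map_pmf fst (rY i) = map_pmf fst (P i)"
      by (simp add: rY_def law_YU_def map_bind_pmf case_prod_unfold) (simp add: map_pmf_def)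
    show "prb (replicate_pmf n (map_pmf fst (P i))) (AU n i (cs n ! w)) \<le> exp (- (real n * e i))"
    proof (cases "us \<in> set_pmf (replicate_pmf n (map_pmf snd (rY i)))")
      case True
      define q where "q = pmf (replicate_pmf n (map_pmf snd (rY i))) us"
      have q: "0 < q" using True by (simp add: q_def pmf_positive)
      let ?pY = "replicate_pmf n (map_pmf fst (rY i))"
      have finpY: "finite (set_pmf ?pY)" by simp
      \<comment> \<open>On the decoding set the product of the marginals is bounded by the joint
        law, whose sum over \<open>y\<close> at the fixed word \<open>us\<close> is at most
        \<open>q\<close> again.\<close>
      have "q * prb ?pY (AU n i us) = (\<Sum>y\<in>set_pmf ?pY. q * (pmf ?pY y * indicator (AU n i us) y))"
        unfolding expct_indicator[symmetric] sum_distrib_left[symmetric] by (subst expct_sum[OF finpY order_refl]) simp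
      also have "\<dots> \<le> (\<Sum>y\<in>set_pmf ?pY. exp (- (real n * e i)) * pmf (iid_pair n (rY i)) (y, us))"
        by (intro sum_mono) (auto simp: AU_def indicator_def q_def mult.commute)
      also have "\<dots> = exp (- (real n * e i)) * (\<Sum>z\<in>(\<lambda>y. (y, us)) ` set_pmf ?pY. pmf (iid_pair n (rY i)) z)"
        by (subst sum.reindex) (auto simp: inj_on_def sum_distrib_left)
      also have "(\<Sum>z\<in>(\<lambda>y. (y, us)) ` set_pmf ?pY. pmf (iid_pair n (rY i)) z) = prb (iid_pair n (rY i)) ((\<lambda>y. (y, us)) ` set_pmf ?pY)"
        using finpY by (simp add: measure_measure_pmf_finite)
      also have "\<dots> \<le> prb (iid_pair n (rY i)) (snd -` {us})" by (rule prb_mono_supp) auto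
      also have "\<dots> = pmf (map_pmf snd (iid_pair n (rY i))) us" by (simp add: pmf_map)
      also have "\<dots> = q" by (simp add: q_def map_snd_iid_pair)
      finally have "q * prb ?pY (AU n i us) \<le> q * exp (- (real n * e i))" by (simp add: mult.commute)
      then have "prb ?pY (AU n i us) \<le> exp (- (real n * e i))" using q by (simp only: mult_le_cancel_left_pos)
      then show ?thesis by (simp add: fstY us_def)
    qed (simp add: AU_def us_def)
  next
    fix n i assume i: "i \<in> F"
    have "expct (replicate_pmf n pX) (\<lambda>x. prb (V i x) (- AU n i (cs n ! enc n x))) \<le>
      expct (replicate_pmf n pX) (\<lambda>x. indicator {x. \<forall>us\<in>set (cs n). (x, us) \<notin> G n} x + g n)"
    proof (rule expct_mono)
      fix x
      show "prb (V i x) (- AU n i (cs n ! enc n x)) \<le> indicator {x. \<forall>us\<in>set (cs n). (x, us) \<notin> G n} x + g n"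
      proof (cases "\<forall>us\<in>set (cs n). (x, us) \<notin> G n")
        case True
        then show ?thesis using g0[of n] by (simp add: add_increasing2 less_imp_le)
      next
        case False
        then have "(x, cs n ! enc n x) \<in> G n" using enc_good by blast
        then show ?thesis using i False by (simp add: G_def less_imp_le)
      qed
    qed simp
    also have "\<dots> = prb (replicate_pmf n pX) {x. \<forall>us\<in>set (cs n). (x, us) \<notin> G n} + g n"
      by (subst expct_add) simp_all
    also have "\<dots> \<le> (2 * (\<epsilon>' n + g n) + u n) + g n"
      using cs(2)[of n] unfolding map_fst_iid_pair fstX by simp
    finally show "expct (replicate_pmf n pX) (\<lambda>x. prb (word_chan (P i) x) (- AU n i (cs n ! enc n x)))
      \<le> (2 * (\<epsilon>' n + g n) + u n) + g n" by (simp add: V_def)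
  qed
qed

section \<open>Mixtures\<close>

lemma accept_prob_compressed:
  "accept_prob (compressed \<phi> p) \<psi> = expct p (\<lambda>z. pmf (\<psi> (fst z, \<phi> (snd z))) H0)"
  by (simp add: accept_prob_def compressed_def bind_map_pmf pmf_bind case_prod_unfold)

lemma accept_prob_mixture:
  "accept_prob (compressed \<phi> (bind_pmf \<nu> p)) \<psi> = expct \<nu> (\<lambda>i. accept_prob (compressed \<phi> (p i)) \<psi>)"
  by (simp add: accept_prob_def compressed_def map_bind_pmf bind_assoc_pmf pmf_bind[of \<nu>])

lemma accept_prob_pair:
  "accept_prob (compressed \<phi> (pair_pmf A B)) \<psi> = expct B (\<lambda>x. expct A (\<lambda>y. pmf (\<psi> (y, \<phi> x)) H0))"
proof -
  have "bind_pmf (compressed \<phi> (pair_pmf A B)) \<psi> = bind_pmf A (\<lambda>y. bind_pmf B (\<lambda>x. \<psi> (y, \<phi> x)))"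
    by (simp add: compressed_def bind_map_pmf pair_pmf_def bind_assoc_pmf bind_return_pmf)
  also have "\<dots> = bind_pmf B (\<lambda>x. bind_pmf A (\<lambda>y. \<psi> (y, \<phi> x)))" by (rule bind_commute_pmf)
  finally show ?thesis by (simp add: accept_prob_def pmf_bind)
qed

lemma accept_prob_iid_pair:
  fixes p :: "('y::finite \<times> 'x::finite) pmf"
  assumes "map_pmf snd p = pX"
  shows "accept_prob (compressed \<phi> (iid_pair n p)) \<psi> =
    expct (replicate_pmf n pX) (\<lambda>x. expct (word_chan p x) (\<lambda>y. pmf (\<psi> (y, \<phi> x)) H0))"
  unfolding accept_prob_compressed iid_pair_eq assms by (subst expct_bind2) auto

lemma accept_prob_unit: "0 \<le> accept_prob p \<psi>" "accept_prob p \<psi> \<le> 1"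
  by (auto simp: accept_prob_def pmf_le_1)

text \<open>The type I error is the \<nu>-average of the component errors, so each component in
  \<open>F\<close> eventually errs with probability below \<open>c\<close>, and
  \<open>real (card F) * c < 1\<close> keeps the sum of these errors away from 1. In the type II
  error all reference components but \<open>(j i, t)\<close> are dropped, at the cost of a constant
  weight. Leaving \<open>F\<close> free allows a whole class as well as a single component.\<close>

lemma achievable_imp_le_theta:
  fixes P :: "nat \<Rightarrow> ('y::finite \<times> 'x::finite) pmf" and pX :: "'x pmf"
  assumes ach: "achievable (\<lambda>n. bind_pmf \<nu> (\<lambda>i. iid_pair n (P i)))
      (\<lambda>n. bind_pmf \<tau> (\<lambda>(j, t). pair_pmf (QY j n) (QX t n))) \<epsilon> R E"
    and fin\<nu>: "finite (set_pmf \<nu>)" and F: "finite F" "F \<noteq> {}" "F \<subseteq> set_pmf \<nu>"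
    and marg: "\<And>i. i \<in> F \<Longrightarrow> map_pmf snd (P i) = pX"
    and rateY: "\<And>i. i \<in> F \<Longrightarrow> divergence_rate (map_pmf fst (P i)) (QY (j i)) (ereal (dY i))"
    and rateX: "divergence_rate pX (QX t) (ereal dX)"
    and \<tau>: "\<And>i. i \<in> F \<Longrightarrow> 0 < pmf \<tau> (j i, t)"
    and R: "0 < R" and c: "\<And>i. i \<in> F \<Longrightarrow> \<epsilon> < pmf \<nu> i * c" "0 \<le> c" "real (card F) * c < 1"
  shows "ereal E \<le> theta F pX P (\<lambda>i. ereal (dY i + dX)) R"
proof -
  define p where "p = (\<lambda>n. bind_pmf \<nu> (\<lambda>i. iid_pair n (P i)))"
  define q where "q = (\<lambda>n. bind_pmf \<tau> (\<lambda>(j, t). pair_pmf (QY j n) (QX t n)))"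
  obtain M :: "nat \<Rightarrow> nat set" and \<phi> :: "nat \<Rightarrow> 'x list \<Rightarrow> nat" and \<psi> :: "nat \<Rightarrow> 'y decision_map"
    where M: "\<And>n. finite (M n)" "\<And>n. \<phi> n ` {x. length x = n} \<subseteq> M n"
      and \<alpha>: "limsup (\<lambda>n. ereal (type_I_error (p n) (\<phi> n) (\<psi> n))) \<le> ereal \<epsilon>"
      and \<beta>: "ereal E \<le> liminf (\<lambda>n. exponent n (type_II_error (q n) (\<phi> n) (\<psi> n)))"
      and rate: "limsup (\<lambda>n. ereal (1 / real n * ln (real (card (M n))))) \<le> ereal R"
    using ach unfolding achievable_def p_def q_def by blast
  define T where "T = (\<lambda>n z. pmf (\<psi> n z) H0)"
  define acc where "acc = (\<lambda>n i. accept_prob (compressed (\<phi> n) (iid_pair n (P i))) (\<psi> n))"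
  have acc: "acc n i = expct (replicate_pmf n pX) (\<lambda>x. expct (word_chan (P i) x) (\<lambda>y. T n (y, \<phi> n x)))"
    if "i \<in> F" for n i
    using accept_prob_iid_pair[OF marg[OF that]] by (simp add: acc_def T_def)
  have \<alpha>_eq: "type_I_error (p n) (\<phi> n) (\<psi> n) = (\<Sum>i\<in>set_pmf \<nu>. pmf \<nu> i * (1 - acc n i))" for n
  proof -
    have "type_I_error (p n) (\<phi> n) (\<psi> n) = expct \<nu> (\<lambda>i. 1 - acc n i)"
      unfolding type_I_error_def p_def accept_prob_mixture acc_def using fin\<nu> by (simp add: expct_diff)
    then show ?thesis using fin\<nu> by (simp add: expct_sum)
  qed
  have acc1: "acc n i \<le> 1" for n i by (simp add: acc_def accept_prob_unit)
  define \<eta> where "\<eta> = 1 - real (card F) * c"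
  have \<eta>: "0 < \<eta>" "\<eta> \<le> 1" using c by (auto simp: \<eta>_def)
  have err_i: "\<forall>\<^sub>F n in sequentially. \<forall>i\<in>F. 1 - acc n i < c"
  proof (rule eventually_ball_finite[OF F(1)], rule ballI)
    fix i assume i: "i \<in> F"
    have "limsup (\<lambda>n. ereal (type_I_error (p n) (\<phi> n) (\<psi> n))) < ereal (pmf \<nu> i * c)"
      using \<alpha> c(1)[OF i] by (meson ereal_less(2) le_less_trans less_ereal.simps(1))
    then have "\<forall>\<^sub>F n in sequentially. ereal (type_I_error (p n) (\<phi> n) (\<psi> n)) < ereal (pmf \<nu> i * c)"
      by (rule Limsup_lessD)
    then show "\<forall>\<^sub>F n in sequentially. 1 - acc n i < c"
    proof eventually_elim
      case (elim n)
      have "pmf \<nu> i * (1 - acc n i) \<le> (\<Sum>i\<in>set_pmf \<nu>. pmf \<nu> i * (1 - acc n i))"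
        using i F(3) fin\<nu> acc1 by (intro member_le_sum) auto
      then have "pmf \<nu> i * (1 - acc n i) < pmf \<nu> i * c" using elim by (simp add: \<alpha>_eq)
      then show ?case by (simp add: mult_less_cancel_left pmf_nonneg not_less[symmetric])
    qed
  qed
  have err: "\<forall>\<^sub>F n in sequentially. (\<Sum>i\<in>F. 1 - expct (replicate_pmf n pX)
      (\<lambda>x. expct (word_chan (P i) x) (\<lambda>y. T n (y, \<phi> n x)))) \<le> 1 - \<eta>"
    using err_i
  proof eventually_elim
    case (elim n)
    have "(\<Sum>i\<in>F. 1 - acc n i) \<le> (\<Sum>i\<in>F. c)" using elim by (intro sum_mono) (simp add: less_imp_le)
    then show ?case by (simp add: acc \<eta>_def)
  qed
  define \<tau>0 where "\<tau>0 = Min ((\<lambda>i. pmf \<tau> (j i, t)) ` F)"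
  have \<tau>0: "0 < \<tau>0" "\<And>i. i \<in> F \<Longrightarrow> \<tau>0 \<le> pmf \<tau> (j i, t)"
    using F \<tau> by (auto simp: \<tau>0_def Min_gr_iff)
  have T: "0 \<le> T n z" "T n z \<le> 1" for n z by (auto simp: T_def pmf_le_1)
  \<comment> \<open>One slack \<rho> pays for passing from the liminf to all large \<open>n\<close>,
    the other is the loss in \<open>converse\<close>.\<close>
  have "ereal (E - 2 * \<rho>) \<le> theta F pX P (\<lambda>i. ereal (dY i + dX)) R" if \<rho>: "0 < \<rho>" for \<rho>
  proof -
    have "ereal (E - \<rho>) < ereal E" using \<rho> by simp
    also note \<beta>
    finally have "ereal (E - \<rho>) < liminf (\<lambda>n. exponent n (type_II_error (q n) (\<phi> n) (\<psi> n)))" .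
    then have "\<forall>\<^sub>F n in sequentially. ereal (E - \<rho>) < exponent n (type_II_error (q n) (\<phi> n) (\<psi> n))"
      by (rule less_LiminfD)
    then have \<beta>': "\<forall>\<^sub>F n in sequentially. \<forall>i\<in>F.
      \<tau>0 * expct (QX t n) (\<lambda>x. expct (QY (j i) n) (\<lambda>y. T n (y, \<phi> n x))) \<le> exp (- (real n * (E - \<rho>)))"
      using eventually_gt_at_top[of 0]
    proof eventually_elim
      case (elim n)
      define \<beta>n where "\<beta>n = type_II_error (q n) (\<phi> n) (\<psi> n)"
      have \<beta>0: "0 \<le> \<beta>n" by (simp add: \<beta>n_def type_II_error_def accept_prob_unit)
      have \<beta>_le: "\<beta>n \<le> exp (- (real n * (E - \<rho>)))"
      proof (cases "\<beta>n = 0")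
        case False
        then have pos: "0 < \<beta>n" using \<beta>0 by simp
        have "E - \<rho> < 1 / real n * ln (1 / \<beta>n)" using elim(1) False by (simp add: exponent_def \<beta>n_def)
        then have "ln \<beta>n < - (real n * (E - \<rho>))" using elim(2) pos by (simp add: ln_div field_simps)
        then have "exp (ln \<beta>n) \<le> exp (- (real n * (E - \<rho>)))" by simp
        then show ?thesis using pos by simp
      qed simp
      show ?case
      proof
        fix i assume i: "i \<in> F"
        define h where "h = (\<lambda>(j, t). expct (QX t n) (\<lambda>x. expct (QY j n) (\<lambda>y. T n (y, \<phi> n x))))"
        have h: "0 \<le> h z" "h z \<le> 1" for z
          by (cases z; simp only: h_def prod.case; intro expct_unit; intro expct_unit T)+
        have "\<beta>n = expct \<tau> h"
          unfolding \<beta>n_def type_II_error_def q_def accept_prob_mixture h_def T_def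
          by (intro expct_cong refl) (auto simp: accept_prob_pair)
        moreover have "(\<Sum>z\<in>{(j i, t)}. pmf \<tau> z * h z) \<le> expct \<tau> h" by (intro expct_ge_sum h) simp
        ultimately have "pmf \<tau> (j i, t) * h (j i, t) \<le> \<beta>n" by simp
        moreover have "\<tau>0 * h (j i, t) \<le> pmf \<tau> (j i, t) * h (j i, t)" using \<tau>0(2)[OF i] h by (intro mult_right_mono) auto
        ultimately show "\<tau>0 * expct (QX t n) (\<lambda>x. expct (QY (j i) n) (\<lambda>y. T n (y, \<phi> n x))) \<le> exp (- (real n * (E - \<rho>)))"
          using \<beta>_le by (simp add: h_def)
      qed
    qed
    have rate': "\<forall>\<^sub>F n in sequentially. real (card (\<phi> n ` {xs. length xs = n})) \<le> exp (real n * (R + \<kappa>))" if \<kappa>: "0 < \<kappa>" for \<kappa>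
    proof -
      have "ereal R < ereal (R + \<kappa>)" using \<kappa> by simp
      with rate have "limsup (\<lambda>n. ereal (1 / real n * ln (real (card (M n))))) < ereal (R + \<kappa>)" by (rule le_less_trans)
      then have "\<forall>\<^sub>F n in sequentially. ereal (1 / real n * ln (real (card (M n)))) < ereal (R + \<kappa>)" by (rule Limsup_lessD)
      then show ?thesis using eventually_gt_at_top[of 0]
      proof eventually_elim
        case (elim n)
        \<comment> \<open>A word of length \<open>n\<close> exists, so \<open>M n\<close> is
          non-empty and its cardinality can be recovered from its logarithm.\<close>
        have "replicate n undefined \<in> {xs :: 'x list. length xs = n}" by simp
        then have "\<phi> n (replicate n undefined) \<in> M n" using M(2)[of n] by blast
        then have pos: "0 < card (M n)" using M(1) card_gt_0_iff by blast
        have "ln (real (card (M n))) < real n * (R + \<kappa>)" using elim by (simp add: field_simps)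
        then have "exp (ln (real (card (M n)))) \<le> exp (real n * (R + \<kappa>))" by simp
        then have "real (card (M n)) \<le> exp (real n * (R + \<kappa>))" using pos by simp
        moreover have "card (\<phi> n ` {xs. length xs = n}) \<le> card (M n)" by (rule card_mono[OF M])
        ultimately show ?case by linarith
      qed
    qed
    obtain K where K: "K \<in> kernels pX R" "\<And>i. i \<in> F \<Longrightarrow> (E - \<rho>) - dY i - dX - \<rho> \<le> mutual_info (law_YU (P i) K)"
      using converse[where QY = "\<lambda>i. QY (j i)" and QX = "QX t" and T = T and \<phi> = \<phi> and E = "E - \<rho>",
        OF F(1) marg rateY rateX T R \<tau>0(1) \<eta> \<rho> err \<beta>' rate'] by blast
    have "ereal (E - 2 * \<rho>) \<le> (MIN i\<in>F. ereal (mutual_info (law_YU (P i) K)) + ereal (dY i + dX))"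
      using F K(2) by (subst Min_ge_iff) (auto simp: algebra_simps)
    also have "\<dots> \<le> theta F pX P (\<lambda>i. ereal (dY i + dX)) R"
      unfolding theta_def by (rule SUP_upper) (rule K)
    finally show ?thesis .
  qed
  note * = this
  show ?thesis
  proof (rule ereal_le_epsilon2)
    fix r :: real assume "0 < r"
    then have "ereal (E - 2 * (r / 2)) \<le> theta F pX P (\<lambda>i. ereal (dY i + dX)) R" by (intro *) simp
    then have "ereal (E - 2 * (r / 2)) + ereal r \<le> theta F pX P (\<lambda>i. ereal (dY i + dX)) R + ereal r" by (rule add_right_mono)
    then show "ereal E \<le> theta F pX P (\<lambda>i. ereal (dY i + dX)) R + ereal r" by simp
  qed
qed

text \<open>Erasing \<open>U\<close> with small probability makes the rate constraint strict.\<close>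

lemma kernel_strict_rate:
  fixes pX :: "'x::finite pmf" and P :: "nat \<Rightarrow> ('y::finite \<times> 'x) pmf"
  assumes K: "K \<in> kernels pX R" and R: "0 < R" and F: "finite F"
    and marg: "\<And>i. i \<in> F \<Longrightarrow> map_pmf snd (P i) = pX"
    and a: "\<And>i. i \<in> F \<Longrightarrow> a i < mutual_info (law_YU (P i) K)"
  obtains K' l where "finite (\<Union>x. set_pmf (K' x))" "mutual_info (law_XU pX K') < R" "0 < l"
    "\<And>i. i \<in> F \<Longrightarrow> a i + 2 * l < mutual_info (law_YU (P i) K')"
proof -
  have finK: "finite (\<Union>x. set_pmf (K x))" and KR: "mutual_info (law_XU pX K) \<le> R"
    using K by (auto simp: kernels_def)
  \<comment> \<open>The same \<open>l\<close> is the erasure probability and, doubled, a surplus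
    that later pays for one change of measure in X and one in Y.\<close>
  have "\<forall>\<^sub>F l in at_right 0. \<forall>i\<in>F. 0 < (1 - l) * mutual_info (law_YU (P i) K) - (a i + 2 * l)"
  proof (rule eventually_ball_finite[OF F], rule ballI)
    fix i assume i: "i \<in> F"
    have "((\<lambda>l. (1 - l) * mutual_info (law_YU (P i) K) - (a i + 2 * l)) \<longlongrightarrow>
        (1 - 0) * mutual_info (law_YU (P i) K) - (a i + 2 * 0)) (at_right 0)"
      by (intro tendsto_intros)
    then show "\<forall>\<^sub>F l in at_right 0. 0 < (1 - l) * mutual_info (law_YU (P i) K) - (a i + 2 * l)"
      by (rule order_tendstoD) (use a[OF i] in simp)
  qed
  moreover have "\<forall>\<^sub>F l in at_right (0 :: real). 0 < l \<and> l < 1"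
    by (auto simp: eventually_at_right_field intro: exI[of _ 1])
  ultimately have "\<forall>\<^sub>F l in at_right 0. (\<forall>i\<in>F. 0 < (1 - l) * mutual_info (law_YU (P i) K) - (a i + 2 * l)) \<and> 0 < l \<and> l < 1"
    by (rule eventually_conj)
  then obtain l where l: "\<And>i. i \<in> F \<Longrightarrow> a i + 2 * l < (1 - l) * mutual_info (law_YU (P i) K)" "0 < l" "l < 1"
    by (auto dest!: eventually_happens)
  obtain \<sigma> :: "'x pmf pmf" where \<sigma>: "finite (set_pmf \<sigma>)" "bind_pmf \<sigma> id = pX"
    "mutual_info (law_XU pX K) = infoX pX \<sigma>"
    "\<And>p :: ('y \<times> 'x) pmf. map_pmf snd p = pX \<Longrightarrow>
        mutual_info (law_YU p K) = infoY p \<sigma>"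
    by (rule posterior_law_exists[OF finK]) blast
  obtain \<sigma>' :: "'x pmf pmf" where \<sigma>': "finite (set_pmf \<sigma>')" "bind_pmf \<sigma>' id = pX"
    "infoX pX \<sigma>' = (1 - l) * infoX pX \<sigma>"
    "\<And>p :: ('y \<times> 'x) pmf. map_pmf snd p = pX \<Longrightarrow>
        infoY p \<sigma>' =
        (1 - l) * infoY p \<sigma>"
    by (rule erase_posterior[OF _ _ \<sigma>(1,2), of l]) (use l in auto)
  obtain K' :: "'x \<Rightarrow> nat pmf" where K': "finite (\<Union>x. set_pmf (K' x))"
    "mutual_info (law_XU pX K') = infoX pX \<sigma>'"
    "\<And>p :: ('y \<times> 'x) pmf. map_pmf snd p = pX \<Longrightarrow>
        mutual_info (law_YU p K') = infoY p \<sigma>'"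
    by (rule realize_posterior_law[OF \<sigma>'(1,2)]) blast
  have "(1 - l) * mutual_info (law_XU pX K) \<le> (1 - l) * R" using KR l by (intro mult_left_mono) auto
  also have "\<dots> < R" using R l by (simp add: algebra_simps)
  finally have "mutual_info (law_XU pX K') < R" by (simp add: K'(2) \<sigma>'(3) \<sigma>(3))
  moreover have "a i + 2 * l < mutual_info (law_YU (P i) K')" if "i \<in> F" for i
    using l(1)[OF that] marg[OF that] by (simp add: K'(3) \<sigma>'(4) \<sigma>(4))
  ultimately show ?thesis using that[of K' l] K'(1) l(2) by blast
qed

text \<open>The opposite direction, for achievability: \<open>q\<close> is dominated by
  \<open>k\<close> times \<open>p\<close> on \<open>G\<close>, so the part of \<open>q\<close> on
  \<open>G\<close> lives on the finite support of \<open>p\<close>.\<close>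

lemma change_of_measure_rev:
  assumes fin: "finite (set_pmf p)" and k: "0 \<le> k"
    and G: "\<And>x. x \<in> G \<Longrightarrow> pmf q x \<le> k * pmf p x" and f: "\<And>x. 0 \<le> f x"
  shows "expct q (\<lambda>x. indicator G x * f x) \<le> k * expct p f"
proof -
  have "expct q (\<lambda>x. indicator G x * f x) = (\<Sum>x\<in>set_pmf p. pmf q x * (indicator G x * f x))"
  proof (subst integral_measure_pmf[OF fin])
    fix x assume x: "x \<in> set_pmf q" "indicator G x * f x \<noteq> 0"
    then have "x \<in> G" by (auto simp: indicator_def split: if_splits)
    moreover have "0 < pmf q x" using x by (simp add: pmf_positive)
    ultimately have "pmf p x \<noteq> 0" using G[of x] by auto
    then show "x \<in> set_pmf p" by (simp add: set_pmf_iff)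
  qed simp
  also have "\<dots> \<le> (\<Sum>x\<in>set_pmf p. k * (pmf p x * f x))"
  proof (rule sum_mono)
    fix x
    show "pmf q x * (indicator G x * f x) \<le> k * (pmf p x * f x)"
      using mult_right_mono[OF G f, of x x] f[of x] k by (auto simp: indicator_def mult.assoc)
  qed
  also have "\<dots> = k * expct p f" using fin by (simp add: expct_sum sum_distrib_left)
  finally show ?thesis .
qed

text \<open>
  The sets \<open>C n\<close> contain typical words only, so that they are disjoint for different marginals.
\<close>

lemma component_code:
  fixes pX :: "'x::finite pmf" and P :: "nat \<Rightarrow> ('y::finite \<times> 'x) pmf"
  assumes F: "finite F" "F \<noteq> {}" and marg: "\<And>i. i \<in> F \<Longrightarrow> map_pmf snd (P i) = pX"
    and J: "finite J" and I: "finite I"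
    and rateY: "\<And>i j. i \<in> F \<Longrightarrow> j \<in> J \<Longrightarrow> divergence_rate (map_pmf fst (P i)) (QY j) (DY i j)"
    and rateX: "\<And>t. t \<in> I \<Longrightarrow> divergence_rate pX (QX t) (DX t)"
    and dY: "\<And>i j. i \<in> F \<Longrightarrow> j \<in> J \<Longrightarrow> ereal (dY i) \<le> DY i j"
    and dX: "\<And>t. t \<in> I \<Longrightarrow> ereal dX \<le> DX t"
    and R: "0 < R" and \<delta>: "0 < \<delta>" and v: "ereal v < theta F pX P (\<lambda>i. ereal (dY i + dX)) R"
  shows "\<exists>(err :: nat \<Rightarrow> real) (enc :: nat \<Rightarrow> 'x list \<Rightarrow> nat) (A :: nat \<Rightarrow> nat \<Rightarrow> nat \<Rightarrow> 'y list set) (C :: nat \<Rightarrow> 'x list set).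
    err \<longlonglongrightarrow> 0 \<and> (\<forall>n x. real (enc n x) \<le> exp (real n * R)) \<and>
    (\<forall>n. \<forall>i\<in>F. expct (replicate_pmf n pX)
        (\<lambda>x. indicator (- C n) x + prb (word_chan (P i) x) (- A n i (enc n x))) \<le> err n) \<and>
    (\<forall>n. \<forall>i\<in>F. \<forall>j\<in>J. \<forall>t\<in>I. expct (QX t n) (\<lambda>x. indicator (C n) x * prb (QY j n) (A n i (enc n x))) \<le> exp (- (real n * v))) \<and>
    (\<forall>n. \<forall>x\<in>C n. \<forall>a. \<bar>real (count_list x a) - real n * pmf pX a\<bar> < real n * \<delta>)"
proof -
  obtain K where K: "K \<in> kernels pX R" "ereal v < (MIN i\<in>F. ereal (mutual_info (law_YU (P i) K)) + ereal (dY i + dX))"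
    using v unfolding theta_def less_SUP_iff by blast
  have *: "v - dY i - dX < mutual_info (law_YU (P i) K)" if "i \<in> F" for i
  proof -
    have "ereal v < ereal (mutual_info (law_YU (P i) K)) + ereal (dY i + dX)"
      using K(2) F that by (subst (asm) Min_gr_iff) auto
    then show ?thesis by simp
  qed
  obtain K' l where K': "finite (\<Union>x. set_pmf (K' x))"
    "mutual_info (law_XU pX K') < R" "0 < l"
    "\<And>i. i \<in> F \<Longrightarrow> v - dY i - dX + 2 * l < mutual_info (law_YU (P i) K')"
    using kernel_strict_rate[where P = P and a = "\<lambda>i. v - dY i - dX", OF K(1) R F(1) marg *] by blast
  obtain err :: "nat \<Rightarrow> real" and enc :: "nat \<Rightarrow> 'x list \<Rightarrow> nat" and A :: "nat \<Rightarrow> nat \<Rightarrow> nat \<Rightarrow> 'y list set"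
  where code: "err \<longlonglongrightarrow> 0" "\<And>n x. real (enc n x) \<le> exp (real n * R)"
    "\<And>n i w. i \<in> F \<Longrightarrow> prb (replicate_pmf n (map_pmf fst (P i))) (A n i w) \<le> exp (- (real n * (v - dY i - dX + 2 * l)))"
    "\<And>n i. i \<in> F \<Longrightarrow> expct (replicate_pmf n pX) (\<lambda>x. prb (word_chan (P i) x) (- A n i (enc n x))) \<le> err n"
    using achievability_component[where P = P and e = "\<lambda>i. v - dY i - dX + 2 * l", OF F(1) marg K'(1) R K'(2,4)] by blast
  \<comment> \<open>On the good words no reference law exceeds its nominal exponential rate by more
    than the slack \<open>l\<close>. As \<open>dY i\<close> and \<open>dX\<close> are lower bounds
    for the rates of all reference laws, bad words are rare for all \<open>j\<close> and
    \<open>t\<close> simultaneously.\<close>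
  define GY where "GY = (\<lambda>n i. {y. \<forall>j\<in>J. pmf (QY j n) y \<le> exp (- (real n * (dY i - l))) * pmf (replicate_pmf n (map_pmf fst (P i))) y})"
  define GX where "GX = (\<lambda>n. {x. \<forall>t\<in>I. pmf (QX t n) x \<le> exp (- (real n * (dX - l))) * pmf (replicate_pmf n pX) x})"
  define Typ where "Typ = (\<lambda>n. {x. \<forall>a. \<bar>real (count_list x a) - real n * pmf pX a\<bar> < real n * \<delta>})"
  define A' where "A' = (\<lambda>n i w. A n i w \<inter> GY n i)"
  define C where "C = (\<lambda>n. GX n \<inter> Typ n)"
  define V where "V = (\<lambda>i x. word_chan (P i) x)"
  define eY where "eY = (\<lambda>n. \<Sum>i\<in>F. \<Sum>j\<in>J. prb (replicate_pmf n (map_pmf fst (P i)))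
    (heavy n (dY i - l) (map_pmf fst (P i)) (QY j n)))"
  define eX where "eX = (\<lambda>n. \<Sum>t\<in>I. prb (replicate_pmf n pX)
    (heavy n (dX - l) pX (QX t n)))"
  have eY_lim: "eY \<longlonglongrightarrow> 0"
  proof -
    have "eY \<longlonglongrightarrow> (\<Sum>i\<in>F. \<Sum>j\<in>J. 0)"
      unfolding eY_def
    proof (intro tendsto_sum)
      fix i j assume ij: "i \<in> F" "j \<in> J"
      have "ereal (dY i - l) < ereal (dY i)" using K'(3) by simp
      then have "ereal (dY i - l) < DY i j" using dY[OF ij] by (rule less_le_trans)
      then show "(\<lambda>n. prb (replicate_pmf n (map_pmf fst (P i)))
        (heavy n (dY i - l) (map_pmf fst (P i)) (QY j n))) \<longlonglongrightarrow> 0"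
        using rateY[OF ij] by (simp only: divergence_rate_def)
    qed
    then show ?thesis by simp
  qed
  have eX_lim: "eX \<longlonglongrightarrow> 0"
  proof -
    have "eX \<longlonglongrightarrow> (\<Sum>t\<in>I. 0)"
      unfolding eX_def
    proof (intro tendsto_sum)
      fix t assume t: "t \<in> I"
      have "ereal (dX - l) < ereal dX" using K'(3) by simp
      then have "ereal (dX - l) < DX t" using dX[OF t] by (rule less_le_trans)
      then show "(\<lambda>n. prb (replicate_pmf n pX)
        (heavy n (dX - l) pX (QX t n))) \<longlonglongrightarrow> 0"
        using rateX[OF t] by (simp only: divergence_rate_def)
    qed
    then show ?thesis by simp
  qed
  define eT where "eT = (\<lambda>n. prb (replicate_pmf n pX) (- Typ n))"
  have eT_lim: "eT \<longlonglongrightarrow> 0"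
    using strong_typicality[OF \<delta>, of pX] by (simp add: eT_def Typ_def Compl_eq)
  have PGY: "prb (replicate_pmf n (map_pmf fst (P i))) (- GY n i) \<le> eY n" if i: "i \<in> F" for n i
  proof -
    have "- GY n i = (\<Union>j\<in>J. (heavy n (dY i - l) (map_pmf fst (P i)) (QY j n)))"
      by (auto simp: GY_def)
    then have "prb (replicate_pmf n (map_pmf fst (P i))) (- GY n i) \<le> (\<Sum>j\<in>J. prb (replicate_pmf n (map_pmf fst (P i)))
        (heavy n (dY i - l) (map_pmf fst (P i)) (QY j n)))"
      by (simp only:) (rule measure_pmf.finite_measure_subadditive_finite, use J in auto)
    also have "\<dots> \<le> eY n"
      unfolding eY_def using F i by (intro member_le_sum) (auto intro: sum_nonneg)
    finally show ?thesis .
  qed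
  have PGX: "prb (replicate_pmf n pX) (- GX n) \<le> eX n" for n
  proof -
    have "- GX n = (\<Union>t\<in>I. (heavy n (dX - l) pX (QX t n)))"
      by (auto simp: GX_def)
    then show ?thesis unfolding eX_def
      by (simp only:) (rule measure_pmf.finite_measure_subadditive_finite, use I in auto)
  qed
  show ?thesis
  proof (rule exI[of _ "\<lambda>n. (eX n + eT n) + (err n + eY n)"], rule exI[of _ enc], rule exI[of _ A'], rule exI[of _ C],
      intro conjI allI ballI)
    have "(\<lambda>n. (eX n + eT n) + (err n + eY n)) \<longlonglongrightarrow> (0 + 0) + (0 + 0)"
      by (intro tendsto_add eX_lim eT_lim eY_lim code(1))
    then show "(\<lambda>n. (eX n + eT n) + (err n + eY n)) \<longlonglongrightarrow> 0" by simp
    show "real (enc n x) \<le> exp (real n * R)" for n x by (rule code)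
    show "\<bar>real (count_list x a) - real n * pmf pX a\<bar> < real n * \<delta>" if "x \<in> C n" for n x a
      using that by (auto simp: C_def Typ_def)
  next
    fix n i assume i: "i \<in> F"
    have V_chan: "bind_pmf (replicate_pmf n pX) (V i) = replicate_pmf n (map_pmf fst (P i))"
      unfolding V_def bind_replicate_pmf_prod_pmfs using bind_chan[of "P i"] marg[OF i] by simp
    have "expct (replicate_pmf n pX) (\<lambda>x. indicator (- C n) x + prb (V i x) (- A' n i (enc n x))) \<le>
      expct (replicate_pmf n pX) (\<lambda>x. indicator (- C n) x + (prb (V i x) (- A n i (enc n x)) + prb (V i x) (- GY n i)))"
    proof (rule expct_mono)
      fix x
      have "- A' n i (enc n x) = - A n i (enc n x) \<union> - GY n i" by (auto simp: A'_def)
      then show "indicator (- C n) x + prb (V i x) (- A' n i (enc n x)) \<le>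
          indicator (- C n) x + (prb (V i x) (- A n i (enc n x)) + prb (V i x) (- GY n i))"
        using prb_Un_le[of "V i x" "- A n i (enc n x)" "- GY n i"] by simp
    qed simp
    also have "\<dots> = prb (replicate_pmf n pX) (- C n) + (expct (replicate_pmf n pX) (\<lambda>x. prb (V i x) (- A n i (enc n x))) +
        expct (replicate_pmf n pX) (\<lambda>x. prb (V i x) (- GY n i)))"
      by (simp add: expct_add)
    also have "expct (replicate_pmf n pX) (\<lambda>x. prb (V i x) (- GY n i)) = prb (bind_pmf (replicate_pmf n pX) (V i)) (- GY n i)"
      by (rule prb_bind[symmetric]) (auto simp: V_def)
    also have "\<dots> \<le> eY n" unfolding V_chan by (rule PGY[OF i])
    also have "expct (replicate_pmf n pX) (\<lambda>x. prb (V i x) (- A n i (enc n x))) \<le> err n"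
      unfolding V_def by (rule code(4)[OF i])
    also have "prb (replicate_pmf n pX) (- C n) \<le> eX n + eT n"
    proof -
      have "- C n = - GX n \<union> - Typ n" by (auto simp: C_def)
      then show ?thesis
        using prb_Un_le[of "replicate_pmf n pX" "- GX n" "- Typ n"] PGX[of n] by (simp add: eT_def)
    qed
    finally show "expct (replicate_pmf n pX) (\<lambda>x. indicator (- C n) x + prb (word_chan (P i) x) (- A' n i (enc n x)))
        \<le> (eX n + eT n) + (err n + eY n)" by (simp add: V_def)
  next
    fix n i j t assume i: "i \<in> F" and j: "j \<in> J" and t: "t \<in> I"
    let ?pY = "replicate_pmf n (map_pmf fst (P i))"
    define e where "e = exp (- (real n * (dY i - l))) * exp (- (real n * (v - dY i - dX + 2 * l)))"
    have QY_A: "prb (QY j n) (A' n i w) \<le> e" for w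
    proof -
      have "prb (QY j n) (A' n i w) = expct (QY j n) (indicator (A' n i w))" by simp
      also have "\<dots> = expct (QY j n) (\<lambda>y. indicator (GY n i) y * indicator (A n i w) y)"
        by (intro expct_cong refl) (auto simp: A'_def indicator_def)
      also have "\<dots> \<le> exp (- (real n * (dY i - l))) * expct ?pY (indicator (A n i w))"
        by (rule change_of_measure_rev) (use j in \<open>auto simp: GY_def\<close>)
      also have "\<dots> \<le> e" unfolding e_def using code(3)[OF i] by (intro mult_left_mono) auto
      finally show ?thesis .
    qed
    have "expct (QX t n) (\<lambda>x. indicator (C n) x * prb (QY j n) (A' n i (enc n x))) \<le>
      exp (- (real n * (dX - l))) * expct (replicate_pmf n pX) (\<lambda>x. prb (QY j n) (A' n i (enc n x)))"
      by (rule change_of_measure_rev) (use t in \<open>auto simp: C_def GX_def\<close>)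
    also have "\<dots> \<le> exp (- (real n * (dX - l))) * e"
      by (intro mult_left_mono expct_const_le QY_A) auto
    \<comment> \<open>The two losses \<open>l\<close> use up the surplus \<open>2 * l\<close> of the
      code, and exactly \<open>v\<close> remains.\<close>
    also have "\<dots> = exp (- (real n * v))"
      unfolding e_def exp_add[symmetric] by (simp add: algebra_simps)
    finally show "expct (QX t n) (\<lambda>x. indicator (C n) x * prb (QY j n) (A' n i (enc n x))) \<le> exp (- (real n * v))" .
  qed
qed

section \<open>Combining the codes of different marginals\<close>

lemma distinct_pmfs_separated:
  fixes PX :: "nat \<Rightarrow> 'x::finite pmf"
  assumes "inj_on PX S" "finite S"
  obtains \<delta> where "0 < \<delta>"
    "\<And>s s'. s \<in> S \<Longrightarrow> s' \<in> S \<Longrightarrow> s \<noteq> s' \<Longrightarrow> \<exists>a. 2 * \<delta> \<le> \<bar>pmf (PX s) a - pmf (PX s') a\<bar>"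
proof -
  \<comment> \<open>Zero distances, from equal indices or from letters on which two marginals agree,
    are removed; the inserted 1 keeps the minimum defined if nothing is left.\<close>
  define D where "D = (\<lambda>(s, s', a). \<bar>pmf (PX s) a - pmf (PX s') a\<bar>) ` (S \<times> S \<times> UNIV) - {0}"
  have fin: "finite (insert 1 D)" using assms(2) by (auto simp: D_def)
  show ?thesis
  proof (rule that[of "Min (insert 1 D) / 2"])
    have "\<forall>d\<in>insert 1 D. 0 < d" by (auto simp: D_def)
    then show "0 < Min (insert 1 D) / 2" using fin by (simp add: Min_gr_iff)
    fix s s' assume s: "s \<in> S" "s' \<in> S" "s \<noteq> s'"
    then have "PX s \<noteq> PX s'" using assms(1) by (auto simp: inj_on_def)
    then obtain a where a: "pmf (PX s) a \<noteq> pmf (PX s') a" by (auto intro: pmf_eqI)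
    then have "\<bar>pmf (PX s) a - pmf (PX s') a\<bar> \<in> D" using s by (auto simp: D_def intro!: rev_image_eqI[of "(s, s', a)"])
    then have "Min (insert 1 D) \<le> \<bar>pmf (PX s) a - pmf (PX s') a\<bar>" using fin by (intro Min_le) auto
    then show "\<exists>a. 2 * (Min (insert 1 D) / 2) \<le> \<bar>pmf (PX s) a - pmf (PX s') a\<bar>" by auto
  qed
qed

text \<open>A message is a class \<open>s\<close> together with a codeword index of the code for
  that class. The type I error is governed by the component that produced the data, while type II
  errors add up over finitely many classes and components. This union, like the announcement of the
  class, costs only a constant factor, which no exponential rate sees.\<close>

lemma achievable_below_theta:
  fixes P :: "nat \<Rightarrow> ('y::finite \<times> 'x::finite) pmf" and PX :: "nat \<Rightarrow> 'x pmf"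
    and F :: "nat \<Rightarrow> nat set"
  assumes F: "\<And>s. s \<in> {1..N} \<Longrightarrow> finite (F s)" "\<And>s. s \<in> {1..N} \<Longrightarrow> F s \<noteq> {}"
    and cover: "\<And>i. i \<in> set_pmf \<nu> \<Longrightarrow> \<exists>s\<in>{1..N}. i \<in> F s"
    and dist: "inj_on PX {1..N}"
    and fin: "finite (set_pmf \<nu>)" "finite J" "finite I" and \<tau>: "set_pmf \<tau> \<subseteq> J \<times> I"
    and marg: "\<And>s i. s \<in> {1..N} \<Longrightarrow> i \<in> F s \<Longrightarrow> map_pmf snd (P i) = PX s"
    and rateY: "\<And>s i j. s \<in> {1..N} \<Longrightarrow> i \<in> F s \<Longrightarrow> j \<in> J \<Longrightarrow> divergence_rate (map_pmf fst (P i)) (QY j) (DY i j)"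
    and rateX: "\<And>s t. s \<in> {1..N} \<Longrightarrow> t \<in> I \<Longrightarrow> divergence_rate (PX s) (QX t) (DX s t)"
    and dY: "\<And>s i j. s \<in> {1..N} \<Longrightarrow> i \<in> F s \<Longrightarrow> j \<in> J \<Longrightarrow> ereal (dY i) \<le> DY i j"
    and dX: "\<And>s t. s \<in> {1..N} \<Longrightarrow> t \<in> I \<Longrightarrow> ereal (dX s) \<le> DX s t"
    and \<epsilon>: "0 \<le> \<epsilon>" and R: "0 < R"
    and v: "\<And>s. s \<in> {1..N} \<Longrightarrow> ereal v < theta (F s) (PX s) P (\<lambda>i. ereal (dY i + dX s)) R"
  shows "achievable (\<lambda>n. bind_pmf \<nu> (\<lambda>i. iid_pair n (P i)))
      (\<lambda>n. bind_pmf \<tau> (\<lambda>(j, t). pair_pmf (QY j n) (QX t n))) \<epsilon> R v"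
proof -
  obtain \<delta> where \<delta>: "0 < \<delta>"
    "\<And>s s'. s \<in> {1..N} \<Longrightarrow> s' \<in> {1..N} \<Longrightarrow> s \<noteq> s' \<Longrightarrow> \<exists>a. 2 * \<delta> \<le> \<bar>pmf (PX s) a - pmf (PX s') a\<bar>"
    using distinct_pmfs_separated[OF dist] by blast
  define \<Phi> where "\<Phi> = (\<lambda>s (err :: nat \<Rightarrow> real) (enc :: nat \<Rightarrow> 'x list \<Rightarrow> nat) (A :: nat \<Rightarrow> nat \<Rightarrow> nat \<Rightarrow> 'y list set) (C :: nat \<Rightarrow> 'x list set).
    err \<longlonglongrightarrow> 0 \<and> (\<forall>n x. real (enc n x) \<le> exp (real n * R)) \<and>
    (\<forall>n. \<forall>i\<in>F s. expct (replicate_pmf n (PX s))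
        (\<lambda>x. indicator (- C n) x + prb (word_chan (P i) x) (- A n i (enc n x))) \<le> err n) \<and>
    (\<forall>n. \<forall>i\<in>F s. \<forall>j\<in>J. \<forall>t\<in>I. expct (QX t n) (\<lambda>x. indicator (C n) x * prb (QY j n) (A n i (enc n x))) \<le> exp (- (real n * v))) \<and>
    (\<forall>n. \<forall>x\<in>C n. \<forall>a. \<bar>real (count_list x a) - real n * pmf (PX s) a\<bar> < real n * \<delta>))"
  have "\<forall>s\<in>{1..N}. \<exists>err enc A C. \<Phi> s err enc A C"
  proof
    fix s assume s: "s \<in> {1..N}"
    show "\<exists>err enc A C. \<Phi> s err enc A C" unfolding \<Phi>_def
      by (rule component_code[where QY = QY and DY = DY and QX = QX and DX = "DX s" and dY = dY and dX = "dX s"])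
        (use F marg rateY rateX dY dX R \<delta>(1) v fin s in auto)
  qed
  then obtain err enc A C where codes: "\<forall>s\<in>{1..N}. \<Phi> s (err s) (enc s) (A s) (C s)"
    unfolding bchoice_iff by blast
  have err: "err s \<longlonglongrightarrow> 0" and enc: "real (enc s n x) \<le> exp (real n * R)"
    and typeI: "i \<in> F s \<Longrightarrow> expct (replicate_pmf n (PX s))
        (\<lambda>x. indicator (- C s n) x + prb (word_chan (P i) x) (- A s n i (enc s n x))) \<le> err s n"
    and typeII: "i \<in> F s \<Longrightarrow> j \<in> J \<Longrightarrow> t \<in> I \<Longrightarrow>
        expct (QX t n) (\<lambda>x. indicator (C s n) x * prb (QY j n) (A s n i (enc s n x))) \<le> exp (- (real n * v))"
    and C_typical: "x \<in> C s n \<Longrightarrow> \<bar>real (count_list x a) - real n * pmf (PX s) a\<bar> < real n * \<delta>"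
    if "s \<in> {1..N}" for s n x i j t a
    using codes that unfolding \<Phi>_def by blast+
  \<comment> \<open>Letter frequencies cannot be within \<delta> of two marginals that are 2
    \<delta> apart at some letter.\<close>
  have disj: "s = s'" if ss: "s \<in> {1..N}" "s' \<in> {1..N}" "x \<in> C s n" "x \<in> C s' n" for s s' x n
  proof (rule ccontr)
    assume "s \<noteq> s'"
    then obtain a where a: "2 * \<delta> \<le> \<bar>pmf (PX s) a - pmf (PX s') a\<bar>" using \<delta>(2)[OF ss(1,2)] by blast
    have "real n * (2 * \<delta>) \<le> real n * \<bar>pmf (PX s) a - pmf (PX s') a\<bar>" using a by (intro mult_left_mono) auto
    also have "\<dots> = \<bar>real n * pmf (PX s) a - real n * pmf (PX s') a\<bar>"
      by (simp add: abs_mult right_diff_distrib[symmetric])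
    also have "\<dots> < real n * \<delta> + real n * \<delta>"
      using C_typical[OF ss(1,3), of a] C_typical[OF ss(2,4), of a] by linarith
    finally show False by simp
  qed
  \<comment> \<open>Words outside all sets \<open>C s n\<close> are sent as class 0; as 0 is not in
    \<open>{1..N}\<close>, the decoder always rejects them.\<close>
  define \<phi> where "\<phi> = (\<lambda>n x. if \<exists>s\<in>{1..N}. x \<in> C s n
      then prod_encode ((SOME s. s \<in> {1..N} \<and> x \<in> C s n), enc (SOME s. s \<in> {1..N} \<and> x \<in> C s n) n x)
      else prod_encode (0, 0))"
  have \<phi>_in: "\<phi> n x = prod_encode (s, enc s n x)" if "s \<in> {1..N}" "x \<in> C s n" for s n x
  proof -
    have "(SOME s. s \<in> {1..N} \<and> x \<in> C s n) = s"
      using that disj by (intro some_equality) blast+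
    then show ?thesis using that by (auto simp: \<phi>_def)
  qed
  have \<phi>_out: "\<phi> n x = prod_encode (0, 0)" if "\<not> (\<exists>s\<in>{1..N}. x \<in> C s n)" for n x
    using that by (simp only: \<phi>_def if_False)
  define \<psi> :: "nat \<Rightarrow> 'y decision_map" where "\<psi> = (\<lambda>n (y, w). case prod_decode w of (s, w') \<Rightarrow>
      if s \<in> {1..N} \<and> (\<exists>i\<in>F s. y \<in> A s n i w') then return_pmf H0 else return_pmf H1)"
  define T where "T = (\<lambda>n z. pmf (\<psi> n z) H0)"
  have T_code: "T n (y, prod_encode (s, w)) = (if s \<in> {1..N} \<and> (\<exists>i\<in>F s. y \<in> A s n i w) then 1 else 0)" for n y s w
    by (auto simp: T_def \<psi>_def)
  have T01: "0 \<le> T n z" "T n z \<le> 1" for n z by (auto simp: T_def pmf_le_1)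
  define p where "p = (\<lambda>n. bind_pmf \<nu> (\<lambda>i. iid_pair n (P i)))"
  define q where "q = (\<lambda>n. bind_pmf \<tau> (\<lambda>(j, t). pair_pmf (QY j n) (QX t n)))"
  have errI: "1 - accept_prob (compressed (\<phi> n) (iid_pair n (P i))) (\<psi> n) \<le> err s n"
    if s: "s \<in> {1..N}" and i: "i \<in> F s" for s i n
  proof -
    define V where "V = (\<lambda>x. word_chan (P i) x)"
    have "1 - accept_prob (compressed (\<phi> n) (iid_pair n (P i))) (\<psi> n) =
      expct (replicate_pmf n (PX s)) (\<lambda>x. 1 - expct (V x) (\<lambda>y. T n (y, \<phi> n x)))"
      by (simp add: accept_prob_iid_pair[OF marg[OF s i]] expct_diff V_def T_def)
    also have "\<dots> \<le> expct (replicate_pmf n (PX s)) (\<lambda>x. indicator (- C s n) x + prb (V x) (- A s n i (enc s n x)))"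
    proof (rule expct_mono)
      fix x
      show "1 - expct (V x) (\<lambda>y. T n (y, \<phi> n x)) \<le> indicator (- C s n) x + prb (V x) (- A s n i (enc s n x))"
      proof (cases "x \<in> C s n")
        case True
        have "prb (V x) (A s n i (enc s n x)) = expct (V x) (indicator (A s n i (enc s n x)))" by simp
        also have "\<dots> \<le> expct (V x) (\<lambda>y. T n (y, \<phi> n x))"
        proof (rule expct_mono)
          fix y
          show "indicator (A s n i (enc s n x)) y \<le> T n (y, \<phi> n x)"
            using s i by (auto simp: \<phi>_in[OF s True] T_code indicator_def)
        qed (simp add: V_def)
        finally show ?thesis using True by (simp add: prb_compl)
      next
        case False
        have "0 \<le> expct (V x) (\<lambda>y. T n (y, \<phi> n x))" by (rule expct_nonneg) (rule T01)
        then show ?thesis using False by (simp add: add_increasing2)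
      qed
    qed simp
    also have "\<dots> \<le> err s n" unfolding V_def by (rule typeI[OF s i])
    finally show ?thesis .
  qed
  define e where "e = (\<lambda>n. \<Sum>s\<in>{1..N}. \<bar>err s n\<bar>)"
  have e_lim: "e \<longlonglongrightarrow> 0"
  proof -
    have "e \<longlonglongrightarrow> (\<Sum>s\<in>{1..N}. \<bar>0\<bar>)" unfolding e_def by (intro tendsto_sum tendsto_rabs err)
    then show ?thesis by simp
  qed
  have typeI_le: "type_I_error (p n) (\<phi> n) (\<psi> n) \<le> e n" for n
  proof -
    have "type_I_error (p n) (\<phi> n) (\<psi> n) = expct \<nu> (\<lambda>i. 1 - accept_prob (compressed (\<phi> n) (iid_pair n (P i))) (\<psi> n))"
      unfolding type_I_error_def p_def accept_prob_mixture using fin by (simp add: expct_diff)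
    also have "\<dots> \<le> e n"
    proof (rule expct_const_le[OF fin(1)])
      fix i assume "i \<in> set_pmf \<nu>"
      then obtain s where s: "s \<in> {1..N}" "i \<in> F s" using cover by blast
      have "1 - accept_prob (compressed (\<phi> n) (iid_pair n (P i))) (\<psi> n) \<le> err s n" by (rule errI[OF s])
      also have "\<dots> \<le> \<bar>err s n\<bar>" by simp
      also have "\<dots> \<le> e n" unfolding e_def using s by (intro member_le_sum) auto
      finally show "1 - accept_prob (compressed (\<phi> n) (iid_pair n (P i))) (\<psi> n) \<le> e n" .
    qed
    finally show ?thesis .
  qed
  \<comment> \<open>The number of terms in the union bound over classes and their components; the
    added 1 keeps \<open>c\<close> positive for the logarithm.\<close>
  define c where "c = real (\<Sum>s\<in>{1..N}. card (F s)) + 1"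
  have c1: "1 \<le> c" unfolding c_def by (simp add: sum_nonneg)
  have typeII_le: "type_II_error (q n) (\<phi> n) (\<psi> n) \<le> c * exp (- (real n * v))" for n
  proof -
    have "type_II_error (q n) (\<phi> n) (\<psi> n) = expct \<tau> (\<lambda>(j, t). expct (QX t n) (\<lambda>x. expct (QY j n) (\<lambda>y. T n (y, \<phi> n x))))"
      unfolding type_II_error_def q_def accept_prob_mixture T_def
      by (intro expct_cong refl) (auto simp: accept_prob_pair)
    also have "\<dots> \<le> c * exp (- (real n * v))"
    proof (rule expct_const_le)
      show "finite (set_pmf \<tau>)" using \<tau> fin(2,3) by (meson finite_SigmaI finite_subset)
      fix z assume "z \<in> set_pmf \<tau>"
      then obtain j t where z: "z = (j, t)" "j \<in> J" "t \<in> I" using \<tau> by auto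
      let ?h = "\<lambda>s i x. indicator (C s n) x * prb (QY j n) (A s n i (enc s n x))"
      have int: "integrable (measure_pmf (QX t n)) (?h s i)" for s i
        by (rule measure_pmf.integrable_const_bound[where B = 1]) (auto simp: indicator_def)
      have "expct (QX t n) (\<lambda>x. expct (QY j n) (\<lambda>y. T n (y, \<phi> n x))) \<le>
        expct (QX t n) (\<lambda>x. \<Sum>s\<in>{1..N}. \<Sum>i\<in>F s. ?h s i x)"
      proof (rule integral_mono')
        show "integrable (measure_pmf (QX t n)) (\<lambda>x. \<Sum>s\<in>{1..N}. \<Sum>i\<in>F s. ?h s i x)"
          by (intro Bochner_Integration.integrable_sum int)
        fix x
        have h0: "0 \<le> (\<Sum>i\<in>F s. ?h s i x)" for s by (intro sum_nonneg) auto
        show "0 \<le> (\<Sum>s\<in>{1..N}. \<Sum>i\<in>F s. ?h s i x)" by (intro sum_nonneg) auto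
        show "expct (QY j n) (\<lambda>y. T n (y, \<phi> n x)) \<le> (\<Sum>s\<in>{1..N}. \<Sum>i\<in>F s. ?h s i x)"
        proof (cases "\<exists>s\<in>{1..N}. x \<in> C s n")
          case True
          then obtain s where s: "s \<in> {1..N}" "x \<in> C s n" by blast
          have "expct (QY j n) (\<lambda>y. T n (y, \<phi> n x)) = expct (QY j n) (indicator (\<Union>i\<in>F s. A s n i (enc s n x)))"
            using s(1) by (intro expct_cong refl) (auto simp: \<phi>_in[OF s] T_code indicator_def)
          also have "\<dots> = prb (QY j n) (\<Union>i\<in>F s. A s n i (enc s n x))" by simp
          also have "\<dots> \<le> (\<Sum>i\<in>F s. prb (QY j n) (A s n i (enc s n x)))"
            by (rule measure_pmf.finite_measure_subadditive_finite) (use F s in auto)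
          also have "\<dots> = (\<Sum>i\<in>F s. ?h s i x)" using s by simp
          also have "\<dots> \<le> (\<Sum>s\<in>{1..N}. \<Sum>i\<in>F s. ?h s i x)"
            using s(1) h0 by (intro member_le_sum) auto
          finally show ?thesis .
        next
          case False
          have "expct (QY j n) (\<lambda>y. T n (y, \<phi> n x)) = 0" by (simp add: \<phi>_out[OF False] T_code)
          then show ?thesis using h0 by (simp add: sum_nonneg)
        qed
      qed
      also have "\<dots> = (\<Sum>s\<in>{1..N}. \<Sum>i\<in>F s. expct (QX t n) (?h s i))"
        using int by (simp add: Bochner_Integration.integral_sum Bochner_Integration.integrable_sum)
      also have "\<dots> \<le> (\<Sum>s\<in>{1..N}. \<Sum>i\<in>F s. exp (- (real n * v)))"
        using z by (intro sum_mono typeII) auto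
      also have "\<dots> = real (\<Sum>s\<in>{1..N}. card (F s)) * exp (- (real n * v))"
        by (simp add: sum_distrib_right)
      also have "\<dots> \<le> c * exp (- (real n * v))" by (intro mult_right_mono) (auto simp: c_def)
      finally show "(case z of (j, t) \<Rightarrow> expct (QX t n) (\<lambda>x. expct (QY j n) (\<lambda>y. T n (y, \<phi> n x)))) \<le> c * exp (- (real n * v))"
        by (simp add: z)
    qed
    finally show ?thesis .
  qed
  define M where "M = (\<lambda>n. \<phi> n ` {x. length x = n})"
  have finM: "finite (M n)" for n unfolding M_def
    using finite_lists_length_eq[of "UNIV :: 'x set" n] by simp
  \<comment> \<open>There is one message for rejection and at most exp (n R) + 1 indices per class;
    with 1 \<le> exp (n R) this is at most \<open>b\<close> times exp (n R).\<close>
  define b where "b = real N * 2 + 1"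
  have cardM: "real (card (M n)) \<le> b * exp (real n * R)" for n
  proof -
    define m where "m = nat \<lfloor>exp (real n * R)\<rfloor>"
    have m: "real m \<le> exp (real n * R)" unfolding m_def using exp_gt_zero[of "real n * R"] by linarith
    have "M n \<subseteq> insert (prod_encode (0, 0)) (prod_encode ` ({1..N} \<times> {0..m}))"
    proof
      fix w assume "w \<in> M n"
      then obtain x where x: "w = \<phi> n x" by (auto simp: M_def)
      show "w \<in> insert (prod_encode (0, 0)) (prod_encode ` ({1..N} \<times> {0..m}))"
      proof (cases "\<exists>s\<in>{1..N}. x \<in> C s n")
        case True
        then obtain s where s: "s \<in> {1..N}" "x \<in> C s n" by blast
        have "enc s n x \<le> m" using enc[OF s(1), of n x] unfolding m_def by (simp add: le_nat_floor)
        then show ?thesis using s(1) by (auto simp: x \<phi>_in[OF s])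
      qed (simp add: x \<phi>_out)
    qed
    then have "card (M n) \<le> card (insert (prod_encode (0, 0)) (prod_encode ` ({1..N} \<times> {0..m})))"
      by (intro card_mono) auto
    also have "\<dots> \<le> Suc (card (prod_encode ` ({1..N} \<times> {0..m})))" by (rule card_insert_le_m1) auto
    also have "card (prod_encode ` ({1..N} \<times> {0..m})) \<le> card ({1..N} \<times> {0..m})" by (rule card_image_le) simp
    finally have "real (card (M n)) \<le> 1 + real N * (real m + 1)" by (simp add: card_cartesian_product algebra_simps flip: of_nat_mult of_nat_add)
    also have "\<dots> \<le> exp (real n * R) + real N * (exp (real n * R) + exp (real n * R))"
    proof -
      have "1 \<le> exp (real n * R)" using R by simp
      then show ?thesis using m by (intro add_mono mult_left_mono) auto
    qed
    also have "\<dots> = b * exp (real n * R)" by (simp add: b_def algebra_simps)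
    finally show ?thesis .
  qed
  show ?thesis
    unfolding achievable_def p_def[symmetric] q_def[symmetric]
  proof (intro exI[of _ M] exI[of _ \<phi>] exI[of _ \<psi>] conjI allI)
    show "finite (M n)" "\<phi> n ` {x. length x = n} \<subseteq> M n" for n
      by (rule finM) (simp add: M_def)
    have "limsup (\<lambda>n. ereal (type_I_error (p n) (\<phi> n) (\<psi> n))) \<le> limsup (\<lambda>n. ereal (e n))"
      by (rule Limsup_mono) (simp add: typeI_le)
    also have "\<dots> = ereal 0" by (rule lim_imp_Limsup) (use e_lim in auto)
    also have "\<dots> \<le> ereal \<epsilon>" using \<epsilon> by simp
    finally show "limsup (\<lambda>n. ereal (type_I_error (p n) (\<phi> n) (\<psi> n))) \<le> ereal \<epsilon>" .
    have "(\<lambda>n. v - ln c / real n) \<longlonglongrightarrow> v" by real_asymp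
    then have "ereal v = liminf (\<lambda>n. ereal (v - ln c / real n))"
      by (intro lim_imp_Liminf[symmetric]) auto
    also have "\<dots> \<le> liminf (\<lambda>n. exponent n (type_II_error (q n) (\<phi> n) (\<psi> n)))"
    proof (rule Liminf_mono)
      show "\<forall>\<^sub>F n in sequentially. ereal (v - ln c / real n) \<le> exponent n (type_II_error (q n) (\<phi> n) (\<psi> n))"
        using eventually_gt_at_top[of 0]
      proof eventually_elim
        case (elim n)
        define \<beta> where "\<beta> = type_II_error (q n) (\<phi> n) (\<psi> n)"
        show ?case
        proof (cases "\<beta> = 0")
          case False
          then have pos: "0 < \<beta>" by (simp add: \<beta>_def type_II_error_def accept_prob_unit less_le)
          have "ln \<beta> \<le> ln (c * exp (- (real n * v)))" using pos typeII_le[of n] by (intro ln_mono) (auto simp: \<beta>_def)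
          also have "\<dots> = ln c - real n * v" using c1 by (simp add: ln_mult_pos)
          finally have "(real n * v - ln c) / real n \<le> (- ln \<beta>) / real n"
            by (intro divide_right_mono) auto
          then have "v - ln c / real n \<le> 1 / real n * ln (1 / \<beta>)"
            using elim pos by (simp add: ln_div diff_divide_distrib)
          then show ?thesis using False by (simp add: exponent_def \<beta>_def)
        qed (simp add: exponent_def \<beta>_def)
      qed
    qed
    finally show "ereal v \<le> liminf (\<lambda>n. exponent n (type_II_error (q n) (\<phi> n) (\<psi> n)))" .
    have b1: "1 \<le> b" by (simp add: b_def)
    have "limsup (\<lambda>n. ereal (1 / real n * ln (real (card (M n))))) \<le> limsup (\<lambda>n. ereal (ln b / real n + R))"
    proof (rule Limsup_mono)
      show "\<forall>\<^sub>F n in sequentially. ereal (1 / real n * ln (real (card (M n)))) \<le> ereal (ln b / real n + R)"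
        using eventually_gt_at_top[of 0]
      proof eventually_elim
        case (elim n)
        have "replicate n undefined \<in> {x :: 'x list. length x = n}" by simp
        then have "M n \<noteq> {}" unfolding M_def by blast
        then have "0 < real (card (M n))" using finM by (simp add: card_gt_0_iff)
        then have "ln (real (card (M n))) \<le> ln (b * exp (real n * R))" using cardM[of n] by (intro ln_mono) auto
        also have "\<dots> = ln b + real n * R" using b1 by (simp add: ln_mult_pos)
        finally show ?case using elim by (simp add: field_simps)
      qed
    qed
    also have "\<dots> = ereal R"
    proof (rule lim_imp_Limsup)
      have "(\<lambda>n. ln b / real n + R) \<longlonglongrightarrow> R" by real_asymp
      then show "(\<lambda>n. ereal (ln b / real n + R)) \<longlonglongrightarrow> ereal R" by simp
    qed simp
    finally show "limsup (\<lambda>n. ereal (1 / real n * ln (real (card (M n))))) \<le> ereal R" .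
  qed
qed

section \<open>Minimizing reference laws and the final assembly\<close>

lemma first_argmin:
  fixes f :: "nat \<Rightarrow> 'a::linorder"
  assumes "finite J" "J \<noteq> {}"
  shows "first_argmin J f \<in> J" "\<And>j. j \<in> J \<Longrightarrow> f (first_argmin J f) \<le> f j"
proof -
  have "Min (f ` J) \<in> f ` J" using assms by (intro Min_in) auto
  then obtain j where "j \<in> J" "f j = Min (f ` J)" by auto
  then have "j \<in> J \<and> (\<forall>j'\<in>J. f j \<le> f j')" using assms by simp
  from LeastI[of "\<lambda>j. j \<in> J \<and> (\<forall>j'\<in>J. f j \<le> f j')", OF this]
  show "first_argmin J f \<in> J" "\<And>j. j \<in> J \<Longrightarrow> f (first_argmin J f) \<le> f j"
    unfolding first_argmin_def by auto
qed

lemma first_argmin_real: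
  fixes f :: "nat \<Rightarrow> ereal"
  assumes J: "finite J" "J \<noteq> {}" and lt: "(MIN j\<in>J. f j) < \<infinity>" and ge: "\<And>j. j \<in> J \<Longrightarrow> f j \<noteq> -\<infinity>"
  shows "f (first_argmin J f) = ereal (real_of_ereal (f (first_argmin J f)))"
proof -
  have "f (first_argmin J f) \<le> (MIN j\<in>J. f j)"
    using J first_argmin(2)[OF J] by (subst Min_ge_iff) auto
  then have "f (first_argmin J f) \<noteq> \<infinity>" using lt by auto
  moreover have "f (first_argmin J f) \<noteq> -\<infinity>" by (rule ge[OF first_argmin(1)[OF J]])
  ultimately show ?thesis by (cases "f (first_argmin J f)") simp_all
qed

lemma theta_cong:
  "(\<And>i. i \<in> F \<Longrightarrow> d i = d' i) \<Longrightarrow> theta F pX P d R = theta F pX P d' R"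
  unfolding theta_def by (intro SUP_cong refl arg_cong[of _ _ Min] image_cong) auto

text \<open>A constant \<open>U\<close> carries no information and meets every rate. A non-empty
  index set is what allows \<open>theta_singleton\<close> to move the offset out of the
  supremum.\<close>

lemma kernels_nonempty:
  fixes pX :: "'x::finite pmf"
  assumes "0 \<le> R"
  shows "kernels pX R \<noteq> {}"
proof -
  have "law_XU pX (\<lambda>_. return_pmf 0) = mix_law (return_pmf 0) (\<lambda>_. pX)"
    by (simp add: law_XU_def mix_law_def bind_return_pmf)
  then have "mutual_info (law_XU pX (\<lambda>_. return_pmf 0)) = 0"
    by (simp add: mutual_info_mix_law bind_return_pmf)
  then have "(\<lambda>_. return_pmf 0) \<in> kernels pX R" using assms by (simp add: kernels_def)
  then show ?thesis by blast
qed

lemma theta_singleton: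
  fixes pX :: "'x::finite pmf"
  assumes "map_pmf snd (P i) = pX" "0 \<le> R" "d i \<noteq> -\<infinity>"
  shows "theta {i} pX P d R = xi (P i) (d i) R"
  using kernels_nonempty[OF assms(2), of pX] assms
  by (simp add: theta_def xi_def SUP_ereal_add_left)

theorem corollary1:
  fixes P :: "nat \<Rightarrow> ('y::finite \<times> 'x::finite) pmf"
    and PX :: "nat \<Rightarrow> 'x pmf"
    and QY :: "nat \<Rightarrow> nat \<Rightarrow> 'y list pmf"
    and QX :: "nat \<Rightarrow> nat \<Rightarrow> 'x list pmf"
    and m k r :: nat
    and DY DX :: "nat \<Rightarrow> nat \<Rightarrow> ereal"
    and \<nu> :: "nat pmf" and \<tau> :: "(nat \<times> nat) pmf"
    and Rc \<epsilon> :: real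
  defines "N \<equiv> card ((\<lambda>i. map_pmf snd (P i)) ` {1..m})"
    and "F \<equiv> \<lambda>s. {i\<in>{1..m}. map_pmf snd (P i) = PX s}"
    and "js \<equiv> \<lambda>i. first_argmin {1..k} (DY i)"
    and "ts \<equiv> \<lambda>s. first_argmin {1..r} (DX s)"
  defines "dyx \<equiv> \<lambda>i s. DY i (js i) + DX s (ts s)"
  defines "\<theta> \<equiv> \<lambda>s. theta (F s) (PX s) P (\<lambda>i. dyx i s) Rc"
    and "\<xi> \<equiv> \<lambda>i s. xi (P i) (dyx i s) Rc"
  defines "S \<equiv> {s\<in>{1..N}. \<theta> s < (MIN i\<in>F s. \<xi> i s)}"
  defines "PYX \<equiv> \<lambda>n. bind_pmf \<nu> (\<lambda>i. iid_pair n (P i))"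
    and "QYX \<equiv> \<lambda>n. bind_pmf \<tau> (\<lambda>(j, t). pair_pmf (QY j n) (QX t n))"
  assumes PX: "bij_betw PX {1..N} ((\<lambda>i. map_pmf snd (P i)) ` {1..m})"
    and standing:
      "(iid_family {1..m} {1..k} (\<lambda>i. map_pmf fst (P i)) QY DY \<and> iid_family {1..N} {1..r} PX QX DX) \<or>
       (markov_family {1..m} {1..k} (\<lambda>i. map_pmf fst (P i)) QY DY \<and> markov_family {1..N} {1..r} PX QX DX)"
    and \<nu>: "set_pmf \<nu> = {1..m}"
    and \<tau>: "set_pmf \<tau> \<subseteq> {1..k} \<times> {1..r}"
    and \<tau>_pos: "\<And>s i. s \<in> {1..N} \<Longrightarrow> i \<in> F s \<Longrightarrow> pmf \<tau> (js i, ts s) > 0"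
    and Rc: "Rc > 0"
    and \<epsilon>: "0 \<le> \<epsilon>" "\<epsilon> < 1"
    and \<epsilon>_small:
      "\<epsilon> < (MIN i\<in>{1..m}. pmf \<nu> i) * Min (insert 1 ((\<lambda>s. 1 / real (card (F s))) ` S))"
  shows "E_star PYX QYX \<epsilon> Rc = (MIN s\<in>{1..N}. \<theta> s)"
proof -
  have ne_m: "{1..m} \<noteq> {}" using set_pmf_not_empty[of \<nu>] unfolding \<nu> .
  have "set_pmf \<tau> \<noteq> {}" by (rule set_pmf_not_empty)
  then have ne_k: "{1..k} \<noteq> {}" and ne_r: "{1..r} \<noteq> {}" using \<tau> by auto
  have rateY: "divergence_rate (map_pmf fst (P i)) (QY j) (DY i j)" if "i \<in> {1..m}" "j \<in> {1..k}" for i j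
    using standing that
    by (auto dest: iid_family_divergence_rate[of _ _ _ _ _ i j] markov_family_divergence_rate[of _ _ _ _ _ i j])
  have rateX: "divergence_rate (PX s) (QX t) (DX s t)" if "s \<in> {1..N}" "t \<in> {1..r}" for s t
    using standing that
    by (auto dest: iid_family_divergence_rate[of _ _ _ _ _ s t] markov_family_divergence_rate[of _ _ _ _ _ s t])
  have minY: "(MIN j\<in>{1..k}. DY i j) < \<infinity>" if "i \<in> {1..m}" for i
    using standing that unfolding iid_family_def markov_family_def by blast
  have minX: "(MIN t\<in>{1..r}. DX s t) < \<infinity>" if "s \<in> {1..N}" for s
    using standing that unfolding iid_family_def markov_family_def by blast
  define dY where "dY = (\<lambda>i. real_of_ereal (DY i (js i)))"
  define dX where "dX = (\<lambda>s. real_of_ereal (DX s (ts s)))"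
  have js: "js i \<in> {1..k}" "\<And>j. j \<in> {1..k} \<Longrightarrow> DY i (js i) \<le> DY i j" for i
    unfolding js_def using first_argmin[OF finite_atLeastAtMost ne_k] by auto
  have ts: "ts s \<in> {1..r}" "\<And>t. t \<in> {1..r} \<Longrightarrow> DX s (ts s) \<le> DX s t" for s
    unfolding ts_def using first_argmin[OF finite_atLeastAtMost ne_r] by auto
  \<comment> \<open>The minimal rate is below infinity by the standing assumption, and above minus
    infinity because every divergence rate is.\<close>
  have dY: "DY i (js i) = ereal (dY i)" if "i \<in> {1..m}" for i
    unfolding dY_def js_def
    by (rule first_argmin_real[OF finite_atLeastAtMost ne_k minY[OF that]])
      (use rateY[OF that] in \<open>auto simp: divergence_rate_def\<close>)
  have dX: "DX s (ts s) = ereal (dX s)" if "s \<in> {1..N}" for s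
    unfolding dX_def ts_def
    by (rule first_argmin_real[OF finite_atLeastAtMost ne_r minX[OF that]])
      (use rateX[OF that] in \<open>auto simp: divergence_rate_def\<close>)
  have F: "finite (F s)" "F s \<subseteq> {1..m}" for s by (auto simp: F_def)
  have marg: "map_pmf snd (P i) = PX s" if "i \<in> F s" for s i using that by (simp add: F_def)
  have F_ne: "F s \<noteq> {}" if "s \<in> {1..N}" for s
  proof -
    have "PX s \<in> (\<lambda>i. map_pmf snd (P i)) ` {1..m}" using PX that by (auto simp: bij_betw_def)
    then show ?thesis by (auto simp: F_def)
  qed
  have cover: "\<exists>s\<in>{1..N}. i \<in> F s" if "i \<in> {1..m}" for i
  proof -
    have "map_pmf snd (P i) \<in> PX ` {1..N}" using PX that by (auto simp: bij_betw_def)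
    then show ?thesis using that by (auto simp: F_def)
  qed
  have ne_N: "{1..N} \<noteq> {}" using ne_m cover by fastforce
  have dyx: "dyx i s = ereal (dY i + dX s)" if "s \<in> {1..N}" "i \<in> F s" for i s
    using dY[of i] dX[OF that(1)] that(2) F(2)[of s] by (auto simp: dyx_def)
  have \<theta>: "\<theta> s = theta (F s) (PX s) P (\<lambda>i. ereal (dY i + dX s)) Rc" if "s \<in> {1..N}" for s
    unfolding \<theta>_def by (rule theta_cong) (use dyx that in auto)
  define \<nu>0 where "\<nu>0 = (MIN i\<in>{1..m}. pmf \<nu> i)"
  have \<nu>0: "0 < \<nu>0" "\<And>i. i \<in> {1..m} \<Longrightarrow> \<nu>0 \<le> pmf \<nu> i"
  proof -
    show "0 < \<nu>0" unfolding \<nu>0_def using ne_m by (subst Min_gr_iff) (auto intro!: pmf_positive simp: \<nu>)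
    show "\<nu>0 \<le> pmf \<nu> i" if "i \<in> {1..m}" for i unfolding \<nu>0_def using that by (intro Min_le) auto
  qed
  define B where "B = Min (insert 1 ((\<lambda>s. 1 / real (card (F s))) ` S))"
  have finS: "finite S" by (simp add: S_def)
  have B: "B \<le> 1" "\<And>s. s \<in> S \<Longrightarrow> B \<le> 1 / real (card (F s))" using finS by (auto simp: B_def)
  have "\<epsilon> < \<nu>0 * B" using \<epsilon>_small unfolding \<nu>0_def B_def .
  then have "\<epsilon> / \<nu>0 < B" using \<nu>0(1) by (simp add: pos_divide_less_eq mult.commute)
  \<comment> \<open>\<open>c\<close> will bound the type I error of each single component. The left
    inequality gives \<open>\<epsilon> < pmf \<nu> i * c\<close>; the right one gives
    \<open>real (card (F s)) * c < 1\<close> for \<open>s\<close> in \<open>S\<close>, and c < 1 in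
    every case.\<close>
  then obtain c where c: "\<epsilon> / \<nu>0 < c" "c < B" using dense by blast
  have c0: "0 \<le> c" using c(1) \<epsilon>(1) \<nu>0(1) by (meson divide_nonneg_pos le_less_trans less_imp_le)
  have c\<nu>: "\<epsilon> < pmf \<nu> i * c" if "i \<in> {1..m}" for i
  proof -
    have "\<epsilon> < \<nu>0 * c" using c(1) \<nu>0(1) by (simp add: pos_divide_less_eq mult.commute)
    also have "\<dots> \<le> pmf \<nu> i * c" using \<nu>0(2)[OF that] c0 by (rule mult_right_mono)
    finally show ?thesis .
  qed
  have upper: "ereal E \<le> \<theta> s" if ach: "achievable PYX QYX \<epsilon> Rc E" and s: "s \<in> {1..N}" for E s
  proof -
    \<comment> \<open>The converse is available for every non-empty subclass that is small enough
      for \<open>c\<close>; which one is taken depends on whether \<open>s\<close> lies in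
      \<open>S\<close>.\<close>
    have bound: "ereal E \<le> theta F' (PX s) P (\<lambda>i. ereal (dY i + dX s)) Rc"
      if F': "F' \<subseteq> F s" "F' \<noteq> {}" "real (card F') * c < 1" for F'
    proof (rule achievable_imp_le_theta[OF ach[unfolded PYX_def QYX_def], where j = js and t = "ts s" and c = c])
      show "finite F'" using F' F finite_subset by blast
      show "divergence_rate (map_pmf fst (P i)) (QY (js i)) (ereal (dY i))" if "i \<in> F'" for i
        using rateY[of i "js i"] js dY[of i] that F' F(2)[of s] by (auto simp: subset_iff)
      show "divergence_rate (PX s) (QX (ts s)) (ereal (dX s))"
        using rateX[OF s ts(1)[of s]] unfolding dX[OF s] .
      show "F' \<subseteq> set_pmf \<nu>" using F' F(2)[of s] by (auto simp: \<nu>)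
      show "\<epsilon> < pmf \<nu> i * c" if "i \<in> F'" for i using c\<nu> that F' F(2)[of s] by blast
    qed (use F' marg \<tau>_pos s Rc c0 in \<open>auto simp: \<nu>\<close>)
    show ?thesis
    proof (cases "s \<in> S")
      case True
      have pos: "0 < real (card (F s))" using F_ne[OF s] F by (simp add: card_gt_0_iff)
      have "c < 1 / real (card (F s))" using c(2) B(2)[OF True] by linarith
      then have "real (card (F s)) * c < 1" using pos by (simp add: field_simps)
      then show ?thesis using bound[of "F s"] F_ne[OF s] by (simp add: \<theta>[OF s])
    next
      case False
      \<comment> \<open>Here \<open>\<theta> s\<close> reaches the smallest single-component rate,
        so the converse for one minimizing component already gives the claim, and for it c < 1 is
        enough.\<close>
      have ne: "finite ((\<lambda>i. \<xi> i s) ` F s)" "(\<lambda>i. \<xi> i s) ` F s \<noteq> {}" using F F_ne[OF s] by auto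
      obtain i where i: "i \<in> F s" "\<xi> i s = (MIN i\<in>F s. \<xi> i s)" using Min_in[OF ne] by auto
      have "ereal E \<le> theta {i} (PX s) P (\<lambda>i. ereal (dY i + dX s)) Rc"
        using i c(2) B(1) by (intro bound) auto
      also have "\<dots> = xi (P i) (ereal (dY i + dX s)) Rc"
        by (rule theta_singleton) (use marg[OF i(1)] Rc in auto)
      also have "\<dots> = \<xi> i s" unfolding \<xi>_def dyx[OF s i(1)] ..
      also have "\<dots> \<le> \<theta> s" using False s by (simp add: i(2) S_def not_less)
      finally show ?thesis .
    qed
  qed
  show ?thesis
  proof (rule antisym)
    show "E_star PYX QYX \<epsilon> Rc \<le> (MIN s\<in>{1..N}. \<theta> s)"
      unfolding E_star_def using upper ne_N by (intro SUP_least) (subst Min_ge_iff, auto)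
    show "(MIN s\<in>{1..N}. \<theta> s) \<le> E_star PYX QYX \<epsilon> Rc"
    \<comment> \<open>Codes exist for exponents strictly below every \<open>\<theta> s\<close>,
      which determines the supremum.\<close>
    proof (rule dense_le)
      fix x assume x: "x < (MIN s\<in>{1..N}. \<theta> s)"
      show "x \<le> E_star PYX QYX \<epsilon> Rc"
      proof (cases x)
        case (real v)
        have v: "ereal v < \<theta> s" if "s \<in> {1..N}" for s
          using x that ne_N unfolding real by (subst (asm) Min_gr_iff) auto
        have "achievable PYX QYX \<epsilon> Rc v"
          unfolding PYX_def QYX_def
        proof (rule achievable_below_theta[where F = F and PX = PX and N = N and J = "{1..k}" and I = "{1..r}"
              and DY = DY and DX = DX and dY = dY and dX = dX])
          show "inj_on PX {1..N}" using PX by (rule bij_betw_imp_inj_on)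
          show "divergence_rate (map_pmf fst (P i)) (QY j) (DY i j)" if "i \<in> F s" "j \<in> {1..k}" for s i j
            using rateY[of i j] that F(2)[of s] by auto
          show "ereal (dY i) \<le> DY i j" if "i \<in> F s" "j \<in> {1..k}" for s i j
            using js(2)[OF that(2), of i] dY[of i] that F(2)[of s] by auto
          show "ereal (dX s) \<le> DX s t" if "s \<in> {1..N}" "t \<in> {1..r}" for s t
            using ts(2)[OF that(2), of s] dX[OF that(1)] by simp
          show "ereal v < theta (F s) (PX s) P (\<lambda>i. ereal (dY i + dX s)) Rc" if "s \<in> {1..N}" for s
            using v[OF that] \<theta>[OF that] by simp
        qed (use F F_ne cover \<tau> marg rateX \<epsilon> Rc in \<open>auto simp: \<nu>\<close>)
        then show ?thesis unfolding real E_star_def by (intro SUP_upper) simp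
      qed (use x in auto)
    qed
  qed
qed

end
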